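(* Let $(A,\mathfrak{m},k)$ be a commutative Noetherian local ring, let $M$ be a finitely generated $A$-module having free reducible complexity, i.e. $M \in \mathcal{C}^{frc}_A$, and let $t \ge 1$ be a natural number. Let $\mathcal{C}^{frc}_A(t)$ be the class of all modules $X \in \mathcal{C}^{frc}_A$ with $\operatorname{cx} X = t$. If for every $N \in \mathcal{C}^{frc}_A(t)$ one has $\operatorname{Ext}_A^i(M,N)=0$ for $i \gg 0$, then $\operatorname{cx} M < t$.
   Context: All modules are finitely generated. The $n$th Betti number of an $A$-module $M$ is $\beta_n(M) = \dim_k \operatorname{Ext}_A^n(M,k)$, and the complexity of $M$ is $\operatorname{cx} M = \inf \{ t \in \mathbb{Z}_{\ge 0} \mid \exists a \in \mathbb{R} \text{ such that } \beta_n(M) \le a n^{t-1} \text{ for } n \gg 0 \}$ (possibly infinite; $\operatorname{cx} M = 0$ if and only if the projective dimension of $M$ is finite). $\Omega_A^i(M)$ denotes the $i$th syzygy in the minimal free resolution $\cdots \to F_1 \to F_0 \to M \to 0$, with $\Omega_A^0(M)=M$. For a homogeneous element $\eta \in \operatorname{Ext}_A^d(M,M)$ with $d \ge 1$, choose a map $f_\eta \colon \Omega_A^d(M) \to M$ representing $\eta$; the module $K_\eta$ is the pushout of $f_\eta$ along the inclusion $\Omega_A^d(M) \to F_{d-1}$, so that there is an exact sequence $0 \to M \to K_\eta \to \Omega_A^{d-1}(M) \to 0$. Up to isomorphism $K_\eta$ does not depend on the choice of $f_\eta$. The class $\mathcal{C}^{frc}_A$ of modules having free reducible complexity consists of modules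 of finite complexity and is defined inductively: (i) every module of finite projective dimension belongs to $\mathcal{C}^{frc}_A$; (ii) a module $X$ of finite positive complexity belongs to $\mathcal{C}^{frc}_A$ if there is a homogeneous element $\eta \in \operatorname{Ext}_A^*(X,X)$ of positive degree such that $\operatorname{cx} K_\eta = \operatorname{cx} X - 1$ and $K_\eta \in \mathcal{C}^{frc}_A$. *)

theory Defs
  imports
    Complex_Main
    "HOL-Library.Extended_Nat"
    "HOL-Algebra.Ring_Divisibility"
    "Jordan_Normal_Form.Missing_VectorSpace"
begin

section \<open>Local rings\<close>

definition noetherian_local_ring :: "('a, 'r) ring_scheme \<Rightarrow> bool" where
  "noetherian_local_ring A \<longleftrightarrow> cring A \<and> noetherian_ring A \<and> (\<exists>!I. maximalideal I A)"

definition max_ideal :: "('a, 'r) ring_scheme \<Rightarrow> 'a set" where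
  "max_ideal A = (THE I. maximalideal I A)"

definition residue_field :: "('a, 'r) ring_scheme \<Rightarrow> 'a set ring" where
  "residue_field A = A Quot (max_ideal A)"


section \<open>Modules\<close>

text \<open>Every finitely generated \<open>A\<close>-module is a quotient of some \<open>A\<^sup>n\<close>, and its elements can be
  identified with the fibres of \<open>A\<^sup>n \<rightarrow> M\<close>. So each isomorphism class of finitely generated modules
  has a representative whose elements have the type \<open>(nat \<Rightarrow> 'a) set\<close>. Wherever all finitely
  generated modules have to be quantified over inside a formula, they are taken with this type.\<close>

type_synonym 'a umodule = "('a, (nat \<Rightarrow> 'a) set) module"

definition fin_gen :: "('a, 'r) ring_scheme \<Rightarrow> ('a, 'm, 'e) module_scheme \<Rightarrow> bool" where
  "fin_gen A M \<longleftrightarrow> module A M \<and>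
     (\<exists>S. finite S \<and> S \<subseteq> carrier M \<and> module.span A M S = carrier M)"

definition module_isomorphic ::
  "('a, 'r) ring_scheme \<Rightarrow> ('a, 'm, 'e) module_scheme \<Rightarrow> ('a, 'n, 'f) module_scheme \<Rightarrow> bool" where
  "module_isomorphic A M N \<longleftrightarrow>
     (\<exists>h \<in> module_hom A M N. bij_betw h (carrier M) (carrier N))"

text \<open>In the records below the fields \<open>mult\<close> and \<open>one\<close> are inherited from the type of rings and
  play no role for modules.\<close>

definition quotient_module ::
  "('a, 'm, 'e) module_scheme \<Rightarrow> 'm set \<Rightarrow> ('a, 'm set) module" where
  "quotient_module M H =
     \<lparr>carrier = a_rcosets\<^bsub>M\<^esub> H, mult = (\<lambda>_ _. H), one = H, zero = H, add = set_add M,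
      smult = (\<lambda>a C. \<Union>x\<in>C. H +>\<^bsub>M\<^esub> (a \<odot>\<^bsub>M\<^esub> x))\<rparr>"

definition Hom_module ::
  "('a, 'r) ring_scheme \<Rightarrow> ('a, 'm, 'e) module_scheme \<Rightarrow> ('a, 'n, 'f) module_scheme
     \<Rightarrow> ('a, 'm \<Rightarrow> 'n) module" where
  "Hom_module A M N =
     \<lparr>carrier = module_hom A M N \<inter> extensional (carrier M),
      mult = (\<lambda>_ _. \<lambda>x\<in>carrier M. \<zero>\<^bsub>N\<^esub>), one = (\<lambda>x\<in>carrier M. \<zero>\<^bsub>N\<^esub>),
      zero = (\<lambda>x\<in>carrier M. \<zero>\<^bsub>N\<^esub>),
      add = (\<lambda>f g. \<lambda>x\<in>carrier M. f x \<oplus>\<^bsub>N\<^esub> g x),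
      smult = (\<lambda>a f. \<lambda>x\<in>carrier M. a \<odot>\<^bsub>N\<^esub> f x)\<rparr>"

abbreviation free_module :: "('a, 'r) ring_scheme \<Rightarrow> nat \<Rightarrow> ('a, nat \<Rightarrow> 'a) module" where
  "free_module A n \<equiv> ring.func_space A {..<n}"

text \<open>The submodule \<open>IM\<close>.\<close>

definition ideal_times :: "('a, 'r) ring_scheme \<Rightarrow> 'a set \<Rightarrow> ('a, 'm, 'e) module_scheme \<Rightarrow> 'm set" where
  "ideal_times A I M = module.span A M {a \<odot>\<^bsub>M\<^esub> x | a x. a \<in> I \<and> x \<in> carrier M}"

definition residue_module :: "('a, 'r) ring_scheme \<Rightarrow> ('a, 'a set) module" where
  "residue_module A = (let k = residue_field A in
     \<lparr>carrier = carrier k, mult = mult k, one = one k, zero = zero k, add = add k,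
      smult = (\<lambda>a c. (max_ideal A +>\<^bsub>A\<^esub> a) \<otimes>\<^bsub>k\<^esub> c)\<rparr>)"

text \<open>An \<open>A\<close>-module annihilated by the maximal ideal, regarded as a vector space over the residue
  field: the residue class \<open>c\<close> acts as any of its representatives \<open>a \<in> c\<close> does.\<close>

definition over_residue_field ::
  "('a, 'r) ring_scheme \<Rightarrow> ('a, 'm, 'e) module_scheme \<Rightarrow> ('a set, 'm) module" where
  "over_residue_field A V =
     \<lparr>carrier = carrier V, mult = mult V, one = one V, zero = zero V, add = add V,
      smult = (\<lambda>c v. THE w. \<exists>a\<in>c. w = a \<odot>\<^bsub>V\<^esub> v)\<rparr>"


section \<open>Resolutions and projective dimension\<close>

text \<open>Exactness of \<open>\<dots> \<rightarrow> P 2 \<rightarrow> P 1 \<rightarrow> P 0 \<rightarrow> M \<rightarrow> 0\<close>, where \<open>d n\<close> is the map \<open>P n \<rightarrow> P (n - 1)\<close> for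
  \<open>n \<ge> 1\<close> (\<open>d 0\<close> is not used) and \<open>e\<close> is the augmentation \<open>P 0 \<rightarrow> M\<close>.\<close>

definition resolution ::
  "('a, 'r) ring_scheme \<Rightarrow> ('a, 'm, 'e) module_scheme \<Rightarrow> (nat \<Rightarrow> ('a, 'p) module)
     \<Rightarrow> (nat \<Rightarrow> 'p \<Rightarrow> 'p) \<Rightarrow> ('p \<Rightarrow> 'm) \<Rightarrow> bool" where
  "resolution A M P d e \<longleftrightarrow>
     (\<forall>n. module A (P n)) \<and>
     e \<in> module_hom A (P 0) M \<and>
     (\<forall>n. d (Suc n) \<in> module_hom A (P (Suc n)) (P n)) \<and>
     e ` carrier (P 0) = carrier M \<and>
     d 1 ` carrier (P 1) = {x \<in> carrier (P 0). e x = \<zero>\<^bsub>M\<^esub>} \<and>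
     (\<forall>n. d (Suc (Suc n)) ` carrier (P (Suc (Suc n))) =
            {x \<in> carrier (P (Suc n)). d (Suc n) x = \<zero>\<^bsub>P n\<^esub>})"

definition projective_module :: "('a, 'r) ring_scheme \<Rightarrow> ('a, 'p, 'e) module_scheme \<Rightarrow> bool" where
  "projective_module A P \<longleftrightarrow> fin_gen A P \<and>
     (\<forall>(Y :: 'a umodule) (Z :: 'a umodule) g f.
        fin_gen A Y \<longrightarrow> fin_gen A Z \<longrightarrow>
        g \<in> module_hom A Y Z \<longrightarrow> g ` carrier Y = carrier Z \<longrightarrow> f \<in> module_hom A P Z \<longrightarrow>
        (\<exists>h \<in> module_hom A P Y. \<forall>x \<in> carrier P. g (h x) = f x))"

definition proj_dim :: "('a, 'r) ring_scheme \<Rightarrow> ('a, 'm, 'e) module_scheme \<Rightarrow> enat" where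
  "proj_dim A M = Inf {enat n | n. \<exists>(P :: nat \<Rightarrow> 'a umodule) d e.
     resolution A M P d e \<and> (\<forall>i. projective_module A (P i)) \<and>
     (\<forall>i>n. carrier (P i) = {\<zero>\<^bsub>P i\<^esub>})}"

definition minimal_free_resolution ::
  "('a, 'r) ring_scheme \<Rightarrow> ('a, 'm, 'e) module_scheme \<Rightarrow> (nat \<Rightarrow> nat)
     \<Rightarrow> (nat \<Rightarrow> (nat \<Rightarrow> 'a) \<Rightarrow> nat \<Rightarrow> 'a) \<Rightarrow> ((nat \<Rightarrow> 'a) \<Rightarrow> 'm) \<Rightarrow> bool" where
  "minimal_free_resolution A M b d e \<longleftrightarrow>
     resolution A M (\<lambda>n. free_module A (b n)) d e \<and>
     (\<forall>n. d (Suc n) ` carrier (free_module A (b (Suc n)))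
            \<subseteq> ideal_times A (max_ideal A) (free_module A (b n)))"

text \<open>The minimal free resolution is unique up to isomorphism of complexes; one is chosen for each
  module.\<close>

definition min_res ::
  "('a, 'r) ring_scheme \<Rightarrow> ('a, 'm, 'e) module_scheme
     \<Rightarrow> (nat \<Rightarrow> nat) \<times> (nat \<Rightarrow> (nat \<Rightarrow> 'a) \<Rightarrow> nat \<Rightarrow> 'a) \<times> ((nat \<Rightarrow> 'a) \<Rightarrow> 'm)" where
  "min_res A M = (SOME (b, d, e). minimal_free_resolution A M b d e)"

definition res_module ::
  "('a, 'r) ring_scheme \<Rightarrow> ('a, 'm, 'e) module_scheme \<Rightarrow> nat \<Rightarrow> ('a, nat \<Rightarrow> 'a) module" where
  "res_module A M n = free_module A (fst (min_res A M) n)"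

definition res_map ::
  "('a, 'r) ring_scheme \<Rightarrow> ('a, 'm, 'e) module_scheme \<Rightarrow> nat \<Rightarrow> (nat \<Rightarrow> 'a) \<Rightarrow> nat \<Rightarrow> 'a" where
  "res_map A M = fst (snd (min_res A M))"

text \<open>The \<open>n\<close>th syzygy for \<open>n \<ge> 1\<close>, as a submodule of \<open>res_module A M (n - 1)\<close>.\<close>

definition syzygy ::
  "('a, 'r) ring_scheme \<Rightarrow> ('a, 'm, 'e) module_scheme \<Rightarrow> nat \<Rightarrow> ('a, nat \<Rightarrow> 'a) module" where
  "syzygy A M n =
     (res_module A M (n - 1))\<lparr>carrier := res_map A M n ` carrier (res_module A M n)\<rparr>"


section \<open>Ext, Betti numbers and complexity\<close>

definition Ext_cocycles ::
  "('a, 'r) ring_scheme \<Rightarrow> nat \<Rightarrow> ('a, 'm, 'e) module_scheme \<Rightarrow> ('a, 'n, 'f) module_scheme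
     \<Rightarrow> ((nat \<Rightarrow> 'a) \<Rightarrow> 'n) set" where
  "Ext_cocycles A n M N =
     {f \<in> carrier (Hom_module A (res_module A M n) N).
        \<forall>x \<in> carrier (res_module A M (Suc n)). f (res_map A M (Suc n) x) = \<zero>\<^bsub>N\<^esub>}"

definition Ext_coboundaries ::
  "('a, 'r) ring_scheme \<Rightarrow> nat \<Rightarrow> ('a, 'm, 'e) module_scheme \<Rightarrow> ('a, 'n, 'f) module_scheme
     \<Rightarrow> ((nat \<Rightarrow> 'a) \<Rightarrow> 'n) set" where
  "Ext_coboundaries A n M N =
     (if n = 0 then {\<zero>\<^bsub>Hom_module A (res_module A M 0) N\<^esub>}
      else (\<lambda>g. restrict (g \<circ> res_map A M n) (carrier (res_module A M n)))
             ` carrier (Hom_module A (res_module A M (n - 1)) N))"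

definition Ext ::
  "('a, 'r) ring_scheme \<Rightarrow> nat \<Rightarrow> ('a, 'm, 'e) module_scheme \<Rightarrow> ('a, 'n, 'f) module_scheme
     \<Rightarrow> ('a, ((nat \<Rightarrow> 'a) \<Rightarrow> 'n) set) module" where
  "Ext A n M N =
     quotient_module
       ((Hom_module A (res_module A M n) N)\<lparr>carrier := Ext_cocycles A n M N\<rparr>)
       (Ext_coboundaries A n M N)"

definition betti :: "('a, 'r) ring_scheme \<Rightarrow> ('a, 'm, 'e) module_scheme \<Rightarrow> nat \<Rightarrow> nat" where
  "betti A M n =
     vectorspace.dim (residue_field A) (over_residue_field A (Ext A n M (residue_module A)))"

definition complexity :: "('a, 'r) ring_scheme \<Rightarrow> ('a, 'm, 'e) module_scheme \<Rightarrow> enat" where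
  "complexity A M = Inf {enat t | t. \<exists>a::real.
     \<forall>\<^sub>F n in sequentially. real (betti A M n) \<le> a * real n powi (int t - 1)}"


section \<open>Free reducible complexity\<close>

text \<open>An element \<open>\<eta>\<close> of \<open>Ext\<close> is a coset, that is, the set of all cocycles in the class. The map \<open>f\<close>
  on the syzygy corresponds to the cocycle obtained by composing it with the resolution map
  onto the syzygy.\<close>

definition represents ::
  "('a, 'r) ring_scheme \<Rightarrow> nat \<Rightarrow> ('a, 'm, 'e) module_scheme \<Rightarrow> ('a, 'n, 'f) module_scheme
     \<Rightarrow> ((nat \<Rightarrow> 'a) \<Rightarrow> 'n) \<Rightarrow> ((nat \<Rightarrow> 'a) \<Rightarrow> 'n) set \<Rightarrow> bool" where
  "represents A n M N f \<eta> \<longleftrightarrow>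
     f \<in> module_hom A (syzygy A M n) N \<and>
     restrict (f \<circ> res_map A M n) (carrier (res_module A M n)) \<in> \<eta>"

text \<open>The pushout of \<open>f\<close>, defined on the \<open>n\<close>th syzygy, \<open>n \<ge> 1\<close>, along the inclusion of this syzygy into
  \<open>res_module A M (n - 1)\<close>.\<close>

definition K_module ::
  "('a, 'r) ring_scheme \<Rightarrow> nat \<Rightarrow> ('a, 'm, 'e) module_scheme \<Rightarrow> ((nat \<Rightarrow> 'a) \<Rightarrow> 'm)
     \<Rightarrow> ('a, ('m \<times> (nat \<Rightarrow> 'a)) set) module" where
  "K_module A n M f = (let F = res_module A M (n - 1) in
     quotient_module (direct_sum M F) ((\<lambda>x. (f x, \<ominus>\<^bsub>F\<^esub> x)) ` carrier (syzygy A M n)))"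

inductive frc :: "('a, 'r) ring_scheme \<Rightarrow> 'a umodule \<Rightarrow> bool" for A where
  finite_proj_dim: "\<lbrakk>fin_gen A X; proj_dim A X < \<infinity>\<rbrakk> \<Longrightarrow> frc A X"
| reduce: "\<lbrakk>fin_gen A X; 0 < complexity A X; complexity A X < \<infinity>;
     1 \<le> n; \<eta> \<in> carrier (Ext A n X X); represents A n X X f \<eta>;
     complexity A (K_module A n X f) = complexity A X - 1;
     module_isomorphic A K (K_module A n X f); frc A K\<rbrakk> \<Longrightarrow> frc A X"

text \<open>The class is closed under isomorphism, which extends it to modules of any element type.\<close>

definition free_reducible_complexity ::
  "('a, 'r) ring_scheme \<Rightarrow> ('a, 'm, 'e) module_scheme \<Rightarrow> bool" where
  "free_reducible_complexity A M \<longleftrightarrow>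
     fin_gen A M \<and> (\<exists>X :: 'a umodule. frc A X \<and> module_isomorphic A X M)"

definition frc_class :: "('a, 'r) ring_scheme \<Rightarrow> nat \<Rightarrow> 'a umodule set" where
  "frc_class A t = {X. frc A X \<and> complexity A X = enat t}"

end

theory Submission
  imports Defs
begin

text \<open>
  Let \<open>\<eta>\<close> reduce the complexity of \<open>X\<close> and let \<open>F\<close> be the minimal free resolution of \<open>X\<close>. Lifting
  \<open>\<eta>\<close> to a chain map \<open>\<Phi>\<close> of \<open>F\<close> of degree \<open>-q\<close>, the mapping cone of \<open>\<Phi>\<close> resolves \<open>K\<^sub>\<eta>\<close>. Two
  consequences are used. First, if \<open>Ext(X, N)\<close> vanishes in high degrees, so does \<open>Ext(K\<^sub>\<eta>, N)\<close>; hence one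
  can pass from \<open>M\<close> along its chain of reductions to a module \<open>X\<close> of complexity exactly \<open>t\<close>, and then
  \<open>Ext(X, X)\<close> vanishes in high degrees. Second, \<open>F\<^sub>i\<close> is generated modulo the maximal ideal by
  \<open>\<Phi>(F\<^bsub>i+q\<^esub>)\<close> and \<open>\<beta>\<^sub>i(K\<^sub>\<eta>)\<close> further elements. Since \<open>Ext(X, X)\<close> vanishes in high degrees, some power
  \<open>\<Phi>\<^sup>k\<close> is null-homotopic and so maps into the maximal ideal times \<open>F\<close>. Iterating the generation statement,
  \<open>\<beta>\<^sub>i(X)\<close> is at most the sum of \<open>\<beta>\<^bsub>i+jq\<^esub>(K\<^sub>\<eta>)\<close> over \<open>j < k\<close>, which contradicts the drop in complexity.
\<close>

section \<open>Module homomorphisms\<close>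

text \<open>Every reduction lowers the complexity by exactly one and a chain ends at complexity 0,
  so no value between 1 and the initial complexity is skipped. The power
  \<open>\<Phi>\<^sup>k\<close> is controlled as follows: composed with the augmentation it is a
  cocycle for a power of the class, and once this is a coboundary, \<open>\<Phi>\<^sup>k\<close> is
  a sum of terms in which a differential is composed with a homotopy. Differentials of a minimal
  resolution land in the maximal ideal times the next term, hence so does
  \<open>\<Phi>\<^sup>k\<close>. The same fact makes Betti numbers equal to ranks. The obstacle is
  that the cone is neither minimal nor built from modules of the form \<open>free_module\<close>,
  whereas \<open>Ext\<close> is computed from one chosen minimal resolution. Therefore vanishing is
  expressed by cochains on an arbitrary resolution, projectivity is replaced by lifting along the
  maps of a single given resolution, and resolutions are compared through one identity,
  \<open>x = \<beta> (\<alpha> x) + d (s x) + s (d x)\<close>, from which both the rank estimates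
  and the transfer of vanishing are read off.\<close>

lemma module_homI:
  assumes "\<And>x. x \<in> carrier M \<Longrightarrow> f x \<in> carrier N"
    and "\<And>x y. x \<in> carrier M \<Longrightarrow> y \<in> carrier M \<Longrightarrow> f (x \<oplus>\<^bsub>M\<^esub> y) = f x \<oplus>\<^bsub>N\<^esub> f y"
    and "\<And>r x. r \<in> carrier A \<Longrightarrow> x \<in> carrier M \<Longrightarrow> f (r \<odot>\<^bsub>M\<^esub> x) = r \<odot>\<^bsub>N\<^esub> f x"
  shows "f \<in> module_hom A M N"
  using assms unfolding module_hom_def by auto

lemma module_hom_in: "f \<in> module_hom A M N \<Longrightarrow> x \<in> carrier M \<Longrightarrow> f x \<in> carrier N"
  unfolding module_hom_def by auto

lemma mod_homI: "module A M \<Longrightarrow> module A N \<Longrightarrow> f \<in> module_hom A M N \<Longrightarrow> mod_hom A M N f"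
  by (simp add: mod_hom_def mod_hom_axioms_def)

lemma module_hom_zero:
  "module A M \<Longrightarrow> module A N \<Longrightarrow> f \<in> module_hom A M N \<Longrightarrow> f \<zero>\<^bsub>M\<^esub> = \<zero>\<^bsub>N\<^esub>"
  using mod_hom.f0_is_0[OF mod_homI] .

lemma module_hom_neg:
  "module A M \<Longrightarrow> module A N \<Longrightarrow> f \<in> module_hom A M N \<Longrightarrow> x \<in> carrier M \<Longrightarrow>
    f (\<ominus>\<^bsub>M\<^esub> x) = \<ominus>\<^bsub>N\<^esub> f x"
  using mod_hom.f_neg[OF mod_homI] .

lemma module_hom_diff:
  "module A M \<Longrightarrow> module A N \<Longrightarrow> f \<in> module_hom A M N \<Longrightarrow> x \<in> carrier M \<Longrightarrow> y \<in> carrier M \<Longrightarrow>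
    f (x \<ominus>\<^bsub>M\<^esub> y) = f x \<ominus>\<^bsub>N\<^esub> f y"
  using mod_hom.f_minus[OF mod_homI] .

lemma module_hom_id: "(\<lambda>x. x) \<in> module_hom A M M"
  unfolding module_hom_def by auto

lemma module_hom_comp:
  "f \<in> module_hom A M N \<Longrightarrow> g \<in> module_hom A N L \<Longrightarrow> (\<lambda>x. g (f x)) \<in> module_hom A M L"
  unfolding module_hom_def by (auto simp: Pi_iff)

lemma module_hom_const_zero:
  assumes "module A N"
  shows "(\<lambda>x. \<zero>\<^bsub>N\<^esub>) \<in> module_hom A M N"
proof -
  interpret N: module A N by fact
  show ?thesis by (rule module_homI) auto
qed

lemma module_hom_plus:
  assumes "module A N" "f \<in> module_hom A M N" "g \<in> module_hom A M N"
  shows "(\<lambda>x. f x \<oplus>\<^bsub>N\<^esub> g x) \<in> module_hom A M N"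
proof -
  interpret N: module A N by fact
  note [simp] = module_hom_in[OF assms(2)] module_hom_in[OF assms(3)]
  show ?thesis
    by (rule module_homI)
      (simp_all add: module_hom_add[OF assms(2)] module_hom_add[OF assms(3)]
        module_hom_smult[OF assms(2)] module_hom_smult[OF assms(3)] N.a_ac N.smult_r_distr)
qed

lemma module_hom_uminus:
  assumes "module A N" "f \<in> module_hom A M N"
  shows "(\<lambda>x. \<ominus>\<^bsub>N\<^esub> f x) \<in> module_hom A M N"
proof -
  interpret N: module A N by fact
  note [simp] = module_hom_in[OF assms(2)]
  show ?thesis
    by (rule module_homI)
      (simp_all add: module_hom_add[OF assms(2)] module_hom_smult[OF assms(2)]
        N.smult_r_minus N.minus_add)
qed

lemma module_hom_minus:
  assumes "module A N" "f \<in> module_hom A M N" "g \<in> module_hom A M N"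
  shows "(\<lambda>x. f x \<ominus>\<^bsub>N\<^esub> g x) \<in> module_hom A M N"
  unfolding a_minus_def using assms by (intro module_hom_plus module_hom_uminus)

lemma module_hom_finsum:
  assumes "module A M" "module A N" "f \<in> module_hom A M N" "finite I" "g \<in> I \<rightarrow> carrier M"
  shows "f (finsum M g I) = finsum N (\<lambda>i. f (g i)) I"
proof -
  interpret M: module A M by fact
  interpret N: module A N by fact
  note [simp] = module_hom_in[OF assms(3)]
  from assms(4,5) show ?thesis
  proof (induct I)
    case empty
    show ?case by (simp add: module_hom_zero[OF assms(1-3)])
  next
    case (insert i I)
    then have "g \<in> I \<rightarrow> carrier M" "g i \<in> carrier M" by auto
    moreover from this have "(\<lambda>i. f (g i)) \<in> I \<rightarrow> carrier N" by (auto simp: Pi_iff)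
    ultimately show ?case
      using insert by (simp add: module_hom_add[OF assms(3)])
  qed
qed


section \<open>Submodules: negatives, kernels and finite sums\<close>

lemma submodule_neg:
  assumes "submodule A S M" "x \<in> S"
  shows "\<ominus>\<^bsub>M\<^esub> x \<in> S"
proof -
  interpret S: submodule A S M by fact
  interpret M: module A M by (rule S.module)
  have "(\<ominus>\<^bsub>A\<^esub> \<one>\<^bsub>A\<^esub>) \<odot>\<^bsub>M\<^esub> x \<in> S" using assms(2) by (intro S.smult_closed) auto
  then show ?thesis using M.smult_minus_1[of x] assms(2) S.subset by (metis subsetD)
qed

lemma submodule_diff:
  assumes "submodule A S M" "x \<in> S" "y \<in> S"
  shows "x \<ominus>\<^bsub>M\<^esub> y \<in> S"
  unfolding a_minus_def by (rule submodule.m_closed[OF assms(1,2) submodule_neg[OF assms(1,3)]])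

lemma kernel_submodule:
  assumes "module A M" "module A N" "f \<in> module_hom A M N"
  shows "submodule A {x \<in> carrier M. f x = \<zero>\<^bsub>N\<^esub>} M"
  using mod_hom.ker_is_submodule[OF mod_homI[OF assms]]
  unfolding mod_hom.ker_def[OF mod_homI[OF assms]] .

lemma submodule_finsum:
  assumes "submodule A N M" "finite I" "f \<in> I \<rightarrow> N"
  shows "finsum M f I \<in> N"
proof -
  interpret N: submodule A N M by fact
  interpret M: module A M by (rule N.module)
  from assms(2,3) show ?thesis
  proof (induct I)
    case (insert i I)
    then have "f \<in> I \<rightarrow> carrier M" "f i \<in> carrier M" using N.subset by auto
    then show ?case using insert by auto
  qed auto
qed


section \<open>Linear combinations of finite families and free modules\<close>

text \<open>Numbering the vectors, instead of taking a finite set of them, permits repetitions and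
  makes the coefficients an element of \<open>free_module A n\<close>. A generating family thus
  becomes a surjection from a free module.\<close>

definition fam_comb ::
  "('a, 'm, 'e) module_scheme \<Rightarrow> (nat \<Rightarrow> 'm) \<Rightarrow> nat \<Rightarrow> (nat \<Rightarrow> 'a) \<Rightarrow> 'm" where
  "fam_comb M v n c = finsum M (\<lambda>i. c i \<odot>\<^bsub>M\<^esub> v i) {..<n}"

text \<open>The standard basis vectors. The restriction is there because elements of a free module
  are extensional functions.\<close>

definition unit_fun :: "('a, 'r) ring_scheme \<Rightarrow> nat \<Rightarrow> nat \<Rightarrow> nat \<Rightarrow> 'a" where
  "unit_fun A n i = (\<lambda>j\<in>{..<n}. if j = i then \<one>\<^bsub>A\<^esub> else \<zero>\<^bsub>A\<^esub>)"

lemma free_carrier: "ring A \<Longrightarrow> carrier (free_module A n) = {..<n} \<rightarrow>\<^sub>E carrier A"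
  by (simp add: ring.func_space_def)

lemma free_zero: "ring A \<Longrightarrow> i < n \<Longrightarrow> \<zero>\<^bsub>free_module A n\<^esub> i = \<zero>\<^bsub>A\<^esub>"
  by (simp add: ring.func_space_def)

lemma free_add: "ring A \<Longrightarrow> i < n \<Longrightarrow> (x \<oplus>\<^bsub>free_module A n\<^esub> y) i = x i \<oplus>\<^bsub>A\<^esub> y i"
  by (simp add: ring.func_space_def)

lemma free_smult: "ring A \<Longrightarrow> i < n \<Longrightarrow> (a \<odot>\<^bsub>free_module A n\<^esub> y) i = a \<otimes>\<^bsub>A\<^esub> y i"
  by (simp add: ring.func_space_def)

lemma free_module_module: "cring A \<Longrightarrow> module A (free_module A n)"
  by (rule cring.func_space_is_module)

lemma free_in: "ring A \<Longrightarrow> x \<in> carrier (free_module A n) \<Longrightarrow> i < n \<Longrightarrow> x i \<in> carrier A"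
  by (auto simp: free_carrier)

lemma free_eqI:
  "ring A \<Longrightarrow> x \<in> carrier (free_module A n) \<Longrightarrow> y \<in> carrier (free_module A n) \<Longrightarrow>
    (\<And>i. i < n \<Longrightarrow> x i = y i) \<Longrightarrow> x = y"
  by (metis PiE_ext free_carrier lessThan_iff)

lemma free_minus:
  assumes "cring A" "i < n" "x \<in> carrier (free_module A n)"
  shows "(\<ominus>\<^bsub>free_module A n\<^esub> x) i = \<ominus>\<^bsub>A\<^esub> x i"
  using cring.func_space_neg[OF assms(1,3)] assms(2) by simp

lemma free_diff:
  assumes "cring A" "i < n" "x \<in> carrier (free_module A n)" "y \<in> carrier (free_module A n)"
  shows "(x \<ominus>\<^bsub>free_module A n\<^esub> y) i = x i \<ominus>\<^bsub>A\<^esub> y i"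
proof -
  interpret cring A by fact
  interpret F: module A "free_module A n" by (rule free_module_module) fact
  show ?thesis
    using assms unfolding a_minus_def by (simp add: free_add[OF ring_axioms] free_minus)
qed

lemma unit_fun_in: "ring A \<Longrightarrow> unit_fun A n i \<in> carrier (free_module A n)"
  by (auto simp: free_carrier unit_fun_def ring.ring_simprules)

lemma free_finsum:
  assumes "cring A" "finite I" "g \<in> I \<rightarrow> carrier (free_module A n)" "j < n"
  shows "(finsum (free_module A n) g I) j = finsum A (\<lambda>i. g i j) I"
proof -
  interpret A: cring A by fact
  interpret F: module A "free_module A n" by (rule free_module_module) fact
  from assms(2,3) show ?thesis
  proof (induct I)
    case empty
    show ?case using assms(4) by (simp add: free_zero[OF A.ring_axioms])
  next
    case (insert i I)
    then have "g \<in> I \<rightarrow> carrier (free_module A n)" "g i \<in> carrier (free_module A n)" by auto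
    moreover from this have "(\<lambda>i. g i j) \<in> I \<rightarrow> carrier A"
      using assms(4) by (auto simp: free_carrier[OF A.ring_axioms])
    moreover have "g i j \<in> carrier A"
      using calculation(2) assms(4) by (auto simp: free_carrier[OF A.ring_axioms])
    ultimately show ?case
      using insert assms(4) by (simp add: free_add[OF A.ring_axioms])
  qed
qed

lemma fam_comb_closed:
  assumes "module A M" "v \<in> {..<n} \<rightarrow> carrier M" "c \<in> {..<n} \<rightarrow> carrier A"
  shows "fam_comb M v n c \<in> carrier M"
proof -
  interpret module A M by fact
  show ?thesis unfolding fam_comb_def using assms(2,3) by (intro finsum_closed) auto
qed

lemma fam_comb_cong:
  assumes "module A M" "v \<in> {..<n} \<rightarrow> carrier M" "c \<in> {..<n} \<rightarrow> carrier A"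
    and "\<And>i. i < n \<Longrightarrow> v i = v' i" "\<And>i. i < n \<Longrightarrow> c i = c' i"
  shows "fam_comb M v n c = fam_comb M v' n c'"
proof -
  interpret module A M by fact
  show ?thesis unfolding fam_comb_def using assms by (intro finsum_cong') (auto simp: Pi_iff)
qed

lemma hom_fam_comb:
  assumes "module A M" "module A N" "f \<in> module_hom A M N"
    and "v \<in> {..<n} \<rightarrow> carrier M" "c \<in> {..<n} \<rightarrow> carrier A"
  shows "f (fam_comb M v n c) = fam_comb N (\<lambda>i. f (v i)) n c"
proof -
  interpret M: module A M by fact
  interpret N: module A N by fact
  have "f (fam_comb M v n c) = finsum N (\<lambda>i. f (c i \<odot>\<^bsub>M\<^esub> v i)) {..<n}"
    unfolding fam_comb_def using assms by (intro module_hom_finsum[of A]) auto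
  also have "\<dots> = fam_comb N (\<lambda>i. f (v i)) n c"
    unfolding fam_comb_def using assms(4,5) module_hom_in[OF assms(3)]
    by (intro N.finsum_cong') (auto simp: Pi_iff module_hom_smult[OF assms(3)])
  finally show ?thesis .
qed

lemma fam_comb_hom:
  assumes "module A M" "v \<in> {..<n} \<rightarrow> carrier M"
  shows "fam_comb M v n \<in> module_hom A (free_module A n) M"
proof -
  interpret M: module A M by fact
  interpret F: module A "free_module A n" by (rule free_module_module[OF M.is_cring])
  note ring = M.ring_axioms
  have v: "v i \<in> carrier M" if "i < n" for i using assms(2) that by auto
  have c: "x i \<in> carrier A" if "x \<in> carrier (free_module A n)" "i < n" for x i
    using free_in[OF ring that] .
  show ?thesis
  proof (rule module_homI)
    fix x assume x: "x \<in> carrier (free_module A n)"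
    then show "fam_comb M v n x \<in> carrier M"
      using c by (intro fam_comb_closed[OF assms]) auto
    fix y assume y: "y \<in> carrier (free_module A n)"
    have "fam_comb M v n (x \<oplus>\<^bsub>free_module A n\<^esub> y)
        = finsum M (\<lambda>i. x i \<odot>\<^bsub>M\<^esub> v i \<oplus>\<^bsub>M\<^esub> y i \<odot>\<^bsub>M\<^esub> v i) {..<n}"
      unfolding fam_comb_def using x y v c
      by (intro M.finsum_cong') (auto simp: free_add[OF ring] M.smult_l_distr)
    also have "\<dots> = fam_comb M v n x \<oplus>\<^bsub>M\<^esub> fam_comb M v n y"
      unfolding fam_comb_def using x y v c by (intro M.finsum_addf) auto
    finally show "fam_comb M v n (x \<oplus>\<^bsub>free_module A n\<^esub> y) = \<dots>" .
  next
    fix r x assume r: "r \<in> carrier A" and x: "x \<in> carrier (free_module A n)"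
    have "fam_comb M v n (r \<odot>\<^bsub>free_module A n\<^esub> x) = finsum M (\<lambda>i. r \<odot>\<^bsub>M\<^esub> (x i \<odot>\<^bsub>M\<^esub> v i)) {..<n}"
      unfolding fam_comb_def using x v c r
      by (intro M.finsum_cong') (auto simp: free_smult[OF ring] M.smult_assoc1)
    also have "\<dots> = r \<odot>\<^bsub>M\<^esub> fam_comb M v n x"
      unfolding fam_comb_def using x v c r by (intro M.finsum_smult[symmetric]) auto
    finally show "fam_comb M v n (r \<odot>\<^bsub>free_module A n\<^esub> x) = r \<odot>\<^bsub>M\<^esub> fam_comb M v n x" .
  qed
qed

lemma fam_comb_unit:
  assumes "module A M" "v \<in> {..<n} \<rightarrow> carrier M" "i < n"
  shows "fam_comb M v n (unit_fun A n i) = v i"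
proof -
  interpret M: module A M by fact
  have "fam_comb M v n (unit_fun A n i)
      = finsum M (\<lambda>j. if i = j then v j else \<zero>\<^bsub>M\<^esub>) {..<n}"
    unfolding fam_comb_def using assms(2,3)
    by (intro M.finsum_cong') (auto simp: unit_fun_def Pi_iff)
  also have "\<dots> = v i"
    using assms(2,3) by (intro M.add.finprod_singleton) auto
  finally show ?thesis .
qed

lemma free_decomp:
  assumes "cring A" "x \<in> carrier (free_module A n)"
  shows "fam_comb (free_module A n) (unit_fun A n) n x = x"
proof -
  let ?F = "free_module A n"
  interpret A: cring A by fact
  interpret F: module A "?F" by (rule free_module_module) fact
  note ring = A.ring_axioms
  have c: "x i \<in> carrier A" if "i < n" for i
    using free_in[OF ring assms(2) that] .
  have u: "unit_fun A n \<in> {..<n} \<rightarrow> carrier (?F)"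
    using unit_fun_in[OF ring] by auto
  show ?thesis
  proof (rule free_eqI[OF ring _ assms(2)])
    show "fam_comb (?F) (unit_fun A n) n x \<in> carrier (?F)"
      using c u by (intro fam_comb_closed[OF F.module_axioms]) auto
    fix j assume j: "j < n"
    have "fam_comb (?F) (unit_fun A n) n x j
        = finsum A (\<lambda>i. (x i \<odot>\<^bsub>?F\<^esub> unit_fun A n i) j) {..<n}"
      unfolding fam_comb_def using c u j by (intro free_finsum[OF assms(1)]) auto
    also have "\<dots> = finsum A (\<lambda>i. if j = i then x i else \<zero>\<^bsub>A\<^esub>) {..<n}"
      using j c by (intro A.finsum_cong') (auto simp: free_smult[OF ring] unit_fun_def)
    also have "\<dots> = x j"
      using j c by (intro A.add.finprod_singleton) auto
    finally show "fam_comb (?F) (unit_fun A n) n x j = x j" .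
  qed
qed

lemma free_hom_fam_comb:
  assumes "module A M" "f \<in> module_hom A (free_module A n) M" "x \<in> carrier (free_module A n)"
  shows "f x = fam_comb M (\<lambda>i. f (unit_fun A n i)) n x"
proof -
  interpret M: module A M by fact
  have F: "module A (free_module A n)" by (rule free_module_module[OF M.is_cring])
  have "f x = f (fam_comb (free_module A n) (unit_fun A n) n x)"
    using free_decomp[OF M.is_cring assms(3)] by simp
  also have "\<dots> = fam_comb M (\<lambda>i. f (unit_fun A n i)) n x"
    using unit_fun_in[OF M.ring_axioms] free_in[OF M.ring_axioms assms(3)]
    by (intro hom_fam_comb[OF F assms(1,2)]) auto
  finally show ?thesis .
qed

lemma fam_comb_append:
  assumes "module A M" "v \<in> {..<n} \<rightarrow> carrier M" "c \<in> {..<n} \<rightarrow> carrier A"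
    and "w \<in> {..<m} \<rightarrow> carrier M" "d \<in> {..<m} \<rightarrow> carrier A"
  shows "fam_comb M v n c \<oplus>\<^bsub>M\<^esub> fam_comb M w m d =
    fam_comb M (\<lambda>i. if i < n then v i else w (i - n)) (n + m) (\<lambda>i. if i < n then c i else d (i - n))"
proof -
  interpret M: module A M by fact
  let ?g = "\<lambda>i. (if i < n then c i else d (i - n)) \<odot>\<^bsub>M\<^esub> (if i < n then v i else w (i - n))"
  have split: "{..<n + m} = {..<n} \<union> (\<lambda>i. n + i) ` {..<m}"
  proof (rule Set.set_eqI, rule iffI)
    fix i assume i: "i \<in> {..<n + m}"
    show "i \<in> {..<n} \<union> (\<lambda>i. n + i) ` {..<m}"
      using i by (cases "i < n") (auto intro!: image_eqI[of _ _ "i - n"])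
  qed auto
  have "finsum M ?g {..<n + m} = finsum M ?g {..<n} \<oplus>\<^bsub>M\<^esub> finsum M ?g ((\<lambda>i. n + i) ` {..<m})"
    unfolding split using assms(2-5) by (intro M.finsum_Un_disjoint) (auto simp: Pi_iff)
  also have "finsum M ?g {..<n} = fam_comb M v n c"
    unfolding fam_comb_def using assms(2,3) by (intro M.finsum_cong') auto
  also have "finsum M ?g ((\<lambda>i. n + i) ` {..<m}) = finsum M (\<lambda>i. ?g (n + i)) {..<m}"
    using assms(4,5) by (intro M.add.finprod_reindex) (auto simp: Pi_iff)
  also have "\<dots> = fam_comb M w m d"
    unfolding fam_comb_def using assms(4,5) by (intro M.finsum_cong') auto
  finally show ?thesis unfolding fam_comb_def by simp
qed

text \<open>The image of the homomorphism \<open>fam_comb M v n\<close> is a submodule containing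
  each \<open>v i\<close>, as the image of a basis vector; conversely a submodule is closed under
  combinations.\<close>

lemma fam_comb_span:
  assumes "module A M" "v \<in> {..<n} \<rightarrow> carrier M"
  shows "module.span A M (v ` {..<n}) = fam_comb M v n ` carrier (free_module A n)"
proof -
  interpret M: module A M by fact
  have F: "module A (free_module A n)" by (rule free_module_module[OF M.is_cring])
  interpret h: mod_hom A "free_module A n" M "fam_comb M v n"
    by (intro mod_homI F fam_comb_hom assms)
  have vM: "v ` {..<n} \<subseteq> carrier M" using assms(2) by auto
  show ?thesis
  proof
    have "v i \<in> fam_comb M v n ` carrier (free_module A n)" if "i < n" for i
      using fam_comb_unit[OF assms that] unit_fun_in[OF M.ring_axioms, of n i] by force
    then show "M.span (v ` {..<n}) \<subseteq> fam_comb M v n ` carrier (free_module A n)"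
      using M.span_is_subset[OF _ h.im_is_submodule, of "v ` {..<n}"] by (auto simp: h.im_def)
    interpret S: submodule A "M.span (v ` {..<n})" M by (rule M.span_is_submodule[OF vM])
    have S: "module A (M.md (M.span (v ` {..<n})))"
      by (rule M.submodule_is_module[OF S.submodule_axioms])
    have "fam_comb M v n c \<in> M.span (v ` {..<n})" if c: "c \<in> carrier (free_module A n)" for c
    proof -
      \<comment> \<open>The combination is formed inside the span, where closure is clear, and then
        carried to \<open>M\<close> by the inclusion homomorphism.\<close>
      have "fam_comb (M.md (M.span (v ` {..<n}))) v n c \<in> M.span (v ` {..<n})"
        using fam_comb_closed[OF S, of v n c] M.in_own_span[OF vM] free_in[OF M.ring_axioms c] by auto
      moreover have "fam_comb (M.md (M.span (v ` {..<n}))) v n c = fam_comb M v n c"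
      proof -
        have "(\<Oplus>\<^bsub>M.md (M.span (v ` {..<n}))\<^esub>i\<in>{..<n}. c i \<odot>\<^bsub>M\<^esub> v i) = (\<Oplus>\<^bsub>M\<^esub>i\<in>{..<n}. c i \<odot>\<^bsub>M\<^esub> v i)"
          if "c \<in> {..<n} \<rightarrow> carrier A"
        proof -
          have id: "(\<lambda>x. x) \<in> module_hom A (M.md (M.span (v ` {..<n}))) M"
            using S.subset by (intro module_homI) auto
          show ?thesis
            using that M.in_own_span[OF vM]
            by (intro module_hom_finsum[OF S M.module_axioms id]) auto
        qed
        then show ?thesis
          using free_in[OF M.ring_axioms c] by (simp add: fam_comb_def)
      qed
      ultimately show ?thesis by simp
    qed
    then show "fam_comb M v n ` carrier (free_module A n) \<subseteq> M.span (v ` {..<n})" by auto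
  qed
qed

section \<open>Finite generation by numbered families\<close>

lemma finite_enum:
  assumes "finite S"
  obtains v where "S = v ` {..<card S}"
  using ex_bij_betw_nat_finite[OF assms] by (metis bij_betw_imp_surj_on lessThan_atLeast0)

lemma fin_gen_iff:
  "fin_gen A M \<longleftrightarrow> module A M \<and>
     (\<exists>n v. v \<in> {..<n} \<rightarrow> carrier M \<and> fam_comb M v n ` carrier (free_module A n) = carrier M)"
  (is "?L \<longleftrightarrow> ?R")
proof
  assume ?L
  then obtain S where M: "module A M" and S: "finite S" "S \<subseteq> carrier M" "module.span A M S = carrier M"
    unfolding fin_gen_def by blast
  obtain v where v: "S = v ` {..<card S}" using finite_enum[OF S(1)] .
  have "v \<in> {..<card S} \<rightarrow> carrier M" using v S(2) by auto
  then show ?R using M S(3) v fam_comb_span[OF M, of v "card S"] by metis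
next
  assume ?R
  then obtain n v where M: "module A M" and v: "v \<in> {..<n} \<rightarrow> carrier M"
    "fam_comb M v n ` carrier (free_module A n) = carrier M" by blast
  then show ?L
    unfolding fin_gen_def using fam_comb_span[OF M v(1)]
    by (intro conjI exI[of _ "v ` {..<n}"]) auto
qed

lemma fin_gen_module: "fin_gen A M \<Longrightarrow> module A M"
  by (simp add: fin_gen_def)

lemma fin_gen_image:
  assumes "fin_gen A M" "module A N" "g \<in> module_hom A M N" "g ` carrier M = carrier N"
  shows "fin_gen A N"
proof -
  obtain n v where M: "module A M" and v: "v \<in> {..<n} \<rightarrow> carrier M"
    and s: "fam_comb M v n ` carrier (free_module A n) = carrier M"
    using assms(1) unfolding fin_gen_iff by blast
  interpret M: module A M by fact
  have "fam_comb N (\<lambda>i. g (v i)) n ` carrier (free_module A n)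
     = g ` (fam_comb M v n ` carrier (free_module A n))"
    unfolding image_image using free_in[OF M.ring_axioms]
    by (intro image_cong refl hom_fam_comb[symmetric, OF M assms(2,3) v(1)]) auto
  then show ?thesis
    unfolding fin_gen_iff s assms(4) using v assms(2) module_hom_in[OF assms(3)]
    by (intro conjI exI[of _ n] exI[of _ "\<lambda>i. g (v i)"]) auto
qed

lemma fin_gen_free: "cring A \<Longrightarrow> fin_gen A (free_module A n)"
  unfolding fin_gen_iff using free_module_module[of A n] unit_fun_in[OF cring.axioms(1), of A n]
    free_decomp[of A _ n]
  by (intro conjI exI[of _ n] exI[of _ "unit_fun A n"]) force+


section \<open>Lifting along homomorphisms\<close>

text \<open>Projectivity for one fixed \<open>g\<close>. It speaks of the image of \<open>g\<close>
  rather than of surjective maps, so it applies directly to differentials, and fixing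
  \<open>Y\<close> and \<open>Z\<close> frees it from quantifying over modules of one element
  type.\<close>

definition lifts ::
  "('a, 'r) ring_scheme \<Rightarrow> ('a, 'p, 'e) module_scheme \<Rightarrow> ('y \<Rightarrow> 'z) \<Rightarrow>
     ('a, 'y, 'f) module_scheme \<Rightarrow> ('a, 'z, 'g) module_scheme \<Rightarrow> bool" where
  "lifts A P g Y Z \<longleftrightarrow>
     (\<forall>f \<in> module_hom A P Z. f ` carrier P \<subseteq> g ` carrier Y \<longrightarrow>
        (\<exists>h \<in> module_hom A P Y. \<forall>x \<in> carrier P. g (h x) = f x))"

lemma liftsD:
  assumes "lifts A P g Y Z" "f \<in> module_hom A P Z"
    and "\<And>x. x \<in> carrier P \<Longrightarrow> \<exists>y \<in> carrier Y. g y = f x"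
  shows "\<exists>h. h \<in> module_hom A P Y \<and> (\<forall>x \<in> carrier P. g (h x) = f x)"
proof -
  have "f ` carrier P \<subseteq> g ` carrier Y" using assms(3) by force
  then show ?thesis using assms(1,2) unfolding lifts_def by blast
qed

text \<open>Choose preimages of the values of \<open>f\<close> on the basis and extend
  linearly.\<close>

lemma free_lifts:
  assumes "module A Y" "module A Z" "g \<in> module_hom A Y Z"
  shows "lifts A (free_module A n) g Y Z"
  unfolding lifts_def
proof (intro ballI impI)
  interpret Y: module A Y by fact
  fix f assume f: "f \<in> module_hom A (free_module A n) Z"
    and fg: "f ` carrier (free_module A n) \<subseteq> g ` carrier Y"
  have "\<exists>y\<in>carrier Y. g y = f (unit_fun A n i)" for i
    using fg unit_fun_in[OF Y.ring_axioms, of n i] by force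
  then obtain v where v: "v i \<in> carrier Y" "g (v i) = f (unit_fun A n i)" for i by metis
  show "\<exists>h\<in>module_hom A (free_module A n) Y. \<forall>x\<in>carrier (free_module A n). g (h x) = f x"
  proof (intro bexI ballI)
    show "fam_comb Y v n \<in> module_hom A (free_module A n) Y"
      using v by (intro fam_comb_hom assms) auto
    fix x assume x: "x \<in> carrier (free_module A n)"
    have "g (fam_comb Y v n x) = fam_comb Z (\<lambda>i. g (v i)) n x"
      using v free_in[OF Y.ring_axioms x] by (intro hom_fam_comb[OF assms]) auto
    also have "\<dots> = f x"
      unfolding v by (rule free_hom_fam_comb[symmetric, OF assms(2) f x])
    finally show "g (fam_comb Y v n x) = f x" .
  qed
qed

section \<open>Direct sums\<close>

lemma direct_sum_simps:
  "carrier (direct_sum M N) = carrier M \<times> carrier N"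
  "\<zero>\<^bsub>direct_sum M N\<^esub> = (\<zero>\<^bsub>M\<^esub>, \<zero>\<^bsub>N\<^esub>)"
  "x \<oplus>\<^bsub>direct_sum M N\<^esub> y = (fst x \<oplus>\<^bsub>M\<^esub> fst y, snd x \<oplus>\<^bsub>N\<^esub> snd y)"
  "a \<odot>\<^bsub>direct_sum M N\<^esub> x = (a \<odot>\<^bsub>M\<^esub> fst x, a \<odot>\<^bsub>N\<^esub> snd x)"
  by (simp_all add: direct_sum_def)

lemma direct_sum_fst: "fst \<in> module_hom A (direct_sum M N) M"
  and direct_sum_snd: "snd \<in> module_hom A (direct_sum M N) N"
  by (auto intro!: module_homI simp: direct_sum_simps)

lemma direct_sum_inl:
  assumes "module A N" shows "(\<lambda>x. (x, \<zero>\<^bsub>N\<^esub>)) \<in> module_hom A M (direct_sum M N)"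
proof -
  interpret N: module A N by fact
  show ?thesis by (auto intro!: module_homI simp: direct_sum_simps)
qed

lemma direct_sum_inr:
  assumes "module A M" shows "(\<lambda>x. (\<zero>\<^bsub>M\<^esub>, x)) \<in> module_hom A N (direct_sum M N)"
proof -
  interpret M: module A M by fact
  show ?thesis by (auto intro!: module_homI simp: direct_sum_simps)
qed

lemma direct_sum_pair:
  assumes "f \<in> module_hom A L M" "g \<in> module_hom A L N"
  shows "(\<lambda>x. (f x, g x)) \<in> module_hom A L (direct_sum M N)"
  using assms unfolding module_hom_def by (auto simp: direct_sum_simps)

text \<open>Lift on each summand and add. This serves the terms of a mapping cone, which are pairs
  and so are not literally of the form \<open>free_module A n\<close>.\<close>

lemma direct_sum_lifts:
  assumes "module A P" "module A Q" "module A Y" "module A Z" "g \<in> module_hom A Y Z"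
    and "lifts A P g Y Z" "lifts A Q g Y Z"
  shows "lifts A (direct_sum P Q) g Y Z"
  unfolding lifts_def
proof (intro ballI impI)
  interpret P: module A P by fact
  interpret Q: module A Q by fact
  interpret Y: module A Y by fact
  interpret Z: module A Z by fact
  fix f assume f: "f \<in> module_hom A (direct_sum P Q) Z"
    and fg: "f ` carrier (direct_sum P Q) \<subseteq> g ` carrier Y"
  have hom1: "(\<lambda>x. f (x, \<zero>\<^bsub>Q\<^esub>)) \<in> module_hom A P Z"
    by (rule module_hom_comp[OF direct_sum_inl[OF assms(2)] f])
  have ex1: "\<exists>y\<in>carrier Y. g y = f (x, \<zero>\<^bsub>Q\<^esub>)" if "x \<in> carrier P" for x
  proof -
    have "f (x, \<zero>\<^bsub>Q\<^esub>) \<in> g ` carrier Y"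
      using that by (intro subsetD[OF fg] imageI) (simp add: direct_sum_simps)
    then show ?thesis by auto
  qed
  obtain h1 where h1: "h1 \<in> module_hom A P Y" "\<And>x. x \<in> carrier P \<Longrightarrow> g (h1 x) = f (x, \<zero>\<^bsub>Q\<^esub>)"
    using liftsD[OF assms(6) hom1 ex1] by blast
  have hom2: "(\<lambda>x. f (\<zero>\<^bsub>P\<^esub>, x)) \<in> module_hom A Q Z"
    by (rule module_hom_comp[OF direct_sum_inr[OF assms(1)] f])
  have ex2: "\<exists>y\<in>carrier Y. g y = f (\<zero>\<^bsub>P\<^esub>, x)" if "x \<in> carrier Q" for x
  proof -
    have "f (\<zero>\<^bsub>P\<^esub>, x) \<in> g ` carrier Y"
      using that by (intro subsetD[OF fg] imageI) (simp add: direct_sum_simps)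
    then show ?thesis by auto
  qed
  obtain h2 where h2: "h2 \<in> module_hom A Q Y" "\<And>x. x \<in> carrier Q \<Longrightarrow> g (h2 x) = f (\<zero>\<^bsub>P\<^esub>, x)"
    using liftsD[OF assms(7) hom2 ex2] by blast
  show "\<exists>h\<in>module_hom A (direct_sum P Q) Y. \<forall>x\<in>carrier (direct_sum P Q). g (h x) = f x"
  proof (intro bexI ballI)
    show "(\<lambda>x. h1 (fst x) \<oplus>\<^bsub>Y\<^esub> h2 (snd x)) \<in> module_hom A (direct_sum P Q) Y"
      by (intro module_hom_plus assms module_hom_comp[OF direct_sum_fst h1(1)]
          module_hom_comp[OF direct_sum_snd h2(1)])
    fix x assume "x \<in> carrier (direct_sum P Q)"
    then obtain p q where x: "x = (p, q)" "p \<in> carrier P" "q \<in> carrier Q"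
      by (auto simp: direct_sum_simps)
    have "g (h1 p \<oplus>\<^bsub>Y\<^esub> h2 q) = f (p, \<zero>\<^bsub>Q\<^esub>) \<oplus>\<^bsub>Z\<^esub> f (\<zero>\<^bsub>P\<^esub>, q)"
      using x h1 h2 by (simp add: module_hom_add[OF assms(5)] module_hom_in)
    also have "\<dots> = f (p, q)"
      using x by (subst module_hom_add[OF f, symmetric]) (auto simp: direct_sum_simps)
    finally show "g (h1 (fst x) \<oplus>\<^bsub>Y\<^esub> h2 (snd x)) = f x" using x by simp
  qed
qed


section \<open>Local rings\<close>

locale noeth_local = cring A for A :: "('a, 'r) ring_scheme" (structure) +
  assumes noeth_local: "noetherian_local_ring A"
begin

abbreviation mm :: "'a set" where "mm \<equiv> max_ideal A"

abbreviation kk :: "'a set ring" where "kk \<equiv> residue_field A"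

lemma mm_maximal: "maximalideal mm A"
proof -
  have "\<exists>!I. maximalideal I A" using noeth_local unfolding noetherian_local_ring_def by simp
  then show ?thesis unfolding max_ideal_def by (rule theI')
qed

lemma mm_unique: "maximalideal I A \<Longrightarrow> I = mm"
  using noeth_local mm_maximal unfolding noetherian_local_ring_def by auto

sublocale mm: maximalideal mm A by (rule mm_maximal)

lemma noetherian: "noetherian_ring A"
  using noeth_local unfolding noetherian_local_ring_def by auto

lemma free_mod: "module A (free_module A n)"
  by (rule free_module_module[OF is_cring])

text \<open>In a Noetherian ring a nonempty chain of ideals contains its own union, so Zorn's lemma
  gives a maximal proper ideal above \<open>I\<close>; uniqueness identifies it with
  \<open>mm\<close>.\<close>

lemma proper_ideal_subset:
  assumes "ideal I A" "I \<noteq> carrier A"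
  shows "I \<subseteq> mm"
proof -
  let ?\<I> = "{J. ideal J A \<and> I \<subseteq> J \<and> J \<noteq> carrier A}"
  have proper: "J \<noteq> carrier A \<longleftrightarrow> \<one> \<notin> J" if "ideal J A" for J
    using ideal.one_imp_carrier[OF that] by auto
  have "\<exists>J\<in>?\<I>. \<forall>J'\<in>?\<I>. J \<subseteq> J' \<longrightarrow> J' = J"
  proof (rule subset_Zorn)
    fix C assume C: "subset.chain ?\<I> C"
    show "\<exists>U\<in>?\<I>. \<forall>J\<in>C. J \<subseteq> U"
    proof (cases "C = {}")
      case True
      then show ?thesis using assms by auto
    next
      case False
      have "subset.chain {J. ideal J A} C" using C unfolding pred_on.chain_def by auto
      then have "\<Union>C \<in> C"
        by (rule noetherian_ring.ideal_chain_is_trivial[OF noetherian False])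
      moreover have "C \<subseteq> ?\<I>" using C unfolding pred_on.chain_def by auto
      ultimately show ?thesis by (intro bexI[of _ "\<Union>C"]) auto
    qed
  qed
  then obtain J where JI: "J \<in> ?\<I>" and max: "\<forall>J'\<in>?\<I>. J \<subseteq> J' \<longrightarrow> J' = J" by (rule bexE)
  have J: "ideal J A" "I \<subseteq> J" "carrier A \<noteq> J" using JI by auto
  have "maximalideal J A"
  proof (rule maximalidealI[OF J(1,3)])
    fix J' assume J': "ideal J' A" "J \<subseteq> J'"
    then show "J' = J \<or> J' = carrier A" using bspec[OF max, of J'] J(2) by auto
  qed
  then show ?thesis using mm_unique J(2) by auto
qed

text \<open>The principal ideal of \<open>x\<close> is not inside \<open>mm\<close>, so it is the
  whole ring.\<close>

lemma unit_or_mm: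
  assumes "x \<in> carrier A" "x \<notin> mm"
  shows "\<exists>y \<in> carrier A. y \<otimes> x = \<one>"
proof -
  have "x \<in> PIdl x" using assms(1) by (rule cgenideal_self)
  then have "PIdl x = carrier A"
    using proper_ideal_subset[OF cgenideal_ideal[OF assms(1)]] assms(2) by blast
  then have "\<one> \<in> PIdl x" by simp
  then obtain y where "y \<in> carrier A" "\<one> = y \<otimes> x" unfolding cgenideal_def by (elim CollectE exE conjE)
  then show ?thesis by (intro bexI[of _ y]) simp_all
qed

lemma kk_field: "field kk"
  unfolding residue_field_def by (rule mm.quotient_is_field[OF is_cring])

sublocale kk: field kk by (rule kk_field)

definition red :: "'a \<Rightarrow> 'a set" where "red a = mm +> a"

sublocale red: ring_hom_cring A kk red
  using mm.rcos_ring_hom_cring[OF is_cring]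
  unfolding residue_field_def red_def[abs_def] by simp

lemma red_zero_iff: "a \<in> carrier A \<Longrightarrow> red a = \<zero>\<^bsub>kk\<^esub> \<longleftrightarrow> a \<in> mm"
  unfolding red_def residue_field_def FactRing_def
  using mm.a_rcos_const mm.a_rcos_self by auto

lemma kk_carrier: "carrier kk = red ` carrier A"
  unfolding red_def residue_field_def FactRing_def by (auto simp: A_RCOSETS_def')

text \<open>This is \<open>mm\<close> times the free module, see \<open>ideal_times_free\<close>;
  the coordinate form makes membership easy to check and turns it into vanishing modulo
  \<open>mm\<close>.\<close>

definition mfree :: "nat \<Rightarrow> (nat \<Rightarrow> 'a) set" where
  "mfree n = {x \<in> carrier (free_module A n). \<forall>i<n. x i \<in> mm}"

lemma mfree_submodule: "submodule A (mfree n) (free_module A n)"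
proof -
  interpret F: module A "free_module A n" by (rule free_mod)
  show ?thesis
    using mm.zero_closed mm.a_closed mm.I_l_closed
    by unfold_locales
      (auto simp: mfree_def free_zero[OF ring_axioms] free_add[OF ring_axioms] free_smult[OF ring_axioms])
qed

lemma ideal_times_free: "ideal_times A mm (free_module A n) = mfree n"
proof
  let ?F = "free_module A n"
  interpret F: module A "?F" by (rule free_mod)
  let ?S = "{a \<odot>\<^bsub>?F\<^esub> x |a x. a \<in> mm \<and> x \<in> carrier (?F)}"
  have "?S \<subseteq> mfree n"
  proof clarify
    fix a x assume a: "a \<in> mm" and x: "x \<in> carrier (?F)"
    show "a \<odot>\<^bsub>?F\<^esub> x \<in> mfree n"
      using mm.a_Hcarr[OF a] x mm.I_r_closed[OF a] free_in[OF ring_axioms x]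
      by (auto simp: mfree_def free_smult[OF ring_axioms])
  qed
  then show "ideal_times A mm (?F) \<subseteq> mfree n"
    unfolding ideal_times_def by (intro F.span_is_subset mfree_submodule)
  have S: "?S \<subseteq> carrier (?F)" by (auto dest: mm.a_Hcarr)
  show "mfree n \<subseteq> ideal_times A mm (?F)"
  proof
    fix x assume x: "x \<in> mfree n"
    then have xF: "x \<in> carrier (?F)" by (simp add: mfree_def)
    have "fam_comb (?F) (unit_fun A n) n x \<in> F.span ?S"
      unfolding fam_comb_def
    proof (rule submodule_finsum[OF F.span_is_submodule[OF S]])
      show "(\<lambda>i. x i \<odot>\<^bsub>?F\<^esub> unit_fun A n i) \<in> {..<n} \<rightarrow> F.span ?S"
        using x unit_fun_in[OF ring_axioms] F.in_own_span[OF S] by (fastforce simp: mfree_def)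
    qed simp
    then show "x \<in> ideal_times A mm (?F)"
      unfolding ideal_times_def free_decomp[OF is_cring xF] .
  qed
qed

text \<open>By linearity \<open>f x\<close> is a combination of values of \<open>f\<close> with the
  coordinates of \<open>x\<close>, elements of \<open>mm\<close>, as coefficients.\<close>

lemma hom_mfree:
  assumes "f \<in> module_hom A (free_module A n) (free_module A m)" "x \<in> mfree n"
  shows "f x \<in> mfree m"
proof -
  interpret F: module A "free_module A m" by (rule free_mod)
  have x: "x \<in> carrier (free_module A n)" using assms(2) by (simp add: mfree_def)
  have f: "f (unit_fun A n i) \<in> carrier (free_module A m)" for i
    using module_hom_in[OF assms(1) unit_fun_in[OF ring_axioms]] .
  have "x i \<odot>\<^bsub>free_module A m\<^esub> f (unit_fun A n i) \<in> mfree m" if "i < n" for i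
    using assms(2) that f[of i] free_in[OF ring_axioms f[of i]] mm.I_r_closed mm.a_Hcarr
    by (auto simp: mfree_def free_smult[OF ring_axioms])
  then have "fam_comb (free_module A m) (\<lambda>i. f (unit_fun A n i)) n x \<in> mfree m"
    unfolding fam_comb_def by (intro submodule_finsum[OF mfree_submodule]) auto
  then show ?thesis using free_hom_fam_comb[OF free_mod assms(1) x] by simp
qed

end


section \<open>Coordinate spaces over a field\<close>

lemma (in field) coord_space: "vectorspace R (free_module R n)"
  using func_space_is_module by (simp add: vectorspace_def field_axioms)

lemma (in field) coord_space_basis:
  shows "vectorspace.basis R (free_module R n) (unit_fun R n ` {..<n})"
    and "card (unit_fun R n ` {..<n}) = n"
proof -
  let ?F = "free_module R n"
  interpret F: vectorspace R ?F by (rule coord_space)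
  note mod = func_space_is_module[of "{..<n}"]
  let ?u = "unit_fun R n"
  have u: "?u i \<in> carrier ?F" for i by (rule unit_fun_in[OF ring_axioms])
  have inj: "inj_on ?u {..<n}"
  proof (rule inj_onI)
    fix i j assume "i \<in> {..<n}" "j \<in> {..<n}" "?u i = ?u j"
    then have "?u i i = ?u j i" "i < n" by auto
    then show "i = j" by (simp add: unit_fun_def split: if_splits)
  qed
  have gen: "F.span (?u ` {..<n}) = carrier ?F"
  proof -
    have "fam_comb ?F ?u n ` carrier ?F = carrier ?F"
      using free_decomp[OF is_cring, of _ n] by force
    then show ?thesis using fam_comb_span[OF mod, of ?u n] u by auto
  qed
  have li: "F.lin_indpt (?u ` {..<n})"
  proof (rule F.finite_lin_indpt2)
    fix a assume a: "a \<in> ?u ` {..<n} \<rightarrow> carrier R" and 0: "F.lincomb a (?u ` {..<n}) = \<zero>\<^bsub>?F\<^esub>"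
    let ?x = "\<lambda>i\<in>{..<n}. a (?u i)"
    have x: "?x \<in> carrier ?F" using a by (auto simp: free_carrier[OF ring_axioms])
    have "F.lincomb a (?u ` {..<n}) = finsum ?F (\<lambda>i. a (?u i) \<odot>\<^bsub>?F\<^esub> ?u i) {..<n}"
      unfolding F.lincomb_def using a u inj by (intro F.M.add.finprod_reindex) (auto simp: Pi_iff)
    also have "\<dots> = fam_comb ?F ?u n ?x"
      unfolding fam_comb_def using a u by (intro F.M.finsum_cong') (auto simp: Pi_iff)
    also have "\<dots> = ?x" by (rule free_decomp[OF is_cring x])
    finally have "?x = \<zero>\<^bsub>?F\<^esub>" using 0 by simp
    then have "?x i = \<zero>" if "i < n" for i using free_zero[OF ring_axioms that] by simp
    then show "\<forall>v\<in>?u ` {..<n}. a v = \<zero>" by auto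
  qed (use u in auto)
  have card: "card (?u ` {..<n}) = n" using card_image[OF inj] by simp
  show "F.basis (?u ` {..<n})" unfolding F.basis_def using gen li u by auto
  show "card (?u ` {..<n}) = n" by (rule card)
qed

lemma (in field) coord_space_dim:
  shows "vectorspace.fin_dim R (free_module R n)"
    and "vectorspace.dim R (free_module R n) = n"
proof -
  interpret F: vectorspace R "free_module R n" by (rule coord_space)
  note basis = coord_space_basis[of n]
  show "F.fin_dim" "F.dim = n"
    using basis F.dim_basis[of "unit_fun R n ` {..<n}"] unfolding F.fin_dim_def F.basis_def by auto
qed

lemma (in field) coord_space_generators:
  assumes v: "v \<in> {..<r} \<rightarrow> carrier (free_module R n)"
    and gen: "fam_comb (free_module R n) v r ` carrier (free_module R r) = carrier (free_module R n)"
  shows "n \<le> r"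
proof -
  interpret F: vectorspace R "free_module R n" by (rule coord_space)
  have span: "F.span (v ` {..<r}) = carrier (free_module R n)"
    using fam_comb_span[OF func_space_is_module v] gen by simp
  have basis: "F.lin_indpt (unit_fun R n ` {..<n})" "unit_fun R n ` {..<n} \<subseteq> carrier (free_module R n)"
    using coord_space_basis[of n] unfolding F.basis_def by auto
  have "card (unit_fun R n ` {..<n}) \<le> card (v ` {..<r})"
    using v by (intro F.li_smaller_than_gen basis span) auto
  also have "\<dots> \<le> r" using card_image_le[of "{..<r}" v] by simp
  finally show ?thesis using coord_space_basis(2)[of n] by simp
qed

context noeth_local
begin

text \<open>Reducing all coordinates modulo \<open>mm\<close> turns the hypothesis into generation
  of the \<open>b\<close>-dimensional coordinate space over the residue field by \<open>r\<close>
  vectors. Every bound on a Betti number in this proof comes from here.\<close>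

lemma rank_le_of_generators_mod_mm:
  assumes "v \<in> {..<r} \<rightarrow> carrier (free_module A b)"
    and "\<And>x. x \<in> carrier (free_module A b) \<Longrightarrow> \<exists>c \<in> carrier (free_module A r). \<exists>z \<in> mfree b.
           x = fam_comb (free_module A b) v r c \<oplus>\<^bsub>free_module A b\<^esub> z"
  shows "b \<le> r"
proof -
  let ?F = "free_module A b" and ?kF = "free_module kk b"
  let ?red = "\<lambda>x. \<lambda>i\<in>{..<b}. red (x i)"
  let ?w = "\<lambda>j. ?red (v j)"
  have vc: "v j i \<in> carrier A" if "j < r" "i < b" for i j
    by (rule free_in[OF ring_axioms]) (use assms(1) that in auto)
  have w: "?w \<in> {..<r} \<rightarrow> carrier (?kF)"
    unfolding free_carrier[OF kk.ring_axioms] using vc by (auto intro!: restrict_PiE)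
  note kmod = free_module_module[OF kk.is_cring]
  have "fam_comb (?kF) ?w r ` carrier (free_module kk r) = carrier (?kF)"
  proof (intro equalityI subsetI)
    fix y assume "y \<in> fam_comb (?kF) ?w r ` carrier (free_module kk r)"
    then show "y \<in> carrier (?kF)"
      using module_hom_in[OF fam_comb_hom[OF kmod w]] by auto
  next
    fix y assume y: "y \<in> carrier (?kF)"
    \<comment> \<open>The vector \<open>y\<close> over the residue field is lifted coordinatewise to
      \<open>x\<close>; the hypothesis is applied to \<open>x\<close> and the result reduced again,
      which removes \<open>z\<close>.\<close>
    have "\<exists>a. a \<in> carrier A \<and> red a = y i" if "i < b" for i
      using free_in[OF kk.ring_axioms y that] unfolding kk_carrier by auto
    then obtain x0 where x0: "\<And>i. i < b \<Longrightarrow> x0 i \<in> carrier A \<and> red (x0 i) = y i" by metis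
    define x where "x = restrict x0 {..<b}"
    have x: "x \<in> carrier (?F)" and redx: "\<And>i. i < b \<Longrightarrow> red (x i) = y i"
      using x0 by (auto simp: x_def free_carrier[OF ring_axioms])
    obtain c z where c: "c \<in> carrier (free_module A r)" and z: "z \<in> mfree b"
      and xcz: "x = fam_comb (?F) v r c \<oplus>\<^bsub>?F\<^esub> z"
      using assms(2)[OF x] by blast
    have cc: "c j \<in> carrier A" if "j < r" for j using free_in[OF ring_axioms c that] .
    let ?c = "\<lambda>j\<in>{..<r}. red (c j)"
    have c': "?c \<in> carrier (free_module kk r)" using cc by (auto simp: free_carrier[OF kk.ring_axioms])
    interpret F: module A "?F" by (rule free_mod)
    interpret kF: module kk "?kF" by (rule kmod)
    have "fam_comb (?kF) ?w r ?c = y"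
    proof (rule free_eqI[OF kk.ring_axioms _ y])
      show "fam_comb (?kF) ?w r ?c \<in> carrier (?kF)"
        using module_hom_in[OF fam_comb_hom[OF kmod w] c'] .
      fix i assume i: "i < b"
      have zi: "z i \<in> mm" using z i by (simp add: mfree_def)
      have s: "(finsum (?F) (\<lambda>j. c j \<odot>\<^bsub>?F\<^esub> v j) {..<r}) i
         = finsum A (\<lambda>j. (c j \<odot>\<^bsub>?F\<^esub> v j) i) {..<r}"
        using assms(1) cc i by (intro free_finsum[OF is_cring]) auto
      also have "\<dots> = finsum A (\<lambda>j. c j \<otimes> v j i) {..<r}"
        using cc vc i by (intro finsum_cong') (auto simp: free_smult[OF ring_axioms])
      finally have xi: "x i = finsum A (\<lambda>j. c j \<otimes> v j i) {..<r} \<oplus> z i"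
        unfolding xcz fam_comb_def using i by (simp add: free_add[OF ring_axioms])
      have "finsum A (\<lambda>j. c j \<otimes> v j i) {..<r} \<in> carrier A"
        using cc vc i by (intro finsum_closed) auto
      then have "y i = red (finsum A (\<lambda>j. c j \<otimes> v j i) {..<r}) \<oplus>\<^bsub>kk\<^esub> red (z i)"
        using xi redx[OF i] mm.a_Hcarr[OF zi] by simp
      also have "red (z i) = \<zero>\<^bsub>kk\<^esub>" using zi mm.a_Hcarr[OF zi] by (simp add: red_zero_iff)
      also have "red (finsum A (\<lambda>j. c j \<otimes> v j i) {..<r}) = finsum kk (red \<circ> (\<lambda>j. c j \<otimes> v j i)) {..<r}"
        using cc vc i by (intro red.hom_finsum) auto
      also have "\<dots> = finsum kk (\<lambda>j. (?c j \<odot>\<^bsub>?kF\<^esub> ?w j) i) {..<r}"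
        using cc vc i by (intro kk.finsum_cong') (auto simp: free_smult[OF kk.ring_axioms])
      also have "\<dots> = fam_comb (?kF) ?w r ?c i"
        unfolding fam_comb_def using w cc i by (intro free_finsum[symmetric, OF kk.is_cring]) auto
      finally have yi: "y i = fam_comb (?kF) ?w r ?c i \<oplus>\<^bsub>kk\<^esub> \<zero>\<^bsub>kk\<^esub>" .
      have "fam_comb (?kF) ?w r ?c i \<in> carrier kk"
        by (rule free_in[OF kk.ring_axioms module_hom_in[OF fam_comb_hom[OF kmod w] c'] i])
      then show "fam_comb (?kF) ?w r ?c i = y i"
        using yi by simp
    qed
    then show "y \<in> fam_comb (?kF) ?w r ` carrier (free_module kk r)"
      using c' by force
  qed
  with w show ?thesis by (rule kk.coord_space_generators)
qed

end


section \<open>Existence of minimal free resolutions\<close>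

context noeth_local
begin

section \<open>Submodules of free modules over a Noetherian ring\<close>

lemma fam_comb_submodule:
  assumes "submodule A S M" "v \<in> {..<r} \<rightarrow> S" "c \<in> carrier (free_module A r)"
  shows "fam_comb M v r c \<in> S"
proof -
  interpret S: submodule A S M by fact
  show ?thesis
    unfolding fam_comb_def using assms(2) free_in[OF ring_axioms assms(3)]
    by (intro submodule_finsum[OF assms(1)]) auto
qed

lemma coord_ideal:
  assumes "submodule A S (free_module A n)" "i < n"
  shows "ideal ((\<lambda>x. x i) ` S) A"
proof -
  interpret S: submodule A S "free_module A n" by fact
  have c: "x i \<in> carrier A" if "x \<in> S" for x
    using free_in[OF ring_axioms subsetD[OF S.subset that] assms(2)] .
  have mult: "r \<otimes> x i \<in> (\<lambda>x. x i) ` S" if "x \<in> S" "r \<in> carrier A" for x r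
    using free_smult[OF ring_axioms assms(2), of r x, symmetric] S.smult_closed[OF that(2,1)]
    by (rule image_eqI)
  show ?thesis
  proof (rule idealI[OF ring_axioms])
    show "subgroup ((\<lambda>x. x i) ` S) (add_monoid A)"
    proof (rule add.subgroupI)
      show "(\<lambda>x. x i) ` S \<subseteq> carrier A" using c by auto
      show "(\<lambda>x. x i) ` S \<noteq> {}" using S.zero_closed by (metis empty_iff image_is_empty)
      fix a assume "a \<in> (\<lambda>x. x i) ` S"
      then obtain x where x: "x \<in> S" "a = x i" by auto
      show "\<ominus> a \<in> (\<lambda>x. x i) ` S"
        using submodule_neg[OF assms(1) x(1)] free_minus[OF is_cring assms(2) subsetD[OF S.subset x(1)]] x(2)
        by (intro image_eqI[of _ _ "\<ominus>\<^bsub>free_module A n\<^esub> x"]) auto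
      fix b assume "b \<in> (\<lambda>x. x i) ` S"
      then obtain y where y: "y \<in> S" "b = y i" by auto
      show "a \<oplus> b \<in> (\<lambda>x. x i) ` S"
        using x y free_add[OF ring_axioms assms(2), of x y] S.m_closed[OF x(1) y(1)]
        by (intro image_eqI[of _ _ "x \<oplus>\<^bsub>free_module A n\<^esub> y"]) auto
    qed
  next
    fix a r assume "a \<in> (\<lambda>x. x i) ` S" and r: "r \<in> carrier A"
    then obtain x where x: "x \<in> S" "a = x i" by auto
    show "r \<otimes> a \<in> (\<lambda>x. x i) ` S" using mult[OF x(1) r] x(2) by simp
    then show "a \<otimes> r \<in> (\<lambda>x. x i) ` S" using m_comm[OF c[OF x(1)] r] x(2) by simp
  qed
qed

lemma append_free:
  assumes "d \<in> carrier (free_module A n)" "c \<in> carrier (free_module A m)"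
  shows "(\<lambda>i\<in>{..<n + m}. if i < n then d i else c (i - n)) \<in> carrier (free_module A (n + m))"
  using free_in[OF ring_axioms assms(1)] free_in[OF ring_axioms assms(2)]
  unfolding free_carrier[OF ring_axioms] by (subst restrict_PiE_iff) auto

lemma fam_comb_append_free:
  assumes "module A M" "v \<in> {..<n} \<rightarrow> carrier M" "d \<in> carrier (free_module A n)"
    and "w \<in> {..<m} \<rightarrow> carrier M" "c \<in> carrier (free_module A m)"
  shows "fam_comb M v n d \<oplus>\<^bsub>M\<^esub> fam_comb M w m c =
    fam_comb M (\<lambda>i. if i < n then v i else w (i - n)) (n + m)
      (\<lambda>i\<in>{..<n + m}. if i < n then d i else c (i - n))"
proof -
  note cd = free_in[OF ring_axioms assms(3)] free_in[OF ring_axioms assms(5)]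
  have "fam_comb M v n d \<oplus>\<^bsub>M\<^esub> fam_comb M w m c =
    fam_comb M (\<lambda>i. if i < n then v i else w (i - n)) (n + m) (\<lambda>i. if i < n then d i else c (i - n))"
    using cd by (intro fam_comb_append[OF assms(1,2) _ assms(4)]) auto
  also have "\<dots> = fam_comb M (\<lambda>i. if i < n then v i else w (i - n)) (n + m)
      (\<lambda>i\<in>{..<n + m}. if i < n then d i else c (i - n))"
    using assms(2,4) cd by (intro fam_comb_cong[OF assms(1)]) (auto simp: Pi_iff)
  finally show ?thesis .
qed

text \<open>Induction on the number of coordinates that may be nonzero: the leading coordinates of the
  elements of \<open>S\<close> form a finitely generated ideal.\<close>

lemma submodule_free_fin_gen_aux:
  assumes "k \<le> n" "submodule A S (free_module A n)"
    and "\<And>x i. x \<in> S \<Longrightarrow> k \<le> i \<Longrightarrow> i < n \<Longrightarrow> x i = \<zero>"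
  shows "\<exists>r v. v \<in> {..<r} \<rightarrow> S \<and> S \<subseteq> fam_comb (free_module A n) v r ` carrier (free_module A r)"
  using assms
proof (induct k arbitrary: S)
  case 0
  interpret F: module A "free_module A n" by (rule free_mod)
  interpret S: submodule A S "free_module A n" by fact
  have "x = \<zero>\<^bsub>free_module A n\<^esub>" if x: "x \<in> S" for x
    using 0(3)[OF x] free_zero[OF ring_axioms]
    by (intro free_eqI[OF ring_axioms subsetD[OF S.subset x]]) auto
  moreover have "fam_comb (free_module A n) v 0 c = \<zero>\<^bsub>free_module A n\<^esub>" for v c
    by (simp add: fam_comb_def)
  moreover have "unit_fun A 0 0 \<in> carrier (free_module A 0)" by (rule unit_fun_in[OF ring_axioms])
  ultimately show ?case
    by (intro exI[of _ "0::nat"] exI[of _ "\<lambda>_. \<zero>\<^bsub>free_module A n\<^esub>"]) auto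
next
  case (Suc k)
  let ?F = "free_module A n"
  interpret F: module A ?F by (rule free_mod)
  interpret S: submodule A S ?F by fact
  have k: "k < n" using Suc.prems(1) by simp
  let ?I = "(\<lambda>x. x k) ` S"
  obtain G where G: "G \<subseteq> carrier A" "finite G" "?I = Idl G"
    using noetherian_ring.finetely_gen[OF noetherian coord_ideal[OF Suc.prems(2) k]] by blast
  obtain g where g: "G = g ` {..<card G}" using finite_enum[OF G(2)] .
  let ?p = "card G"
  have "\<exists>x\<in>S. x k = g j" if "j < ?p" for j
  proof -
    have "g j \<in> ?I" using genideal_self[OF G(1)] G(3) g that by auto
    then show ?thesis by auto
  qed
  \<comment> \<open>The \<open>w j\<close> realise the generators of the coordinate ideal inside
    \<open>S\<close>. Subtracting a combination of them from an element of \<open>S\<close> kills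
    its coordinate \<open>k\<close>.\<close>
  then obtain w where w: "\<And>j. j < ?p \<Longrightarrow> w j \<in> S \<and> w j k = g j" by metis
  have wS: "w \<in> {..<?p} \<rightarrow> S" using w by auto
  have wF: "w \<in> {..<?p} \<rightarrow> carrier ?F" using wS S.subset by auto
  let ?T = "fam_comb ?F w ?p ` carrier (free_module A ?p)"
  have T: "submodule A ?T ?F"
    using F.span_is_submodule[of "w ` {..<?p}"] wF fam_comb_span[OF free_mod wF] by auto
  have "G \<subseteq> (\<lambda>x. x k) ` ?T"
  proof
    fix a assume "a \<in> G"
    then obtain j where j: "j < ?p" "a = g j" using g by auto
    then have "a = fam_comb ?F w ?p (unit_fun A ?p j) k"
      using fam_comb_unit[OF free_mod wF j(1)] w by simp
    then show "a \<in> (\<lambda>x. x k) ` ?T" using unit_fun_in[OF ring_axioms] by blast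
  qed
  then have IT: "?I \<subseteq> (\<lambda>x. x k) ` ?T"
    unfolding G(3) by (intro genideal_minimal coord_ideal[OF T k])
  \<comment> \<open>The part of \<open>S\<close> left after this subtraction; the induction
    hypothesis applies to it.\<close>
  let ?S' = "{x \<in> S. x k = \<zero>}"
  have S': "submodule A ?S' ?F"
    by unfold_locales
      (use S.subset k in \<open>auto simp: free_zero[OF ring_axioms] free_add[OF ring_axioms] free_smult[OF ring_axioms]\<close>)
  have "x i = \<zero>" if "x \<in> ?S'" "k \<le> i" "i < n" for x i
    using that Suc.prems(3)[of x i] by (cases "i = k") auto
  then obtain r v where v: "v \<in> {..<r} \<rightarrow> ?S'" "?S' \<subseteq> fam_comb ?F v r ` carrier (free_module A r)"
    using Suc.hyps[OF _ S'] k by (metis (lifting) less_imp_le)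
  have vF: "v \<in> {..<r} \<rightarrow> carrier ?F" using v(1) S.subset by auto
  let ?u = "\<lambda>i. if i < r then v i else w (i - r)"
  have "S \<subseteq> fam_comb ?F ?u (r + ?p) ` carrier (free_module A (r + ?p))"
  proof
    fix x assume x: "x \<in> S"
    then have xF: "x \<in> carrier ?F" using S.subset by auto
    obtain c where c: "c \<in> carrier (free_module A ?p)" "x k = fam_comb ?F w ?p c k"
      using subsetD[OF IT, of "x k"] x by auto
    let ?y = "fam_comb ?F w ?p c"
    have y: "?y \<in> S" by (rule fam_comb_submodule[OF Suc.prems(2) wS c(1)])
    then have yF: "?y \<in> carrier ?F" using S.subset by auto
    have "(x \<ominus>\<^bsub>?F\<^esub> ?y) k = \<zero>"
      using c(2) free_diff[OF is_cring k xF yF] free_in[OF ring_axioms xF k] by simp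
    then have "x \<ominus>\<^bsub>?F\<^esub> ?y \<in> ?S'"
      using submodule_diff[OF Suc.prems(2) x y] by simp
    then obtain d where d: "d \<in> carrier (free_module A r)" "x \<ominus>\<^bsub>?F\<^esub> ?y = fam_comb ?F v r d"
      using v(2) by auto
    have "x = (x \<ominus>\<^bsub>?F\<^esub> ?y) \<oplus>\<^bsub>?F\<^esub> ?y"
      using xF yF unfolding a_minus_def by (simp add: F.a_assoc F.l_neg)
    also have "\<dots> = fam_comb ?F ?u (r + ?p) (\<lambda>i\<in>{..<r + ?p}. if i < r then d i else c (i - r))"
      unfolding d(2) by (rule fam_comb_append_free[OF free_mod vF d(1) wF c(1)])
    finally show "x \<in> fam_comb ?F ?u (r + ?p) ` carrier (free_module A (r + ?p))"
      using append_free[OF d(1) c(1)] by (rule image_eqI)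
  qed
  moreover have "?u \<in> {..<r + ?p} \<rightarrow> S" using v(1) wS by (auto simp: Pi_iff)
  ultimately show ?case by blast
qed

lemma submodule_free_fin_gen:
  assumes "submodule A S (free_module A n)"
  shows "fin_gen A ((free_module A n)\<lparr>carrier := S\<rparr>)"
proof -
  interpret F: module A "free_module A n" by (rule free_mod)
  interpret S: submodule A S "free_module A n" by fact
  obtain r v where v: "v \<in> {..<r} \<rightarrow> S"
    and S: "S \<subseteq> fam_comb (free_module A n) v r ` carrier (free_module A r)"
    using submodule_free_fin_gen_aux[OF order.refl assms] by auto
  have mS: "module A (F.md S)" by (rule F.submodule_is_module[OF assms])
  have vF: "v \<in> {..<r} \<rightarrow> carrier (free_module A n)" using v S.subset by auto
  have "fam_comb (free_module A n) v r \<in> module_hom A (free_module A r) (F.md S)"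
    using fam_comb_hom[OF free_mod vF] fam_comb_submodule[OF assms v]
    unfolding module_hom_def by auto
  moreover have "fam_comb (free_module A n) v r ` carrier (free_module A r) = carrier (F.md S)"
    using S fam_comb_submodule[OF assms v] by auto
  ultimately show ?thesis by (rule fin_gen_image[OF fin_gen_free[OF is_cring] mS])
qed

text \<open>Take a generating family of least length. A coefficient outside \<open>mm\<close> in a
  relation is a unit, so the relation would express one generator through the others.\<close>

lemma minimal_cover:
  assumes "fin_gen A N"
  shows "\<exists>r v. v \<in> {..<r} \<rightarrow> carrier N \<and> fam_comb N v r ` carrier (free_module A r) = carrier N \<and>
           {x \<in> carrier (free_module A r). fam_comb N v r x = \<zero>\<^bsub>N\<^esub>} \<subseteq> mfree r"
proof -
  let ?P = "\<lambda>r. \<exists>v. v \<in> {..<r} \<rightarrow> carrier N \<and> fam_comb N v r ` carrier (free_module A r) = carrier N"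
  have N: "module A N" and ex: "\<exists>r. ?P r" using assms unfolding fin_gen_iff by auto
  interpret N: module A N by fact
  define r where "r = (LEAST r. ?P r)"
  have "?P r" unfolding r_def using ex by (rule LeastI_ex)
  then obtain v where v: "v \<in> {..<r} \<rightarrow> carrier N"
    and gen: "fam_comb N v r ` carrier (free_module A r) = carrier N" by blast
  have "x \<in> mfree r" if x: "x \<in> carrier (free_module A r)" and 0: "fam_comb N v r x = \<zero>\<^bsub>N\<^esub>" for x
  proof (rule ccontr)
    assume "x \<notin> mfree r"
    then obtain j where j: "j < r" "x j \<notin> mm" using x unfolding mfree_def by auto
    have xc: "x i \<in> carrier A" if "i < r" for i using free_in[OF ring_axioms x that] .
    have vc: "v i \<in> carrier N" if "i < r" for i using v that by auto
    obtain y where y: "y \<in> carrier A" "y \<otimes> x j = \<one>" using unit_or_mm[OF xc[OF j(1)] j(2)] by blast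
    let ?J = "{..<r} - {j}"
    let ?S = "v ` ?J"
    have Sc: "?S \<subseteq> carrier N" using v by auto
    interpret S: submodule A "N.span ?S" N by (rule N.span_is_submodule[OF Sc])
    have vS: "v i \<in> N.span ?S" if "i \<in> ?J" for i using that N.in_own_span[OF Sc] by blast
    let ?s = "finsum N (\<lambda>i. x i \<odot>\<^bsub>N\<^esub> v i) ?J"
    have s: "?s \<in> N.span ?S"
      using vS xc by (intro submodule_finsum[OF S.submodule_axioms]) auto
    then have sc: "?s \<in> carrier N" using S.subset by auto
    have "fam_comb N v r x = finsum N (\<lambda>i. x i \<odot>\<^bsub>N\<^esub> v i) (insert j ?J)"
      unfolding fam_comb_def using j(1) by (simp add: insert_absorb)
    also have "\<dots> = x j \<odot>\<^bsub>N\<^esub> v j \<oplus>\<^bsub>N\<^esub> ?s"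
      using j(1) xc vc by (intro N.finsum_insert) auto
    finally have "x j \<odot>\<^bsub>N\<^esub> v j = \<ominus>\<^bsub>N\<^esub> ?s"
      using 0 sc xc[OF j(1)] vc[OF j(1)] by (simp add: N.minus_equality[symmetric])
    then have "x j \<odot>\<^bsub>N\<^esub> v j \<in> N.span ?S"
      using submodule_neg[OF S.submodule_axioms s] by simp
    then have "y \<odot>\<^bsub>N\<^esub> (x j \<odot>\<^bsub>N\<^esub> v j) \<in> N.span ?S" using y by auto
    then have vj: "v j \<in> N.span ?S"
      using y xc[OF j(1)] vc[OF j(1)] by (simp add: N.smult_assoc1[symmetric])
    have "v ` {..<r} \<subseteq> N.span ?S"
      using vS vj by auto
    then have "N.span (v ` {..<r}) \<subseteq> N.span ?S"
      by (intro N.span_is_subset S.submodule_axioms)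
    then have span: "N.span ?S = carrier N"
      using S.subset fam_comb_span[OF N v] gen by auto
    \<comment> \<open>The remaining generators are renumbered. Repetitions among them can only make
      \<open>card ?S\<close> smaller, so the upper bound by \<open>r - 1\<close> suffices for the
      contradiction.\<close>
    obtain u where u: "?S = u ` {..<card ?S}" using finite_enum[of ?S] by auto
    have uc: "u \<in> {..<card ?S} \<rightarrow> carrier N" using u Sc by auto
    have "?P (card ?S)"
      using uc fam_comb_span[OF N uc] span u by auto
    then have "r \<le> card ?S" unfolding r_def by (rule Least_le)
    also have "card ?S \<le> card ?J" by (rule card_image_le) simp
    finally show False using j(1) by simp
  qed
  then show ?thesis using v gen by blast
qed

text \<open>The kernel of this cover is what the next differential must hit; its position inside
  \<open>mfree b'\<close> is the minimality of that next differential.\<close>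

lemma minimal_step:
  assumes "submodule A Z (free_module A b)"
  shows "\<exists>b' d. d \<in> module_hom A (free_module A b') (free_module A b) \<and>
     d ` carrier (free_module A b') = Z \<and>
     {x \<in> carrier (free_module A b'). d x = \<zero>\<^bsub>free_module A b\<^esub>} \<subseteq> mfree b'"
proof -
  let ?N = "(free_module A b)\<lparr>carrier := Z\<rparr>"
  interpret Z: submodule A Z "free_module A b" by fact
  have N: "fin_gen A ?N" by (rule submodule_free_fin_gen[OF assms])
  obtain r v where v: "v \<in> {..<r} \<rightarrow> carrier ?N"
    "fam_comb ?N v r ` carrier (free_module A r) = carrier ?N"
    "{x \<in> carrier (free_module A r). fam_comb ?N v r x = \<zero>\<^bsub>?N\<^esub>} \<subseteq> mfree r"
    using minimal_cover[OF N] by blast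
  have "fam_comb ?N v r \<in> module_hom A (free_module A r) (free_module A b)"
    using fam_comb_hom[OF fin_gen_module[OF N] v(1)] Z.subset unfolding module_hom_def by auto
  then show ?thesis using v(2,3) by (intro exI[of _ r] exI[of _ "fam_comb ?N v r"]) auto
qed

lemma minimal_free_resolution_exists:
  assumes "fin_gen A M"
  shows "\<exists>b d e. minimal_free_resolution A M b d e"
proof -
  obtain b0 v where v: "v \<in> {..<b0} \<rightarrow> carrier M"
    "fam_comb M v b0 ` carrier (free_module A b0) = carrier M"
    "{x \<in> carrier (free_module A b0). fam_comb M v b0 x = \<zero>\<^bsub>M\<^esub>} \<subseteq> mfree b0"
    using minimal_cover[OF assms] by blast
  note M = fin_gen_module[OF assms]
  let ?e = "fam_comb M v b0"
  have e: "?e \<in> module_hom A (free_module A b0) M" by (rule fam_comb_hom[OF M v(1)])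
  let ?Z0 = "{x \<in> carrier (free_module A b0). ?e x = \<zero>\<^bsub>M\<^esub>}"
  \<comment> \<open>The state of the recursion is the rank of the current term with the submodule to
    be covered next. The clause for 0 ties the start to the augmentation.\<close>
  let ?P = "\<lambda>(n::nat) (b, Z). submodule A Z (free_module A b) \<and> Z \<subseteq> mfree b \<and> (n = 0 \<longrightarrow> b = b0 \<and> Z = ?Z0)"
  let ?Q = "\<lambda>(n::nat) (b, Z) (b', Z'). \<exists>d. d \<in> module_hom A (free_module A b') (free_module A b) \<and>
     d ` carrier (free_module A b') = Z \<and> Z' = {x \<in> carrier (free_module A b'). d x = \<zero>\<^bsub>free_module A b\<^esub>}"
  have "\<exists>f. \<forall>n. ?P n (f n) \<and> ?Q n (f n) (f (Suc n))"
  proof (rule dependent_nat_choice)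
    show "\<exists>x. ?P 0 x"
      using kernel_submodule[OF free_mod M e] v(3) by (intro exI[of _ "(b0, ?Z0)"]) simp
    fix x :: "nat \<times> (nat \<Rightarrow> 'a) set" and n :: nat
    assume P: "?P n x"
    obtain b Z where x: "x = (b, Z)" by (cases x)
    have "submodule A Z (free_module A b)" using P x by simp
    from minimal_step[OF this] obtain b' d
      where d: "d \<in> module_hom A (free_module A b') (free_module A b)"
        "d ` carrier (free_module A b') = Z"
        "{x \<in> carrier (free_module A b'). d x = \<zero>\<^bsub>free_module A b\<^esub>} \<subseteq> mfree b'" by blast
    have "submodule A {x \<in> carrier (free_module A b'). d x = \<zero>\<^bsub>free_module A b\<^esub>} (free_module A b')"
      by (rule kernel_submodule[OF free_mod free_mod d(1)])
    then show "\<exists>y. ?P (Suc n) y \<and> ?Q n x y"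
      using d x by (intro exI[of _ "(b', {x \<in> carrier (free_module A b'). d x = \<zero>\<^bsub>free_module A b\<^esub>})"]) auto
  qed
  then obtain f where ff: "\<forall>n. ?P n (f n) \<and> ?Q n (f n) (f (Suc n))" by (rule exE)
  note f = conjunct1[OF spec[OF ff]] conjunct2[OF spec[OF ff]]
  define b where "b = (\<lambda>n. fst (f n))"
  define Z where "Z = (\<lambda>n. snd (f n))"
  have P: "Z n \<subseteq> mfree (b n)" "b 0 = b0" "Z 0 = ?Z0" for n
    using f(1)[of n] f(1)[of 0] by (auto simp: b_def Z_def split_beta)
  have "\<forall>n. \<exists>d. d \<in> module_hom A (free_module A (b (Suc n))) (free_module A (b n)) \<and>
     d ` carrier (free_module A (b (Suc n))) = Z n \<and>
     Z (Suc n) = {x \<in> carrier (free_module A (b (Suc n))). d x = \<zero>\<^bsub>free_module A (b n)\<^esub>}"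
    using f(2) by (simp add: b_def Z_def split_beta)
  from choice[OF this] obtain D where D: "\<forall>n. D n \<in> module_hom A (free_module A (b (Suc n))) (free_module A (b n)) \<and>
     D n ` carrier (free_module A (b (Suc n))) = Z n \<and>
     Z (Suc n) = {x \<in> carrier (free_module A (b (Suc n))). D n x = \<zero>\<^bsub>free_module A (b n)\<^esub>}"
    by (rule exE)
  \<comment> \<open>\<open>D n\<close> is numbered by its target, a differential of
    \<open>resolution\<close> by its source; hence the shift by one.\<close>
  have "minimal_free_resolution A M b (\<lambda>n. D (n - 1)) ?e"
    unfolding minimal_free_resolution_def resolution_def ideal_times_free
    using free_mod e D v(2) P by simp
  then show ?thesis by blast
qed

lemma min_res_minimal:
  assumes "fin_gen A M"
  shows "minimal_free_resolution A M (fst (min_res A M)) (fst (snd (min_res A M))) (snd (snd (min_res A M)))"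
proof -
  have "\<exists>r. case r of (b, d, e) \<Rightarrow> minimal_free_resolution A M b d e"
    using minimal_free_resolution_exists[OF assms] by auto
  from someI_ex[OF this] show ?thesis
    unfolding min_res_def[symmetric] by (simp add: split_beta)
qed

end


section \<open>Betti numbers are the ranks of the minimal free resolution\<close>

text \<open>All module laws are identities or solvability statements and pass along a surjection
  respecting the operations. It is applied where the structure on \<open>V\<close> is given only by
  formulas: quotients and spaces over the residue field.\<close>

lemma module_transport:
  fixes U :: "('a, 'u, 'e) module_scheme" and V :: "('a, 'v, 'f) module_scheme"
  assumes U: "module R U"
    and T: "T ` carrier U = carrier V"
    and zero: "T \<zero>\<^bsub>U\<^esub> = \<zero>\<^bsub>V\<^esub>"
    and add: "\<And>x y. x \<in> carrier U \<Longrightarrow> y \<in> carrier U \<Longrightarrow> T x \<oplus>\<^bsub>V\<^esub> T y = T (x \<oplus>\<^bsub>U\<^esub> y)"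
    and smult: "\<And>c x. c \<in> carrier R \<Longrightarrow> x \<in> carrier U \<Longrightarrow> c \<odot>\<^bsub>V\<^esub> T x = T (c \<odot>\<^bsub>U\<^esub> x)"
  shows "module R V" and "T \<in> module_hom R U V"
proof -
  interpret U: module R U by fact
  have ball: "(\<forall>v \<in> carrier V. P v) \<longleftrightarrow> (\<forall>x \<in> carrier U. P (T x))" for P using T by force
  have mem: "T x \<in> carrier V" if "x \<in> carrier U" for x using T that by auto
  have *: "\<exists>x \<in> carrier U. v = T x" if "v \<in> carrier V" for v using T that by auto
  note [simp] = mem add smult
  show "T \<in> module_hom R U V" by (rule module_homI) auto
  show "module R V"
  proof (rule module_criteria[OF U.is_cring])
    show "\<zero>\<^bsub>V\<^esub> \<in> carrier V" using zero mem U.zero_closed by metis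
    show "\<forall>v w. v \<in> carrier V \<and> w \<in> carrier V \<longrightarrow> v \<oplus>\<^bsub>V\<^esub> w \<in> carrier V"
      by (auto dest!: *)
    show "\<forall>v\<in>carrier V. \<exists>w\<in>carrier V. v \<oplus>\<^bsub>V\<^esub> w = \<zero>\<^bsub>V\<^esub>"
      unfolding ball
    proof
      fix x assume x: "x \<in> carrier U"
      then have "T x \<oplus>\<^bsub>V\<^esub> T (\<ominus>\<^bsub>U\<^esub> x) = \<zero>\<^bsub>V\<^esub>" by (simp add: U.r_neg zero)
      then show "\<exists>w\<in>carrier V. T x \<oplus>\<^bsub>V\<^esub> w = \<zero>\<^bsub>V\<^esub>" using x by (intro bexI[of _ "T (\<ominus>\<^bsub>U\<^esub> x)"]) auto
    qed
    show "\<forall>c v. c \<in> carrier R \<and> v \<in> carrier V \<longrightarrow> c \<odot>\<^bsub>V\<^esub> v \<in> carrier V"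
      by (auto dest!: *)
    show "\<forall>v w. v \<in> carrier V \<and> w \<in> carrier V \<longrightarrow> v \<oplus>\<^bsub>V\<^esub> w = w \<oplus>\<^bsub>V\<^esub> v"
      by (auto dest!: * simp: U.a_comm)
    show "\<forall>v w x. v \<in> carrier V \<and> w \<in> carrier V \<and> x \<in> carrier V \<longrightarrow>
        v \<oplus>\<^bsub>V\<^esub> w \<oplus>\<^bsub>V\<^esub> x = v \<oplus>\<^bsub>V\<^esub> (w \<oplus>\<^bsub>V\<^esub> x)"
      by (auto dest!: * simp: U.a_assoc)
    show "\<forall>v\<in>carrier V. v \<oplus>\<^bsub>V\<^esub> \<zero>\<^bsub>V\<^esub> = v"
      unfolding ball by (simp flip: zero)
    show "\<forall>a b v. a \<in> carrier R \<and> b \<in> carrier R \<and> v \<in> carrier V \<longrightarrow>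
        a \<otimes>\<^bsub>R\<^esub> b \<odot>\<^bsub>V\<^esub> v = a \<odot>\<^bsub>V\<^esub> (b \<odot>\<^bsub>V\<^esub> v)"
      by (auto dest!: * simp: U.smult_assoc1)
    show "\<forall>v\<in>carrier V. \<one>\<^bsub>R\<^esub> \<odot>\<^bsub>V\<^esub> v = v" unfolding ball by simp
    show "\<forall>a b v. a \<in> carrier R \<and> b \<in> carrier R \<and> v \<in> carrier V \<longrightarrow>
        (a \<oplus>\<^bsub>R\<^esub> b) \<odot>\<^bsub>V\<^esub> v = a \<odot>\<^bsub>V\<^esub> v \<oplus>\<^bsub>V\<^esub> b \<odot>\<^bsub>V\<^esub> v"
      by (auto dest!: * simp: U.smult_l_distr)
    show "\<forall>a v w. a \<in> carrier R \<and> v \<in> carrier V \<and> w \<in> carrier V \<longrightarrow>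
        a \<odot>\<^bsub>V\<^esub> (v \<oplus>\<^bsub>V\<^esub> w) = a \<odot>\<^bsub>V\<^esub> v \<oplus>\<^bsub>V\<^esub> a \<odot>\<^bsub>V\<^esub> w"
      by (auto dest!: * simp: U.smult_r_distr)
  qed
qed

lemma fam_comb_add_left:
  assumes "module A M" "v \<in> {..<n} \<rightarrow> carrier M" "w \<in> {..<n} \<rightarrow> carrier M" "c \<in> {..<n} \<rightarrow> carrier A"
  shows "fam_comb M v n c \<oplus>\<^bsub>M\<^esub> fam_comb M w n c = fam_comb M (\<lambda>i. v i \<oplus>\<^bsub>M\<^esub> w i) n c"
proof -
  interpret M: module A M by fact
  have "fam_comb M (\<lambda>i. v i \<oplus>\<^bsub>M\<^esub> w i) n c = finsum M (\<lambda>i. c i \<odot>\<^bsub>M\<^esub> v i \<oplus>\<^bsub>M\<^esub> c i \<odot>\<^bsub>M\<^esub> w i) {..<n}"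
    unfolding fam_comb_def using assms(2-4) by (intro M.finsum_cong') (auto simp: Pi_iff M.smult_r_distr)
  also have "\<dots> = fam_comb M v n c \<oplus>\<^bsub>M\<^esub> fam_comb M w n c"
    unfolding fam_comb_def using assms(2-4) by (intro M.finsum_addf) (auto simp: Pi_iff)
  finally show ?thesis by simp
qed

lemma fam_comb_smult_left:
  assumes "module A M" "v \<in> {..<n} \<rightarrow> carrier M" "a \<in> carrier A" "c \<in> {..<n} \<rightarrow> carrier A"
  shows "a \<odot>\<^bsub>M\<^esub> fam_comb M v n c = fam_comb M (\<lambda>i. a \<odot>\<^bsub>M\<^esub> v i) n c"
proof -
  interpret M: module A M by fact
  have "fam_comb M (\<lambda>i. a \<odot>\<^bsub>M\<^esub> v i) n c = finsum M (\<lambda>i. a \<odot>\<^bsub>M\<^esub> (c i \<odot>\<^bsub>M\<^esub> v i)) {..<n}"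
    unfolding fam_comb_def using assms(2-4)
    by (intro M.finsum_cong') (auto simp: Pi_iff M.m_comm simp flip: M.smult_assoc1)
  also have "\<dots> = a \<odot>\<^bsub>M\<^esub> fam_comb M v n c"
    unfolding fam_comb_def using assms(2-4) by (intro M.finsum_smult[symmetric]) (auto simp: Pi_iff)
  finally show ?thesis by simp
qed

lemma fam_comb_zero:
  assumes "module A M" "\<And>i. i < n \<Longrightarrow> c i \<odot>\<^bsub>M\<^esub> v i = \<zero>\<^bsub>M\<^esub>"
  shows "fam_comb M v n c = \<zero>\<^bsub>M\<^esub>"
proof -
  interpret M: module A M by fact
  show ?thesis unfolding fam_comb_def using assms(2) by (intro M.finsum_all0) auto
qed

text \<open>Coboundaries with values in the residue field turn out to be zero, so the elements of
  the corresponding \<open>Ext\<close> are cosets with one element.\<close>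

lemma singleton_coset:
  "{z} +>\<^bsub>M\<^esub> f = {z \<oplus>\<^bsub>M\<^esub> f}" "set_add M {f} {g} = {f \<oplus>\<^bsub>M\<^esub> g}"
  by (auto simp: a_r_coset_def' set_add_def')

lemma Hom_simps:
  "carrier (Hom_module A M N) = module_hom A M N \<inter> extensional (carrier M)"
  "\<zero>\<^bsub>Hom_module A M N\<^esub> = (\<lambda>x\<in>carrier M. \<zero>\<^bsub>N\<^esub>)"
  "f \<oplus>\<^bsub>Hom_module A M N\<^esub> g = (\<lambda>x\<in>carrier M. f x \<oplus>\<^bsub>N\<^esub> g x)"
  "a \<odot>\<^bsub>Hom_module A M N\<^esub> f = (\<lambda>x\<in>carrier M. a \<odot>\<^bsub>N\<^esub> f x)"
  by (simp_all add: Hom_module_def)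

lemma restrict_hom:
  assumes "module A M" "f \<in> module_hom A M N"
  shows "restrict f (carrier M) \<in> carrier (Hom_module A M N)"
proof -
  interpret M: module A M by fact
  show ?thesis using assms(2) unfolding Hom_simps module_hom_def by auto
qed

context noeth_local
begin

section \<open>Homomorphisms from free modules into the residue field\<close>

abbreviation km :: "('a, 'a set) module" where "km \<equiv> residue_module A"

lemma km_simps:
  "carrier km = carrier kk" "\<zero>\<^bsub>km\<^esub> = \<zero>\<^bsub>kk\<^esub>" "x \<oplus>\<^bsub>km\<^esub> y = x \<oplus>\<^bsub>kk\<^esub> y" "a \<odot>\<^bsub>km\<^esub> x = red a \<otimes>\<^bsub>kk\<^esub> x"
  by (simp_all add: residue_module_def Let_def red_def)

lemma km_module: "module A km"
proof -
  have inv: "\<exists>w\<in>carrier kk. v \<oplus>\<^bsub>kk\<^esub> w = \<zero>\<^bsub>kk\<^esub>" if "v \<in> carrier kk" for v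
    using that by (intro bexI[of _ "\<ominus>\<^bsub>kk\<^esub> v"]) (auto simp: kk.r_neg)
  show ?thesis
    by (rule module_criteria[OF is_cring])
      (auto simp: km_simps kk.a_ac kk.m_assoc kk.l_distr kk.r_distr inv)
qed

text \<open>The residue field is killed by \<open>mm\<close>. Consequently every differential of a
  minimal resolution induces zero on homomorphisms into it.\<close>

lemma hom_km_mfree:
  assumes "f \<in> module_hom A (free_module A n) km" "x \<in> mfree n"
  shows "f x = \<zero>\<^bsub>kk\<^esub>"
proof -
  have x: "x \<in> carrier (free_module A n)" and m: "x i \<in> mm" if "i < n" for i
    using assms(2) that by (auto simp: mfree_def)
  have "f x = fam_comb km (\<lambda>i. f (unit_fun A n i)) n x"
    using assms(2) by (intro free_hom_fam_comb[OF km_module assms(1)]) (simp add: mfree_def)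
  also have "\<dots> = \<zero>\<^bsub>km\<^esub>"
  proof (rule fam_comb_zero[OF km_module])
    fix i assume "i < n"
    then have "red (x i) = \<zero>\<^bsub>kk\<^esub>" using m red_zero_iff mm.a_Hcarr by auto
    moreover have "f (unit_fun A n i) \<in> carrier kk"
      using module_hom_in[OF assms(1) unit_fun_in[OF ring_axioms]] by (simp add: km_simps)
    ultimately show "x i \<odot>\<^bsub>km\<^esub> f (unit_fun A n i) = \<zero>\<^bsub>km\<^esub>" by (simp add: km_simps)
  qed
  finally show ?thesis by (simp add: km_simps)
qed

text \<open>Any element of a residue class represents it; this makes the description operator in
  \<open>over_residue_field\<close> well defined.\<close>

lemma coset_red:
  assumes "c \<in> carrier kk" "a \<in> c"
  shows "a \<in> carrier A" "red a = c"
proof -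
  obtain b where b: "b \<in> carrier A" "c = red b" using assms(1) kk_carrier by auto
  show "a \<in> carrier A"
    using assms(2) b mm.a_Hcarr unfolding red_def by (auto simp: a_r_coset_def')
  show "red a = c"
    using mm.a_repr_independence'[of a b] assms(2) b unfolding red_def by simp
qed

text \<open>A homomorphism into the residue field is determined by its arbitrary values on the
  basis, so \<open>T\<close> is an isomorphism from the coordinate space. The shape of
  \<open>V\<close> is the one \<open>Ext\<close> takes when all cochains are cocycles and all
  coboundaries vanish.\<close>

lemma Hom_km_dim:
  fixes n :: nat
  defines "F \<equiv> free_module A n"
  defines "H \<equiv> Hom_module A F km"
  defines "V \<equiv> over_residue_field A (quotient_module (H\<lparr>carrier := carrier H\<rparr>) {\<zero>\<^bsub>H\<^esub>})"
  shows "vectorspace.dim kk V = n"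
proof -
  let ?H = "H\<lparr>carrier := carrier H\<rparr>"
  let ?Q = "quotient_module ?H {\<zero>\<^bsub>H\<^esub>}"
  have F: "module A F" unfolding F_def by (rule free_mod)
  interpret F: module A F by (rule F)
  interpret km: module A km by (rule km_module)
  have zplus: "\<zero>\<^bsub>H\<^esub> \<oplus>\<^bsub>?H\<^esub> f = f" if "f \<in> carrier H" for f
  proof
    fix x show "(\<zero>\<^bsub>H\<^esub> \<oplus>\<^bsub>?H\<^esub> f) x = f x"
      using that module_hom_in[of f A F km x] unfolding H_def Hom_simps
      by (auto simp: Hom_module_def restrict_def extensional_def)
  qed
  have carrV: "carrier V = (\<lambda>f. {f}) ` carrier H"
    unfolding V_def over_residue_field_def quotient_module_def
    using zplus by (auto simp: A_RCOSETS_def' singleton_coset)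
  have zeroV: "\<zero>\<^bsub>V\<^esub> = {\<zero>\<^bsub>H\<^esub>}"
    unfolding V_def over_residue_field_def quotient_module_def by simp
  have addV: "{f} \<oplus>\<^bsub>V\<^esub> {g} = {f \<oplus>\<^bsub>H\<^esub> g}" for f g
    unfolding V_def over_residue_field_def quotient_module_def by (simp add: singleton_coset)
  have smultH: "a \<odot>\<^bsub>H\<^esub> f \<in> carrier H" if "a \<in> carrier A" "f \<in> carrier H" for a f
  proof -
    have f: "f \<in> module_hom A F km" using that(2) unfolding H_def Hom_simps by simp
    have "(\<lambda>x. a \<odot>\<^bsub>km\<^esub> f x) \<in> module_hom A F km"
      using that(1) module_hom_in[OF f]
      by (intro module_homI)
        (simp_all add: module_hom_add[OF f] module_hom_smult[OF f] km.smult_r_distr m_comm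
          flip: km.smult_assoc1)
    then show ?thesis unfolding H_def Hom_simps(4) by (rule restrict_hom[OF F])
  qed
  have smultV: "c \<odot>\<^bsub>V\<^esub> {f} = {a \<odot>\<^bsub>H\<^esub> f}" if "a \<in> carrier A" "c = red a" "f \<in> carrier H" for a c f
  proof -
    have c: "c \<in> carrier kk" using that by simp
    have "a \<in> c" using that(1,2) unfolding red_def by (simp add: mm.a_rcos_self)
    have Q: "a' \<odot>\<^bsub>?Q\<^esub> {f} = {a' \<odot>\<^bsub>H\<^esub> f}" if "a' \<in> carrier A" for a'
      unfolding quotient_module_def using zplus[OF smultH[OF that \<open>f \<in> carrier H\<close>]]
      by (simp add: singleton_coset)
    \<comment> \<open>Representatives act through \<open>red\<close>, hence all alike, and the
      description below has exactly one solution.\<close>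
    have eq: "a' \<odot>\<^bsub>?Q\<^esub> {f} = {a \<odot>\<^bsub>H\<^esub> f}" if "a' \<in> c" for a'
    proof -
      have "a' \<in> carrier A" "red a' = red a" using coset_red[OF c that] \<open>c = red a\<close> by auto
      then show ?thesis using Q by (simp add: H_def Hom_simps km_simps)
    qed
    have "c \<odot>\<^bsub>V\<^esub> {f} = (THE w. \<exists>a'\<in>c. w = a' \<odot>\<^bsub>?Q\<^esub> {f})"
      unfolding V_def over_residue_field_def by simp
    also have "\<dots> = {a \<odot>\<^bsub>H\<^esub> f}"
      using eq \<open>a \<in> c\<close> by (intro the_equality) auto
    finally show ?thesis .
  qed
  let ?U = "free_module kk n"
  have U: "module kk ?U" by (rule free_module_module[OF kk.is_cring])
  define T where "T w = {\<lambda>x\<in>carrier F. fam_comb km w n x}" for w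
  have w_in: "w \<in> {..<n} \<rightarrow> carrier km" if "w \<in> carrier ?U" for w
    using free_in[OF kk.ring_axioms that] by (auto simp: km_simps)
  have x_in: "x \<in> {..<n} \<rightarrow> carrier A" if "x \<in> carrier F" for x
    using free_in[OF ring_axioms that[unfolded F_def]] by auto
  have TH: "(\<lambda>x\<in>carrier F. fam_comb km w n x) \<in> carrier H" if "w \<in> carrier ?U" for w
    unfolding H_def using fam_comb_hom[OF km_module w_in[OF that]]
    by (intro restrict_hom[OF F]) (simp add: F_def)
  have surj: "T ` carrier ?U = carrier V"
  proof (intro equalityI subsetI)
    fix y assume "y \<in> T ` carrier ?U"
    then show "y \<in> carrier V" using TH unfolding carrV T_def by auto
  next
    fix y assume "y \<in> carrier V"
    then obtain f where f: "f \<in> carrier H" "y = {f}" unfolding carrV by auto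
    then have hom: "f \<in> module_hom A (free_module A n) km" and ext: "f \<in> extensional (carrier F)"
      unfolding H_def Hom_simps F_def by auto
    let ?w = "\<lambda>i\<in>{..<n}. f (unit_fun A n i)"
    have fu: "f (unit_fun A n i) \<in> carrier kk" for i
      using module_hom_in[OF hom unit_fun_in[OF ring_axioms]] by (simp add: km_simps)
    have w: "?w \<in> carrier ?U"
      unfolding free_carrier[OF kk.ring_axioms] using fu by (subst restrict_PiE_iff) auto
    have "(\<lambda>x\<in>carrier F. fam_comb km ?w n x) = f"
    proof (rule extensionalityI[OF _ ext])
      fix x assume x: "x \<in> carrier F"
      have "fam_comb km ?w n x = fam_comb km (\<lambda>i. f (unit_fun A n i)) n x"
        using w_in[OF w] x_in[OF x] by (intro fam_comb_cong[OF km_module]) auto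
      then show "(\<lambda>x\<in>carrier F. fam_comb km ?w n x) x = f x"
        using free_hom_fam_comb[OF km_module hom x[unfolded F_def]] x by simp
    qed simp
    then show "y \<in> T ` carrier ?U" using w f(2) unfolding T_def by (intro image_eqI[of _ _ ?w]) auto
  qed
  have zero: "T \<zero>\<^bsub>?U\<^esub> = \<zero>\<^bsub>V\<^esub>"
  proof -
    have "fam_comb km \<zero>\<^bsub>?U\<^esub> n x = \<zero>\<^bsub>km\<^esub>" if "x \<in> carrier F" for x
    proof (rule fam_comb_zero[OF km_module])
      fix i assume i: "i < n"
      then have "x i \<in> carrier A" using x_in[OF that] by auto
      then show "x i \<odot>\<^bsub>km\<^esub> \<zero>\<^bsub>?U\<^esub> i = \<zero>\<^bsub>km\<^esub>"
        using free_zero[OF kk.ring_axioms i] by (simp add: km_simps)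
    qed
    then show ?thesis unfolding T_def zeroV H_def Hom_simps by (auto intro!: restrict_ext)
  qed
  have add: "T x \<oplus>\<^bsub>V\<^esub> T y = T (x \<oplus>\<^bsub>?U\<^esub> y)" if x: "x \<in> carrier ?U" and y: "y \<in> carrier ?U" for x y
  proof -
    have "fam_comb km x n z \<oplus>\<^bsub>km\<^esub> fam_comb km y n z = fam_comb km (x \<oplus>\<^bsub>?U\<^esub> y) n z" if z: "z \<in> carrier F" for z
    proof -
      have "fam_comb km x n z \<oplus>\<^bsub>km\<^esub> fam_comb km y n z = fam_comb km (\<lambda>i. x i \<oplus>\<^bsub>km\<^esub> y i) n z"
        by (intro fam_comb_add_left[OF km_module] w_in x y x_in z)
      also have "\<dots> = fam_comb km (x \<oplus>\<^bsub>?U\<^esub> y) n z"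
        using w_in[OF x] w_in[OF y] x_in[OF z]
        by (intro fam_comb_cong[OF km_module]) (auto simp: free_add[OF kk.ring_axioms] km_simps)
      finally show ?thesis .
    qed
    then show ?thesis unfolding T_def addV H_def Hom_simps by (auto intro!: restrict_ext)
  qed
  have smult: "c \<odot>\<^bsub>V\<^esub> T x = T (c \<odot>\<^bsub>?U\<^esub> x)" if c: "c \<in> carrier kk" and x: "x \<in> carrier ?U" for c x
  proof -
    obtain a where a: "a \<in> carrier A" "c = red a" using c kk_carrier by auto
    have "a \<odot>\<^bsub>km\<^esub> fam_comb km x n z = fam_comb km (c \<odot>\<^bsub>?U\<^esub> x) n z" if z: "z \<in> carrier F" for z
    proof -
      have "a \<odot>\<^bsub>km\<^esub> fam_comb km x n z = fam_comb km (\<lambda>i. a \<odot>\<^bsub>km\<^esub> x i) n z"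
        by (intro fam_comb_smult_left[OF km_module] w_in x a x_in z)
      also have "\<dots> = fam_comb km (c \<odot>\<^bsub>?U\<^esub> x) n z"
        using w_in[OF x] x_in[OF z] a
        by (intro fam_comb_cong[OF km_module]) (auto simp: free_smult[OF kk.ring_axioms] km_simps)
      finally show ?thesis .
    qed
    then show ?thesis
      unfolding T_def smultV[OF a TH[OF x]] unfolding H_def Hom_simps by (auto intro!: restrict_ext)
  qed
  \<comment> \<open>Only here does \<open>V\<close> become known to be a module: the structure is
    transported from the coordinate space.\<close>
  have V: "module kk V" "T \<in> module_hom kk ?U V"
    by (rule module_transport[of kk ?U T V]; simp only: U surj zero add smult)+
  interpret lin: linear_map kk ?U V T
    using V U kk_field by (auto simp: linear_map_def vectorspace_def mod_hom_def mod_hom_axioms_def)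
  have "inj_on T (carrier ?U)"
  proof (rule inj_onI)
    fix x y assume x: "x \<in> carrier ?U" and y: "y \<in> carrier ?U" and "T x = T y"
    then have eq: "(\<lambda>z\<in>carrier F. fam_comb km x n z) = (\<lambda>z\<in>carrier F. fam_comb km y n z)"
      unfolding T_def by simp
    have "fam_comb km x n z = fam_comb km y n z" if "z \<in> carrier F" for z
      using fun_cong[OF eq, of z] that by simp
    then have "x i = y i" if "i < n" for i
      using fam_comb_unit[OF km_module w_in[OF x] that] fam_comb_unit[OF km_module w_in[OF y] that]
        unit_fun_in[OF ring_axioms] unfolding F_def by metis
    then show "x = y" by (rule free_eqI[OF kk.ring_axioms x y])
  qed
  then have "vectorspace.dim kk ?U = vectorspace.dim kk V"
    using surj by (intro lin.dim_eq kk.coord_space_dim) auto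
  then show ?thesis using kk.coord_space_dim(2) by simp
qed

text \<open>Minimality makes all differentials of the cochain complex zero, so \<open>Ext\<close> in
  degree \<open>n\<close> is the full space of homomorphisms from the \<open>n\<close>th
  term.\<close>

lemma betti_eq_rank:
  assumes "fin_gen A M"
  shows "betti A M n = fst (min_res A M) n"
proof -
  let ?b = "fst (min_res A M)"
  let ?F = "\<lambda>n. free_module A (?b n)"
  let ?H = "Hom_module A (?F n) km"
  have res: "res_module A M n = ?F n" for n unfolding res_module_def by simp
  have min: "res_map A M (Suc n) x \<in> mfree (?b n)" if "x \<in> carrier (?F (Suc n))" for n x
    using min_res_minimal[OF assms] that
    unfolding minimal_free_resolution_def ideal_times_free res_map_def by auto
  have cocycles: "Ext_cocycles A n M km = carrier ?H"
    unfolding Ext_cocycles_def res Hom_simps km_simps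
    by (intro equalityI subsetI CollectI conjI ballI hom_km_mfree[OF _ min]) (simp_all add: km_simps)
  have coboundaries: "Ext_coboundaries A n M km = {\<zero>\<^bsub>?H\<^esub>}"
  proof (cases n)
    case 0
    then show ?thesis by (simp add: Ext_coboundaries_def res)
  next
    case (Suc m)
    have "restrict (g \<circ> res_map A M n) (carrier (?F n)) = \<zero>\<^bsub>?H\<^esub>"
      if "g \<in> carrier (Hom_module A (?F m) km)" for g
    proof -
      have "g \<in> module_hom A (?F m) km" using that unfolding Hom_simps by simp
      from hom_km_mfree[OF this min] show ?thesis
        unfolding Suc Hom_simps km_simps by (intro restrict_ext) simp
    qed
    \<comment> \<open>Nonemptiness is what makes the image of the constant map the singleton of zero
      and not the empty set.\<close>
    moreover have "carrier (Hom_module A (?F m) km) \<noteq> {}"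
      using restrict_hom[OF free_mod module_hom_const_zero[OF km_module]] by auto
    ultimately show ?thesis unfolding Ext_coboundaries_def res by (auto simp: Suc)
  qed
  show ?thesis
    unfolding betti_def Ext_def res cocycles coboundaries by (rule Hom_km_dim)
qed

end


section \<open>Comparison of resolutions\<close>

text \<open>Differentials are numbered by their target, unlike in \<open>resolution\<close>. A
  resolution cut off at any degree \<open>k\<close> and renumbered is then of this form.\<close>

definition chain_cplx ::
  "('a, 'r) ring_scheme \<Rightarrow> (nat \<Rightarrow> ('a, 'p) module) \<Rightarrow> (nat \<Rightarrow> 'p \<Rightarrow> 'p) \<Rightarrow> bool" where
  "chain_cplx A P \<delta> \<longleftrightarrow> (\<forall>n. module A (P n)) \<and> (\<forall>n. \<delta> n \<in> module_hom A (P (Suc n)) (P n)) \<and>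
     (\<forall>n. \<forall>x \<in> carrier (P (Suc (Suc n))). \<delta> n (\<delta> (Suc n) x) = \<zero>\<^bsub>P n\<^esub>)"

text \<open>Stands in for projectivity of the terms of \<open>P\<close>: they lift along the
  augmentation and the differentials of the one resolution \<open>Q\<close>.\<close>

definition lifts_along ::
  "('a, 'r) ring_scheme \<Rightarrow> (nat \<Rightarrow> ('a, 'p) module) \<Rightarrow> ('a, 'm, 'e) module_scheme \<Rightarrow>
     (nat \<Rightarrow> ('a, 'q) module) \<Rightarrow> (nat \<Rightarrow> 'q \<Rightarrow> 'q) \<Rightarrow> ('q \<Rightarrow> 'm) \<Rightarrow> bool" where
  "lifts_along A P M Q d e \<longleftrightarrow>
     (\<forall>n. lifts A (P n) e (Q 0) M \<and> (\<forall>m. lifts A (P n) (d (Suc m)) (Q (Suc m)) (Q m)))"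

lemma chain_cplxD:
  assumes "chain_cplx A P \<delta>"
  shows "module A (P n)" "\<delta> n \<in> module_hom A (P (Suc n)) (P n)"
    "x \<in> carrier (P (Suc (Suc n))) \<Longrightarrow> \<delta> n (\<delta> (Suc n) x) = \<zero>\<^bsub>P n\<^esub>"
  using assms unfolding chain_cplx_def by auto

lemma resolutionD:
  assumes "resolution A M P d e"
  shows "module A (P n)" "e \<in> module_hom A (P 0) M" "d (Suc n) \<in> module_hom A (P (Suc n)) (P n)"
    "e ` carrier (P 0) = carrier M"
    "y \<in> carrier (P (Suc 0)) \<Longrightarrow> e (d (Suc 0) y) = \<zero>\<^bsub>M\<^esub>"
    "x \<in> carrier (P 0) \<Longrightarrow> e x = \<zero>\<^bsub>M\<^esub> \<Longrightarrow> \<exists>y \<in> carrier (P (Suc 0)). d (Suc 0) y = x"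
    "z \<in> carrier (P (Suc (Suc n))) \<Longrightarrow> d (Suc n) (d (Suc (Suc n)) z) = \<zero>\<^bsub>P n\<^esub>"
    "w \<in> carrier (P (Suc n)) \<Longrightarrow> d (Suc n) w = \<zero>\<^bsub>P n\<^esub> \<Longrightarrow>
      \<exists>y \<in> carrier (P (Suc (Suc n))). d (Suc (Suc n)) y = w"
proof -
  have im1: "d (Suc 0) ` carrier (P (Suc 0)) = {x \<in> carrier (P 0). e x = \<zero>\<^bsub>M\<^esub>}"
    and im2: "d (Suc (Suc n)) ` carrier (P (Suc (Suc n))) = {x \<in> carrier (P (Suc n)). d (Suc n) x = \<zero>\<^bsub>P n\<^esub>}"
    using assms unfolding resolution_def by auto
  show "module A (P n)" "e \<in> module_hom A (P 0) M" "d (Suc n) \<in> module_hom A (P (Suc n)) (P n)"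
    "e ` carrier (P 0) = carrier M"
    using assms unfolding resolution_def by auto
  show "e (d (Suc 0) y) = \<zero>\<^bsub>M\<^esub>" if "y \<in> carrier (P (Suc 0))"
    using im1 imageI[OF that, of "d (Suc 0)"] by simp
  show "\<exists>y \<in> carrier (P (Suc 0)). d (Suc 0) y = x" if "x \<in> carrier (P 0)" "e x = \<zero>\<^bsub>M\<^esub>"
  proof -
    have "x \<in> d (Suc 0) ` carrier (P (Suc 0))" unfolding im1 using that by simp
    then show ?thesis by auto
  qed
  show "d (Suc n) (d (Suc (Suc n)) z) = \<zero>\<^bsub>P n\<^esub>" if "z \<in> carrier (P (Suc (Suc n)))"
    using im2 imageI[OF that, of "d (Suc (Suc n))"] by simp
  show "\<exists>y \<in> carrier (P (Suc (Suc n))). d (Suc (Suc n)) y = w"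
    if "w \<in> carrier (P (Suc n))" "d (Suc n) w = \<zero>\<^bsub>P n\<^esub>"
  proof -
    have "w \<in> d (Suc (Suc n)) ` carrier (P (Suc (Suc n)))" unfolding im2 using that by simp
    then show ?thesis by auto
  qed
qed

lemma resolution_chain_cplx:
  "resolution A M P d e \<Longrightarrow> chain_cplx A (\<lambda>n. P (n + k)) (\<lambda>n. d (Suc (n + k)))"
  unfolding chain_cplx_def by (auto intro: resolutionD)

text \<open>The usual degreewise lifting. Exactness is required of \<open>Q\<close> only and
  \<open>eps\<close> need not be onto, so that \<open>P\<close> may be a truncated resolution and
  \<open>eps\<close> a cocycle of positive degree.\<close>

lemma comparison_map:
  assumes Q: "resolution A N Q dQ eN" and N: "module A N"
    and P: "chain_cplx A P \<delta>" and lift: "lifts_along A P N Q dQ eN"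
    and eps: "eps \<in> module_hom A (P 0) N" "\<And>x. x \<in> carrier (P (Suc 0)) \<Longrightarrow> eps (\<delta> 0 x) = \<zero>\<^bsub>N\<^esub>"
  shows "\<exists>\<phi>. (\<forall>n. \<phi> n \<in> module_hom A (P n) (Q n)) \<and> (\<forall>x \<in> carrier (P 0). eN (\<phi> 0 x) = eps x) \<and>
     (\<forall>n. \<forall>x \<in> carrier (P (Suc n)). dQ (Suc n) (\<phi> (Suc n) x) = \<phi> n (\<delta> n x))"
proof -
  note Pm = chain_cplxD(1)[OF P] and \<delta> = chain_cplxD(2)[OF P] and \<delta>\<delta> = chain_cplxD(3)[OF P]
  note Qm = resolutionD(1)[OF Q] and eN = resolutionD(2)[OF Q] and dQ = resolutionD(3)[OF Q]
  \<comment> \<open>The last clause, that \<open>f\<close> after the differential lands in the image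
    of \<open>dQ\<close>, is precisely what the next lifting asks for.\<close>
  let ?I = "\<lambda>n f. f \<in> module_hom A (P n) (Q n) \<and> (n = 0 \<longrightarrow> (\<forall>x \<in> carrier (P 0). eN (f x) = eps x)) \<and>
    (\<forall>x \<in> carrier (P (Suc n)). \<exists>y \<in> carrier (Q (Suc n)). dQ (Suc n) y = f (\<delta> n x))"
  let ?R = "\<lambda>n f g. \<forall>x \<in> carrier (P (Suc n)). dQ (Suc n) (g x) = f (\<delta> n x)"
  have "\<exists>\<phi>. \<forall>n. ?I n (\<phi> n) \<and> ?R n (\<phi> n) (\<phi> (Suc n))"
  proof (rule dependent_nat_choice)
    have ex: "\<exists>y\<in>carrier (Q 0). eN y = eps x" if "x \<in> carrier (P 0)" for x
    proof -
      have "eps x \<in> eN ` carrier (Q 0)"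
        unfolding resolutionD(4)[OF Q] by (rule module_hom_in[OF eps(1) that])
      then show ?thesis by auto
    qed
    have l0: "lifts A (P 0) eN (Q 0) N" using lift unfolding lifts_along_def by auto
    from liftsD[OF l0 eps(1) ex] obtain f
      where f: "f \<in> module_hom A (P 0) (Q 0)" "\<forall>x \<in> carrier (P 0). eN (f x) = eps x" by blast
    have "\<exists>y \<in> carrier (Q (Suc 0)). dQ (Suc 0) y = f (\<delta> 0 x)" if x: "x \<in> carrier (P (Suc 0))" for x
      using module_hom_in[OF \<delta> x] f(2) eps(2)[OF x] module_hom_in[OF f(1)]
      by (intro resolutionD(6)[OF Q]) auto
    then show "\<exists>f. ?I 0 f" using f by blast
    fix f n assume I: "?I n f"
    have hom: "(\<lambda>x. f (\<delta> n x)) \<in> module_hom A (P (Suc n)) (Q n)"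
      using I by (intro module_hom_comp[OF \<delta>]) simp
    have ln: "lifts A (P (Suc n)) (dQ (Suc n)) (Q (Suc n)) (Q n)" using lift unfolding lifts_along_def by auto
    from I have ex: "\<And>x. x \<in> carrier (P (Suc n)) \<Longrightarrow> \<exists>y \<in> carrier (Q (Suc n)). dQ (Suc n) y = f (\<delta> n x)" by blast
    from liftsD[OF ln hom ex] obtain g
      where g: "g \<in> module_hom A (P (Suc n)) (Q (Suc n))" "?R n f g" by blast
    have "\<exists>y \<in> carrier (Q (Suc (Suc n))). dQ (Suc (Suc n)) y = g (\<delta> (Suc n) x)"
      if x: "x \<in> carrier (P (Suc (Suc n)))" for x
    proof (rule resolutionD(8)[OF Q])
      have dx: "\<delta> (Suc n) x \<in> carrier (P (Suc n))" by (rule module_hom_in[OF \<delta> x])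
      then show "g (\<delta> (Suc n) x) \<in> carrier (Q (Suc n))" by (rule module_hom_in[OF g(1)])
      have "dQ (Suc n) (g (\<delta> (Suc n) x)) = f \<zero>\<^bsub>P n\<^esub>" using g(2) dx \<delta>\<delta>[OF x] by simp
      then show "dQ (Suc n) (g (\<delta> (Suc n) x)) = \<zero>\<^bsub>Q n\<^esub>"
        using module_hom_zero[OF Pm Qm, of f n n] I by simp
    qed
    then show "\<exists>g. ?I (Suc n) g \<and> ?R n f g" using g by blast
  qed
  then obtain \<phi> where "\<forall>n. ?I n (\<phi> n) \<and> ?R n (\<phi> n) (\<phi> (Suc n))" by (rule exE)
  then show ?thesis by (intro exI[of _ \<phi>]) auto
qed

text \<open>For \<open>a = 0\<close> this is the uniqueness of lifts up to homotopy. On a truncated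
  complex a homotopy has one further component, defined on the term just below the truncation;
  \<open>a\<close> is the contribution of that component in degree 0.\<close>

lemma homotopy:
  assumes Q: "resolution A N Q dQ eN" and N: "module A N"
    and P: "chain_cplx A P \<delta>" and lift: "lifts_along A P N Q dQ eN"
    and \<psi>: "\<And>n. \<psi> n \<in> module_hom A (P n) (Q n)"
      "\<And>n x. x \<in> carrier (P (Suc n)) \<Longrightarrow> dQ (Suc n) (\<psi> (Suc n) x) = \<psi> n (\<delta> n x)"
    and a: "a \<in> module_hom A (P 0) (Q 0)" "\<And>x. x \<in> carrier (P 0) \<Longrightarrow> eN (\<psi> 0 x) = eN (a x)"
      "\<And>x. x \<in> carrier (P (Suc 0)) \<Longrightarrow> a (\<delta> 0 x) = \<zero>\<^bsub>Q 0\<^esub>"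
  shows "\<exists>s. (\<forall>n. s n \<in> module_hom A (P n) (Q (Suc n))) \<and>
     (\<forall>x \<in> carrier (P 0). \<psi> 0 x = dQ (Suc 0) (s 0 x) \<oplus>\<^bsub>Q 0\<^esub> a x) \<and>
     (\<forall>n. \<forall>x \<in> carrier (P (Suc n)).
        \<psi> (Suc n) x = dQ (Suc (Suc n)) (s (Suc n) x) \<oplus>\<^bsub>Q (Suc n)\<^esub> s n (\<delta> n x))"
proof -
  note Pm = chain_cplxD(1)[OF P] and \<delta> = chain_cplxD(2)[OF P] and \<delta>\<delta> = chain_cplxD(3)[OF P]
  note Qm = resolutionD(1)[OF Q] and eN = resolutionD(2)[OF Q] and dQ = resolutionD(3)[OF Q]
  have cancel: "x = y \<oplus>\<^bsub>Q n\<^esub> z" if "y = x \<ominus>\<^bsub>Q n\<^esub> z" "x \<in> carrier (Q n)" "z \<in> carrier (Q n)" for x y z n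
  proof -
    interpret Qn: module A "Q n" by (rule Qm)
    show ?thesis using that unfolding a_minus_def by (simp add: Qn.a_assoc Qn.l_neg)
  qed
  \<comment> \<open>The last clause says that \<open>\<psi> (Suc n) x\<close> minus
    \<open>s (\<delta> n x)\<close> is a cycle, so exactness of \<open>Q\<close> lets the homotopy
    continue.\<close>
  let ?I = "\<lambda>n s. s \<in> module_hom A (P n) (Q (Suc n)) \<and>
    (n = 0 \<longrightarrow> (\<forall>x \<in> carrier (P 0). dQ (Suc 0) (s x) = \<psi> 0 x \<ominus>\<^bsub>Q 0\<^esub> a x)) \<and>
    (\<forall>x \<in> carrier (P (Suc n)). dQ (Suc n) (s (\<delta> n x)) = \<psi> n (\<delta> n x))"
  let ?R = "\<lambda>n s s'. \<forall>x \<in> carrier (P (Suc n)).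
     dQ (Suc (Suc n)) (s' x) = \<psi> (Suc n) x \<ominus>\<^bsub>Q (Suc n)\<^esub> s (\<delta> n x)"
  have "\<exists>s. \<forall>n. ?I n (s n) \<and> ?R n (s n) (s (Suc n))"
  proof (rule dependent_nat_choice)
    interpret N: module A N by (rule N)
    interpret Q0: module A "Q 0" by (rule Qm)
    have hom: "(\<lambda>x. \<psi> 0 x \<ominus>\<^bsub>Q 0\<^esub> a x) \<in> module_hom A (P 0) (Q 0)"
      by (rule module_hom_minus[OF Qm \<psi>(1) a(1)])
    have ex: "\<exists>y \<in> carrier (Q (Suc 0)). dQ (Suc 0) y = \<psi> 0 x \<ominus>\<^bsub>Q 0\<^esub> a x" if x: "x \<in> carrier (P 0)" for x
    proof (rule resolutionD(6)[OF Q])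
      note c = module_hom_in[OF \<psi>(1) x] module_hom_in[OF a(1) x]
      show "\<psi> 0 x \<ominus>\<^bsub>Q 0\<^esub> a x \<in> carrier (Q 0)" by (rule module_hom_in[OF hom x])
      show "eN (\<psi> 0 x \<ominus>\<^bsub>Q 0\<^esub> a x) = \<zero>\<^bsub>N\<^esub>"
        unfolding module_hom_diff[OF Qm N eN c] using a(2)[OF x] module_hom_in[OF eN] c by simp
    qed
    have l0: "lifts A (P 0) (dQ (Suc 0)) (Q (Suc 0)) (Q 0)" using lift unfolding lifts_along_def by auto
    from liftsD[OF l0 hom ex] obtain s
      where s: "s \<in> module_hom A (P 0) (Q (Suc 0))" "\<forall>x \<in> carrier (P 0). dQ (Suc 0) (s x) = \<psi> 0 x \<ominus>\<^bsub>Q 0\<^esub> a x"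
      by blast
    have "dQ (Suc 0) (s (\<delta> 0 x)) = \<psi> 0 (\<delta> 0 x)" if x: "x \<in> carrier (P (Suc 0))" for x
    proof -
      note dx = module_hom_in[OF \<delta> x]
      show ?thesis
        using s(2) dx a(3)[OF x] module_hom_in[OF \<psi>(1) dx] by (simp add: a_minus_def)
    qed
    then show "\<exists>s. ?I 0 s" using s by blast
    fix s n assume I: "?I n s"
    then have s: "s \<in> module_hom A (P n) (Q (Suc n))" by simp
    interpret Qn: module A "Q n" by (rule Qm)
    interpret QS: module A "Q (Suc n)" by (rule Qm)
    have s\<delta>: "(\<lambda>x. s (\<delta> n x)) \<in> module_hom A (P (Suc n)) (Q (Suc n))"
      by (rule module_hom_comp[OF \<delta> s])
    have hom: "(\<lambda>x. \<psi> (Suc n) x \<ominus>\<^bsub>Q (Suc n)\<^esub> s (\<delta> n x)) \<in> module_hom A (P (Suc n)) (Q (Suc n))"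
      by (rule module_hom_minus[OF Qm \<psi>(1) s\<delta>])
    have ex: "\<exists>y \<in> carrier (Q (Suc (Suc n))). dQ (Suc (Suc n)) y = \<psi> (Suc n) x \<ominus>\<^bsub>Q (Suc n)\<^esub> s (\<delta> n x)"
      if x: "x \<in> carrier (P (Suc n))" for x
    proof (rule resolutionD(8)[OF Q])
      note c = module_hom_in[OF \<psi>(1) x] module_hom_in[OF s\<delta> x]
      show "\<psi> (Suc n) x \<ominus>\<^bsub>Q (Suc n)\<^esub> s (\<delta> n x) \<in> carrier (Q (Suc n))" by (rule module_hom_in[OF hom x])
      have "dQ (Suc n) (s (\<delta> n x)) = \<psi> n (\<delta> n x)" using I x by simp
      then show "dQ (Suc n) (\<psi> (Suc n) x \<ominus>\<^bsub>Q (Suc n)\<^esub> s (\<delta> n x)) = \<zero>\<^bsub>Q n\<^esub>"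
        unfolding module_hom_diff[OF Qm Qm dQ c] \<psi>(2)[OF x]
        using module_hom_in[OF \<psi>(1) module_hom_in[OF \<delta> x]] by simp
    qed
    have ln: "lifts A (P (Suc n)) (dQ (Suc (Suc n))) (Q (Suc (Suc n))) (Q (Suc n))"
      using lift unfolding lifts_along_def by auto
    from liftsD[OF ln hom ex] obtain s'
      where s': "s' \<in> module_hom A (P (Suc n)) (Q (Suc (Suc n)))" "?R n s s'" by blast
    have "dQ (Suc (Suc n)) (s' (\<delta> (Suc n) x)) = \<psi> (Suc n) (\<delta> (Suc n) x)"
      if x: "x \<in> carrier (P (Suc (Suc n)))" for x
    proof -
      note dx = module_hom_in[OF \<delta> x]
      have "dQ (Suc (Suc n)) (s' (\<delta> (Suc n) x)) = \<psi> (Suc n) (\<delta> (Suc n) x) \<ominus>\<^bsub>Q (Suc n)\<^esub> s \<zero>\<^bsub>P n\<^esub>"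
        using s'(2) dx \<delta>\<delta>[OF x] by simp
      then show ?thesis
        using module_hom_zero[OF Pm Qm s] module_hom_in[OF \<psi>(1) dx] by (simp add: a_minus_def)
    qed
    then show "\<exists>s'. ?I (Suc n) s' \<and> ?R n s s'" using s' by blast
  qed
  then obtain s where s: "\<forall>n. ?I n (s n) \<and> ?R n (s n) (s (Suc n))" by (rule exE)
  have hs: "s n \<in> module_hom A (P n) (Q (Suc n))" for n using s by blast
  show ?thesis
  proof (intro exI[of _ s] conjI allI ballI hs)
    fix x assume x: "x \<in> carrier (P 0)"
    have "dQ (Suc 0) (s 0 x) = \<psi> 0 x \<ominus>\<^bsub>Q 0\<^esub> a x" using s x by blast
    then show "\<psi> 0 x = dQ (Suc 0) (s 0 x) \<oplus>\<^bsub>Q 0\<^esub> a x"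
      by (rule cancel[OF _ module_hom_in[OF \<psi>(1) x] module_hom_in[OF a(1) x]])
  next
    fix n x assume x: "x \<in> carrier (P (Suc n))"
    have "dQ (Suc (Suc n)) (s (Suc n) x) = \<psi> (Suc n) x \<ominus>\<^bsub>Q (Suc n)\<^esub> s n (\<delta> n x)" using s x by blast
    then show "\<psi> (Suc n) x = dQ (Suc (Suc n)) (s (Suc n) x) \<oplus>\<^bsub>Q (Suc n)\<^esub> s n (\<delta> n x)"
      by (rule cancel[OF _ module_hom_in[OF \<psi>(1) x] module_hom_in[OF hs module_hom_in[OF \<delta> x]]])
  qed
qed

text \<open>\<open>P\<close> is a retract of \<open>Q\<close> up to homotopy: the identity and the
  composite through \<open>Q\<close> both cover the identity of \<open>M\<close>. Only this
  composite is treated; the opposite one arises by exchanging \<open>P\<close> and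
  \<open>Q\<close>.\<close>

lemma resolution_retract:
  assumes P: "resolution A M P dP eP" and Q: "resolution A M Q dQ eQ" and M: "module A M"
    and PQ: "lifts_along A P M Q dQ eQ" and QP: "lifts_along A Q M P dP eP"
    and PP: "lifts_along A P M P dP eP"
  shows "\<exists>\<alpha> \<beta> s. (\<forall>n. \<alpha> n \<in> module_hom A (P n) (Q n)) \<and> (\<forall>n. \<beta> n \<in> module_hom A (Q n) (P n)) \<and>
     (\<forall>n. s n \<in> module_hom A (P n) (P (Suc n))) \<and>
     (\<forall>n. \<forall>x \<in> carrier (P (Suc n)). dQ (Suc n) (\<alpha> (Suc n) x) = \<alpha> n (dP (Suc n) x)) \<and>
     (\<forall>n. \<forall>x \<in> carrier (Q (Suc n)). dP (Suc n) (\<beta> (Suc n) x) = \<beta> n (dQ (Suc n) x)) \<and>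
     (\<forall>x \<in> carrier (P 0). x = \<beta> 0 (\<alpha> 0 x) \<oplus>\<^bsub>P 0\<^esub> dP (Suc 0) (s 0 x)) \<and>
     (\<forall>n. \<forall>x \<in> carrier (P (Suc n)). x = \<beta> (Suc n) (\<alpha> (Suc n) x) \<oplus>\<^bsub>P (Suc n)\<^esub>
        (dP (Suc (Suc n)) (s (Suc n) x) \<oplus>\<^bsub>P (Suc n)\<^esub> s n (dP (Suc n) x)))"
proof -
  note Pc = resolution_chain_cplx[OF P, of 0, simplified] and Qc = resolution_chain_cplx[OF Q, of 0, simplified]
  note Pm = resolutionD(1)[OF P] and Qm = resolutionD(1)[OF Q]
  obtain \<alpha> where \<alpha>: "\<And>n. \<alpha> n \<in> module_hom A (P n) (Q n)" "\<And>x. x \<in> carrier (P 0) \<Longrightarrow> eQ (\<alpha> 0 x) = eP x"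
    "\<And>n x. x \<in> carrier (P (Suc n)) \<Longrightarrow> dQ (Suc n) (\<alpha> (Suc n) x) = \<alpha> n (dP (Suc n) x)"
    using comparison_map[OF Q M Pc PQ resolutionD(2)[OF P] resolutionD(5)[OF P]] by blast
  obtain \<beta> where \<beta>: "\<And>n. \<beta> n \<in> module_hom A (Q n) (P n)" "\<And>x. x \<in> carrier (Q 0) \<Longrightarrow> eP (\<beta> 0 x) = eQ x"
    "\<And>n x. x \<in> carrier (Q (Suc n)) \<Longrightarrow> dP (Suc n) (\<beta> (Suc n) x) = \<beta> n (dQ (Suc n) x)"
    using comparison_map[OF P M Qc QP resolutionD(2)[OF Q] resolutionD(5)[OF Q]] by blast
  \<comment> \<open>The defect of the composite from the identity, a chain map covering zero on
    \<open>M\<close> and therefore null-homotopic.\<close>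
  define \<psi> where "\<psi> n x = x \<ominus>\<^bsub>P n\<^esub> \<beta> n (\<alpha> n x)" for n x
  have \<beta>\<alpha>: "(\<lambda>x. \<beta> n (\<alpha> n x)) \<in> module_hom A (P n) (P n)" for n
    by (rule module_hom_comp[OF \<alpha>(1) \<beta>(1)])
  have \<psi>: "\<psi> n \<in> module_hom A (P n) (P n)" for n
    unfolding \<psi>_def[abs_def] by (rule module_hom_minus[OF Pm module_hom_id \<beta>\<alpha>])
  have \<psi>d: "dP (Suc n) (\<psi> (Suc n) x) = \<psi> n (dP (Suc n) x)" if x: "x \<in> carrier (P (Suc n))" for n x
    unfolding \<psi>_def module_hom_diff[OF Pm Pm resolutionD(3)[OF P] x module_hom_in[OF \<beta>\<alpha> x]]
    using \<beta>(3)[OF module_hom_in[OF \<alpha>(1) x]] \<alpha>(3)[OF x] by simp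
  interpret P0: module A "P 0" by (rule Pm)
  interpret M: module A M by (rule M)
  have e\<psi>: "eP (\<psi> 0 x) = eP \<zero>\<^bsub>P 0\<^esub>" if x: "x \<in> carrier (P 0)" for x
    unfolding \<psi>_def module_hom_diff[OF Pm M resolutionD(2)[OF P] x module_hom_in[OF \<beta>\<alpha> x]]
    using \<beta>(2)[OF module_hom_in[OF \<alpha>(1) x]] \<alpha>(2)[OF x] module_hom_in[OF resolutionD(2)[OF P] x]
    by (simp add: module_hom_zero[OF Pm M resolutionD(2)[OF P]])
  obtain s where s: "\<And>n. s n \<in> module_hom A (P n) (P (Suc n))"
    "\<And>x. x \<in> carrier (P 0) \<Longrightarrow> \<psi> 0 x = dP (Suc 0) (s 0 x) \<oplus>\<^bsub>P 0\<^esub> \<zero>\<^bsub>P 0\<^esub>"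
    "\<And>n x. x \<in> carrier (P (Suc n)) \<Longrightarrow>
       \<psi> (Suc n) x = dP (Suc (Suc n)) (s (Suc n) x) \<oplus>\<^bsub>P (Suc n)\<^esub> s n (dP (Suc n) x)"
    using homotopy[where \<psi> = \<psi> and a = "\<lambda>x. \<zero>\<^bsub>P 0\<^esub>", OF P M Pc PP \<psi> \<psi>d module_hom_const_zero[OF Pm] e\<psi>]
    by blast
  have split: "x = \<beta> n (\<alpha> n x) \<oplus>\<^bsub>P n\<^esub> \<psi> n x" if x: "x \<in> carrier (P n)" for n x
  proof -
    interpret Pn: module A "P n" by (rule Pm)
    show ?thesis unfolding \<psi>_def a_minus_def
      using x module_hom_in[OF \<beta>\<alpha> x] by (simp add: Pn.a_lcomm Pn.r_neg)
  qed
  show ?thesis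
  proof (intro exI[of _ \<alpha>] exI[of _ \<beta>] exI[of _ s] conjI allI ballI \<alpha>(1,3) \<beta>(1,3) s(1))
    fix x assume x: "x \<in> carrier (P 0)"
    have "dP (Suc 0) (s 0 x) \<in> carrier (P 0)"
      by (rule module_hom_in[OF resolutionD(3)[OF P] module_hom_in[OF s(1) x]])
    then show "x = \<beta> 0 (\<alpha> 0 x) \<oplus>\<^bsub>P 0\<^esub> dP (Suc 0) (s 0 x)"
      using split[OF x] s(2)[OF x] by simp
  next
    fix n x assume x: "x \<in> carrier (P (Suc n))"
    show "x = \<beta> (Suc n) (\<alpha> (Suc n) x) \<oplus>\<^bsub>P (Suc n)\<^esub>
        (dP (Suc (Suc n)) (s (Suc n) x) \<oplus>\<^bsub>P (Suc n)\<^esub> s n (dP (Suc n) x))"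
      using split[OF x] s(3)[OF x] by simp
  qed
qed


section \<open>Vanishing of Ext\<close>

text \<open>Vanishing of \<open>Ext\<close> in degree \<open>n + 1\<close>, the index being one
  below the degree. The formulation by cochains applies to any resolution, in particular to a
  cone.\<close>

definition ext_vanish ::
  "('a, 'r) ring_scheme \<Rightarrow> (nat \<Rightarrow> ('a, 'p) module) \<Rightarrow> (nat \<Rightarrow> 'p \<Rightarrow> 'p) \<Rightarrow>
     ('a, 'n, 'f) module_scheme \<Rightarrow> nat \<Rightarrow> bool" where
  "ext_vanish A P d N n \<longleftrightarrow> (\<forall>g \<in> module_hom A (P (Suc n)) N.
     (\<forall>x \<in> carrier (P (Suc (Suc n))). g (d (Suc (Suc n)) x) = \<zero>\<^bsub>N\<^esub>) \<longrightarrow>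
     (\<exists>h \<in> module_hom A (P n) N. \<forall>x \<in> carrier (P (Suc n)). g x = h (d (Suc n) x)))"

lemma ext_vanishD:
  assumes "ext_vanish A P d N n" "g \<in> module_hom A (P (Suc n)) N"
    and "\<And>x. x \<in> carrier (P (Suc (Suc n))) \<Longrightarrow> g (d (Suc (Suc n)) x) = \<zero>\<^bsub>N\<^esub>"
  shows "\<exists>h. h \<in> module_hom A (P n) N \<and> (\<forall>x \<in> carrier (P (Suc n)). g x = h (d (Suc n) x))"
  using assms unfolding ext_vanish_def by blast

text \<open>A cocycle \<open>g\<close> on \<open>Q\<close> is pulled back to \<open>P\<close>, where
  it bounds some \<open>h\<close>. The retraction identity then gives
  \<open>g x = h (\<beta> (d x)) + g (s (d x))\<close>, since \<open>g\<close> kills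
  boundaries.\<close>

lemma ext_vanish_transfer:
  assumes P: "resolution A M P dP eP" and Q: "resolution A M Q dQ eQ" and M: "module A M"
    and N: "module A N"
    and PQ: "lifts_along A P M Q dQ eQ" and QP: "lifts_along A Q M P dP eP"
    and QQ: "lifts_along A Q M Q dQ eQ" and van: "ext_vanish A P dP N n"
  shows "ext_vanish A Q dQ N n"
  unfolding ext_vanish_def
proof (intro ballI impI)
  fix g assume g: "g \<in> module_hom A (Q (Suc n)) N"
    and cyc: "\<forall>x \<in> carrier (Q (Suc (Suc n))). g (dQ (Suc (Suc n)) x) = \<zero>\<^bsub>N\<^esub>"
  interpret N: module A N by (rule N)
  note Pm = resolutionD(1)[OF P] and Qm = resolutionD(1)[OF Q]
  note dP = resolutionD(3)[OF P] and dQ = resolutionD(3)[OF Q]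
  interpret QS: module A "Q (Suc n)" by (rule Qm)
  from resolution_retract[OF Q P M QP PQ QQ] obtain \<beta> \<alpha> s
    where \<beta>: "\<And>n. \<beta> n \<in> module_hom A (Q n) (P n)" and \<alpha>: "\<And>n. \<alpha> n \<in> module_hom A (P n) (Q n)"
    and s: "\<And>n. s n \<in> module_hom A (Q n) (Q (Suc n))"
    and \<beta>d: "\<And>n x. x \<in> carrier (Q (Suc n)) \<Longrightarrow> dP (Suc n) (\<beta> (Suc n) x) = \<beta> n (dQ (Suc n) x)"
    and \<alpha>d: "\<And>n x. x \<in> carrier (P (Suc n)) \<Longrightarrow> dQ (Suc n) (\<alpha> (Suc n) x) = \<alpha> n (dP (Suc n) x)"
    and eq: "\<And>n x. x \<in> carrier (Q (Suc n)) \<Longrightarrow> x = \<alpha> (Suc n) (\<beta> (Suc n) x) \<oplus>\<^bsub>Q (Suc n)\<^esub>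
        (dQ (Suc (Suc n)) (s (Suc n) x) \<oplus>\<^bsub>Q (Suc n)\<^esub> s n (dQ (Suc n) x))"
    by blast
  have "(\<lambda>x. g (\<alpha> (Suc n) x)) \<in> module_hom A (P (Suc n)) N" by (rule module_hom_comp[OF \<alpha> g])
  moreover have "g (\<alpha> (Suc n) (dP (Suc (Suc n)) x)) = \<zero>\<^bsub>N\<^esub>" if "x \<in> carrier (P (Suc (Suc n)))" for x
    using bspec[OF cyc module_hom_in[OF \<alpha> that]] unfolding \<alpha>d[OF that] .
  ultimately obtain h where h: "h \<in> module_hom A (P n) N"
    "\<And>x. x \<in> carrier (P (Suc n)) \<Longrightarrow> g (\<alpha> (Suc n) x) = h (dP (Suc n) x)"
    using ext_vanishD[OF van] by blast
  show "\<exists>h\<in>module_hom A (Q n) N. \<forall>x\<in>carrier (Q (Suc n)). g x = h (dQ (Suc n) x)"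
  proof (intro bexI ballI)
    show "(\<lambda>x. h (\<beta> n x) \<oplus>\<^bsub>N\<^esub> g (s n x)) \<in> module_hom A (Q n) N"
      by (intro module_hom_plus N module_hom_comp[OF \<beta> h(1)] module_hom_comp[OF s g])
    fix x assume x: "x \<in> carrier (Q (Suc n))"
    note dx = module_hom_in[OF dQ x]
    note ba = module_hom_in[OF \<alpha> module_hom_in[OF \<beta> x]]
    note ds = module_hom_in[OF dQ module_hom_in[OF s x]]
    note sd = module_hom_in[OF s dx]
    have "g x = g (\<alpha> (Suc n) (\<beta> (Suc n) x) \<oplus>\<^bsub>Q (Suc n)\<^esub>
        (dQ (Suc (Suc n)) (s (Suc n) x) \<oplus>\<^bsub>Q (Suc n)\<^esub> s n (dQ (Suc n) x)))"
      using eq[OF x] by simp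
    also have "\<dots> = g (\<alpha> (Suc n) (\<beta> (Suc n) x)) \<oplus>\<^bsub>N\<^esub>
       (g (dQ (Suc (Suc n)) (s (Suc n) x)) \<oplus>\<^bsub>N\<^esub> g (s n (dQ (Suc n) x)))"
      using ba ds sd by (simp add: module_hom_add[OF g])
    also have "g (dQ (Suc (Suc n)) (s (Suc n) x)) = \<zero>\<^bsub>N\<^esub>" using cyc module_hom_in[OF s x] by simp
    also have "g (\<alpha> (Suc n) (\<beta> (Suc n) x)) = h (\<beta> n (dQ (Suc n) x))"
      using h(2)[OF module_hom_in[OF \<beta> x]] \<beta>d[OF x] by simp
    finally show "g x = h (\<beta> n (dQ (Suc n) x)) \<oplus>\<^bsub>N\<^esub> g (s n (dQ (Suc n) x))"
      using module_hom_in[OF g sd] by simp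
  qed
qed

text \<open>The zero of \<open>Ext\<close> is the set of coboundaries, so a cocycle whose coset is
  zero is itself a coboundary.\<close>

lemma ext_vanish_of_Ext:
  assumes M: "\<And>n. module A (res_module A M n)" and N: "module A N"
    and d: "\<And>n. res_map A M (Suc n) \<in> module_hom A (res_module A M (Suc n)) (res_module A M n)"
    and van: "carrier (Ext A (Suc n) M N) = {\<zero>\<^bsub>Ext A (Suc n) M N\<^esub>}"
  shows "ext_vanish A (res_module A M) (res_map A M) N n"
  unfolding ext_vanish_def
proof (intro ballI impI)
  interpret N: module A N by (rule N)
  let ?F = "res_module A M" and ?d = "res_map A M"
  let ?B = "Ext_coboundaries A (Suc n) M N"
  let ?H = "Hom_module A (?F (Suc n)) N"
  fix g assume g: "g \<in> module_hom A (?F (Suc n)) N"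
    and cyc: "\<forall>x \<in> carrier (?F (Suc (Suc n))). g (?d (Suc (Suc n)) x) = \<zero>\<^bsub>N\<^esub>"
  let ?f = "restrict g (carrier (?F (Suc n)))"
  have "?f \<in> carrier ?H"
    using restrict_hom[OF M g] .
  then have f: "?f \<in> Ext_cocycles A (Suc n) M N"
    unfolding Ext_cocycles_def using cyc module_hom_in[OF d] by auto
  have B: "?B = (\<lambda>g. restrict (g \<circ> ?d (Suc n)) (carrier (?F (Suc n)))) ` carrier (Hom_module A (?F n) N)"
    unfolding Ext_coboundaries_def by simp
  have z: "restrict (\<lambda>x. \<zero>\<^bsub>N\<^esub>) (carrier (?F n)) \<in> carrier (Hom_module A (?F n) N)"
    by (rule restrict_hom[OF M module_hom_const_zero[OF N]])
  have "restrict (restrict (\<lambda>x. \<zero>\<^bsub>N\<^esub>) (carrier (?F n)) \<circ> ?d (Suc n)) (carrier (?F (Suc n))) \<in> ?B"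
    unfolding B by (rule imageI[OF z])
  moreover have "restrict (restrict (\<lambda>x. \<zero>\<^bsub>N\<^esub>) (carrier (?F n)) \<circ> ?d (Suc n)) (carrier (?F (Suc n))) = \<zero>\<^bsub>?H\<^esub>"
    unfolding Hom_simps using module_hom_in[OF d] by (intro restrict_ext) simp
  ultimately have zB: "\<zero>\<^bsub>?H\<^esub> \<in> ?B" by simp
  have "\<zero>\<^bsub>?H\<^esub> \<oplus>\<^bsub>?H\<^esub> ?f = ?f"
    unfolding Hom_simps using module_hom_in[OF g] by (intro restrict_ext) simp
  \<comment> \<open>Zero is a coboundary, hence the cocycle lies in its own coset.\<close>
  then have "?f \<in> ?B +>\<^bsub>?H\<lparr>carrier := Ext_cocycles A (Suc n) M N\<rparr>\<^esub> ?f"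
    using zB unfolding a_r_coset_def' by force
  moreover have "?B +>\<^bsub>?H\<lparr>carrier := Ext_cocycles A (Suc n) M N\<rparr>\<^esub> ?f \<in> carrier (Ext A (Suc n) M N)"
    using f unfolding Ext_def quotient_module_def by (auto simp: A_RCOSETS_def')
  moreover have "\<zero>\<^bsub>Ext A (Suc n) M N\<^esub> = ?B" unfolding Ext_def quotient_module_def by simp
  ultimately have "?f \<in> ?B" using van by simp
  then obtain h where h: "h \<in> carrier (Hom_module A (?F n) N)"
    "?f = restrict (h \<circ> ?d (Suc n)) (carrier (?F (Suc n)))" unfolding B by auto
  have "g x = h (?d (Suc n) x)" if "x \<in> carrier (?F (Suc n))" for x
    using fun_cong[OF h(2), of x] that by simp
  then show "\<exists>h\<in>module_hom A (?F n) N. \<forall>x\<in>carrier (?F (Suc n)). g x = h (?d (Suc n) x)"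
    using h(1) unfolding Hom_simps by blast
qed


section \<open>Quotients and mapping cones\<close>

lemma quotient_module_props:
  assumes M: "module A M" and H: "submodule A H M"
  defines "Q \<equiv> quotient_module M H"
  shows "module A Q" "(\<lambda>x. H +>\<^bsub>M\<^esub> x) \<in> module_hom A M Q"
    "(\<lambda>x. H +>\<^bsub>M\<^esub> x) ` carrier M = carrier Q"
    "x \<in> carrier M \<Longrightarrow> H +>\<^bsub>M\<^esub> x = \<zero>\<^bsub>Q\<^esub> \<longleftrightarrow> x \<in> H"
proof -
  interpret M: module A M by (rule M)
  interpret H: submodule A H M by (rule H)
  have ne: "H \<noteq> {}" using H.zero_closed by (metis empty_iff)
  have "subgroup H (add_monoid M)"
    by (rule M.add.subgroupI) (use ne H.subset H.m_closed submodule_neg[OF H] in auto)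
  then interpret S: abelian_subgroup H M
    by (intro abelian_subgroupI3 additive_subgroup.intro M.abelian_group_axioms)
  have surj: "(\<lambda>x. H +>\<^bsub>M\<^esub> x) ` carrier M = carrier Q"
    unfolding Q_def quotient_module_def by (auto simp: A_RCOSETS_def')
  have zero: "H +>\<^bsub>M\<^esub> \<zero>\<^bsub>M\<^esub> = \<zero>\<^bsub>Q\<^esub>"
    unfolding Q_def quotient_module_def using S.a_rcos_const by simp
  have add: "(H +>\<^bsub>M\<^esub> x) \<oplus>\<^bsub>Q\<^esub> (H +>\<^bsub>M\<^esub> y) = H +>\<^bsub>M\<^esub> (x \<oplus>\<^bsub>M\<^esub> y)"
    if "x \<in> carrier M" "y \<in> carrier M" for x y
    unfolding Q_def quotient_module_def using S.a_rcos_sum that by simp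
  have smult: "a \<odot>\<^bsub>Q\<^esub> (H +>\<^bsub>M\<^esub> x) = H +>\<^bsub>M\<^esub> (a \<odot>\<^bsub>M\<^esub> x)" if a: "a \<in> carrier A" and x: "x \<in> carrier M" for a x
  proof -
    \<comment> \<open>The scalar multiple in the quotient is a union over all representatives; here
      all the cosets in that union are shown to coincide.\<close>
    have eq: "H +>\<^bsub>M\<^esub> (a \<odot>\<^bsub>M\<^esub> z) = H +>\<^bsub>M\<^esub> (a \<odot>\<^bsub>M\<^esub> x)" if z: "z \<in> H +>\<^bsub>M\<^esub> x" for z
    proof -
      obtain h where h: "h \<in> H" "z = h \<oplus>\<^bsub>M\<^esub> x" using z by (auto simp: a_r_coset_def')
      then have "a \<odot>\<^bsub>M\<^esub> z = a \<odot>\<^bsub>M\<^esub> h \<oplus>\<^bsub>M\<^esub> a \<odot>\<^bsub>M\<^esub> x"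
        using a x H.subset by (auto simp: M.smult_r_distr)
      moreover have "a \<odot>\<^bsub>M\<^esub> h \<in> H" using a h by auto
      ultimately have "a \<odot>\<^bsub>M\<^esub> z \<in> H +>\<^bsub>M\<^esub> (a \<odot>\<^bsub>M\<^esub> x)" by (auto simp: a_r_coset_def')
      then show ?thesis using S.a_repr_independence' a x by simp
    qed
    have "H +>\<^bsub>M\<^esub> x \<noteq> {}" using S.a_rcos_self[OF x] by blast
    then have "(\<Union>z\<in>H +>\<^bsub>M\<^esub> x. H +>\<^bsub>M\<^esub> (a \<odot>\<^bsub>M\<^esub> z)) = H +>\<^bsub>M\<^esub> (a \<odot>\<^bsub>M\<^esub> x)"
      by (rule SUP_eq_const) (rule eq)
    then show ?thesis unfolding Q_def quotient_module_def by simp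
  qed
  show "module A Q"
  proof (rule module_transport(1)[of A M "\<lambda>x. H +>\<^bsub>M\<^esub> x" Q])
    show "module A M" by (rule M)
    show "(\<lambda>x. H +>\<^bsub>M\<^esub> x) ` carrier M = carrier Q" by (rule surj)
    show "H +>\<^bsub>M\<^esub> \<zero>\<^bsub>M\<^esub> = \<zero>\<^bsub>Q\<^esub>" by (rule zero)
  qed (simp_all only: add smult)
  show "(\<lambda>x. H +>\<^bsub>M\<^esub> x) \<in> module_hom A M Q"
    using surj by (intro module_homI) (auto simp only: add smult)
  show "(\<lambda>x. H +>\<^bsub>M\<^esub> x) ` carrier M = carrier Q" by (rule surj)
  show "H +>\<^bsub>M\<^esub> x = \<zero>\<^bsub>Q\<^esub> \<longleftrightarrow> x \<in> H" if "x \<in> carrier M"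
    unfolding Q_def quotient_module_def using S.a_rcos_self[OF that] S.a_rcos_const by auto
qed

text \<open>The class has degree \<open>Suc m\<close>, so its syzygy lies in \<open>P m\<close>. The
  map \<open>\<phi>\<close> is a cocycle and \<open>\<Phi>\<close> a chain map of degree
  \<open>-(m + 1)\<close> lifting it.\<close>

locale mapping_cone =
  fixes A :: "('a, 'r) ring_scheme" and M :: "('a, 'm, 'e) module_scheme"
    and P :: "nat \<Rightarrow> ('a, 'p) module" and d :: "nat \<Rightarrow> 'p \<Rightarrow> 'p" and e :: "'p \<Rightarrow> 'm"
    and m :: nat and \<phi> :: "'p \<Rightarrow> 'm" and \<Phi> :: "nat \<Rightarrow> 'p \<Rightarrow> 'p"
  assumes M: "module A M" and res: "resolution A M P d e"
    and \<phi>: "\<phi> \<in> module_hom A (P (Suc m)) M"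
    and \<Phi>: "\<And>n. \<Phi> n \<in> module_hom A (P (Suc (n + m))) (P n)"
    and e\<Phi>: "\<And>y. y \<in> carrier (P (Suc m)) \<Longrightarrow> e (\<Phi> 0 y) = \<phi> y"
    and d\<Phi>: "\<And>n y. y \<in> carrier (P (Suc (Suc (n + m)))) \<Longrightarrow>
       d (Suc n) (\<Phi> (Suc n) y) = \<Phi> n (d (Suc (Suc (n + m))) y)"
begin

text \<open>The second summand is the source of \<open>\<Phi>\<close> in degree
  \<open>n - 1\<close>. In degree 0 it is \<open>P m\<close>, the term just below the domain of
  \<open>\<Phi>\<close>; with it the complex resolves the pushout.\<close>

definition C :: "nat \<Rightarrow> ('a, 'p \<times> 'p) module" where
  "C n = direct_sum (P n) (P (n + m))"

text \<open>The sign on the second component makes consecutive differentials compose to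
  zero.\<close>

definition D :: "nat \<Rightarrow> 'p \<times> 'p \<Rightarrow> 'p \<times> 'p" where
  "D n = (\<lambda>(x, y). (d n x \<oplus>\<^bsub>P (n - 1)\<^esub> \<Phi> (n - 1) y, \<ominus>\<^bsub>P (n - 1 + m)\<^esub> d (n + m) y))"

text \<open>When \<open>\<phi>\<close> is \<open>f\<close> after \<open>d (Suc m)\<close>, this is
  the antidiagonal copy of the syzygy divided out in \<open>K_module\<close>, parametrised by
  \<open>P (Suc m)\<close>.\<close>

definition S :: "('m \<times> 'p) set" where
  "S = (\<lambda>y. (\<phi> y, \<ominus>\<^bsub>P m\<^esub> d (Suc m) y)) ` carrier (P (Suc m))"

definition K :: "('a, ('m \<times> 'p) set) module" where
  "K = quotient_module (direct_sum M (P m)) S"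

definition \<epsilon> :: "'p \<times> 'p \<Rightarrow> ('m \<times> 'p) set" where
  "\<epsilon> = (\<lambda>(x, y). S +>\<^bsub>direct_sum M (P m)\<^esub> (e x, y))"

lemmas Pm = resolutionD(1)[OF res]
  and e_hom = resolutionD(2)[OF res]
  and d_hom = resolutionD(3)[OF res]

lemma C_simps:
  "carrier (C n) = carrier (P n) \<times> carrier (P (n + m))"
  "\<zero>\<^bsub>C n\<^esub> = (\<zero>\<^bsub>P n\<^esub>, \<zero>\<^bsub>P (n + m)\<^esub>)"
  "x \<oplus>\<^bsub>C n\<^esub> y = (fst x \<oplus>\<^bsub>P n\<^esub> fst y, snd x \<oplus>\<^bsub>P (n + m)\<^esub> snd y)"
  by (simp_all add: C_def direct_sum_simps)

lemma C_module: "module A (C n)"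
  unfolding C_def by (intro direct_sum_is_module Pm)

lemma D_apply:
  "D (Suc n) (x, y) = (d (Suc n) x \<oplus>\<^bsub>P n\<^esub> \<Phi> n y, \<ominus>\<^bsub>P (n + m)\<^esub> d (Suc (n + m)) y)"
  by (simp add: D_def)

lemma D_hom: "D (Suc n) \<in> module_hom A (C (Suc n)) (C n)"
proof -
  have fst: "fst \<in> module_hom A (C (Suc n)) (P (Suc n))"
    unfolding C_def by (rule direct_sum_fst)
  have snd: "snd \<in> module_hom A (C (Suc n)) (P (Suc (n + m)))"
    unfolding C_def using direct_sum_snd by simp
  have "(\<lambda>z. (d (Suc n) (fst z) \<oplus>\<^bsub>P n\<^esub> \<Phi> n (snd z), \<ominus>\<^bsub>P (n + m)\<^esub> d (Suc (n + m)) (snd z)))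
     \<in> module_hom A (C (Suc n)) (direct_sum (P n) (P (n + m)))"
    by (intro direct_sum_pair module_hom_plus module_hom_uminus Pm
        module_hom_comp[OF fst d_hom] module_hom_comp[OF snd \<Phi>] module_hom_comp[OF snd d_hom])
  then show ?thesis by (simp add: C_def D_def case_prod_unfold)
qed

lemma S_submodule: "submodule A S (direct_sum M (P m))"
proof -
  have "(\<lambda>y. (\<phi> y, \<ominus>\<^bsub>P m\<^esub> d (Suc m) y)) \<in> module_hom A (P (Suc m)) (direct_sum M (P m))"
    by (intro direct_sum_pair \<phi> module_hom_uminus Pm d_hom)
  from mod_hom.im_is_submodule[OF mod_homI[OF Pm direct_sum_is_module[OF M Pm] this]]
  show ?thesis
    unfolding mod_hom.im_def[OF mod_homI[OF Pm direct_sum_is_module[OF M Pm] \<open>_ \<in> module_hom A _ _\<close>]] S_def .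
qed

lemmas K_props = quotient_module_props[OF direct_sum_is_module[OF M Pm] S_submodule, folded K_def]

lemma K_module: "module A K"
  by (rule K_props(1))

lemma \<epsilon>_hom: "\<epsilon> \<in> module_hom A (C 0) K"
proof -
  have fst: "fst \<in> module_hom A (C 0) (P 0)" and snd: "snd \<in> module_hom A (C 0) (P m)"
    unfolding C_def using direct_sum_fst direct_sum_snd by simp_all
  have "(\<lambda>z. (e (fst z), snd z)) \<in> module_hom A (C 0) (direct_sum M (P m))"
    by (intro direct_sum_pair module_hom_comp[OF fst e_hom] snd)
  from module_hom_comp[OF this K_props(2)] show ?thesis by (simp add: \<epsilon>_def case_prod_unfold)
qed

lemma \<epsilon>_zero_iff:
  assumes "x \<in> carrier (P 0)" "y \<in> carrier (P m)"
  shows "\<epsilon> (x, y) = \<zero>\<^bsub>K\<^esub> \<longleftrightarrow> (\<exists>w \<in> carrier (P (Suc m)). e x = \<phi> w \<and> y = \<ominus>\<^bsub>P m\<^esub> d (Suc m) w)"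
  using K_props(4)[of "(e x, y)"] module_hom_in[OF e_hom] assms
  by (auto simp: \<epsilon>_def S_def direct_sum_simps)

text \<open>Exactness of \<open>P\<close> is used once per coordinate. For a cycle
  \<open>(x, y)\<close> choose \<open>w\<close> with \<open>d w = -y\<close>; then \<open>x\<close>
  minus \<open>\<Phi> w\<close> is a cycle and hence equals some \<open>d u\<close>, and
  \<open>(u, w)\<close> is the required preimage.\<close>

lemma cone_resolution: "resolution A K C D \<epsilon>"
proof -
  interpret M: module A M by (rule M)
  have surj: "\<epsilon> ` carrier (C 0) = carrier K"
  proof -
    have "carrier K = (\<lambda>z. S +>\<^bsub>direct_sum M (P m)\<^esub> z) ` ((e ` carrier (P 0)) \<times> carrier (P m))"
      unfolding K_props(3)[symmetric] resolutionD(4)[OF res] direct_sum_simps ..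
    also have "\<dots> = \<epsilon> ` carrier (C 0)"
      unfolding \<epsilon>_def C_simps by force
    finally show ?thesis by simp
  qed
  have \<epsilon>D: "\<epsilon> (D (Suc 0) (x, y)) = \<zero>\<^bsub>K\<^esub>" if x: "x \<in> carrier (P (Suc 0))" and y: "y \<in> carrier (P (Suc m))" for x y
  proof -
    interpret P0: module A "P 0" by (rule Pm)
    interpret Pmm: module A "P m" by (rule Pm)
    note c = module_hom_in[OF d_hom x] module_hom_in[OF \<Phi>[of 0, simplified] y] module_hom_in[OF d_hom y]
    have "e (d (Suc 0) x \<oplus>\<^bsub>P 0\<^esub> \<Phi> 0 y) = \<phi> y"
      using module_hom_add[OF e_hom c(1,2)] resolutionD(5)[OF res x] e\<Phi>[OF y] module_hom_in[OF \<phi> y] by simp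
    then show ?thesis
      unfolding D_apply using c y by (subst \<epsilon>_zero_iff) auto
  qed
  have ker\<epsilon>: "(x, y) \<in> D (Suc 0) ` carrier (C (Suc 0))"
    if x: "x \<in> carrier (P 0)" and y: "y \<in> carrier (P m)" and 0: "\<epsilon> (x, y) = \<zero>\<^bsub>K\<^esub>" for x y
  proof -
    interpret P0: module A "P 0" by (rule Pm)
    obtain w where w: "w \<in> carrier (P (Suc m))" "e x = \<phi> w" "y = \<ominus>\<^bsub>P m\<^esub> d (Suc m) w"
      using 0 \<epsilon>_zero_iff[OF x y] by blast
    note c = module_hom_in[OF \<Phi>[of 0, simplified] w(1)]
    have "e (x \<ominus>\<^bsub>P 0\<^esub> \<Phi> 0 w) = \<zero>\<^bsub>M\<^esub>"
      using module_hom_diff[OF Pm M e_hom x c] e\<Phi>[OF w(1)] w(2) module_hom_in[OF \<phi> w(1)] by simp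
    then obtain u where u: "u \<in> carrier (P (Suc 0))" "d (Suc 0) u = x \<ominus>\<^bsub>P 0\<^esub> \<Phi> 0 w"
      using resolutionD(6)[OF res, of "x \<ominus>\<^bsub>P 0\<^esub> \<Phi> 0 w"] x c by auto
    have "D (Suc 0) (u, w) = (x, y)"
      unfolding D_apply u(2) using w(3) x c by (simp add: a_minus_def P0.a_assoc P0.l_neg)
    then show ?thesis using u(1) w(1) by (force simp: C_simps)
  qed
  have DD: "D (Suc n) (D (Suc (Suc n)) (x, y)) = \<zero>\<^bsub>C n\<^esub>"
    if x: "x \<in> carrier (P (Suc (Suc n)))" and y: "y \<in> carrier (P (Suc (Suc (n + m))))" for n x y
  proof -
    interpret Pn: module A "P n" by (rule Pm)
    interpret PS: module A "P (Suc n)" by (rule Pm)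
    interpret Pnm: module A "P (n + m)" by (rule Pm)
    interpret PSm: module A "P (Suc (n + m))" by (rule Pm)
    note c = module_hom_in[OF d_hom x] module_hom_in[OF \<Phi>[of "Suc n", simplified] y] module_hom_in[OF d_hom y]
    note c' = module_hom_in[OF \<Phi> c(3)]
    have "d (Suc n) (d (Suc (Suc n)) x \<oplus>\<^bsub>P (Suc n)\<^esub> \<Phi> (Suc n) y)
        \<oplus>\<^bsub>P n\<^esub> \<Phi> n (\<ominus>\<^bsub>P (Suc (n + m))\<^esub> d (Suc (Suc (n + m))) y) = \<zero>\<^bsub>P n\<^esub>"
      unfolding module_hom_add[OF d_hom c(1,2)] resolutionD(7)[OF res x] d\<Phi>[OF y]
        module_hom_neg[OF Pm Pm \<Phi> c(3)] using c' by (simp add: Pn.r_neg)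
    moreover have "\<ominus>\<^bsub>P (n + m)\<^esub> d (Suc (n + m)) (\<ominus>\<^bsub>P (Suc (n + m))\<^esub> d (Suc (Suc (n + m))) y) = \<zero>\<^bsub>P (n + m)\<^esub>"
      unfolding module_hom_neg[OF Pm Pm d_hom c(3)] resolutionD(7)[OF res y] by simp
    ultimately show ?thesis unfolding D_apply C_simps by (simp add: D_apply)
  qed
  have kerD: "(x, y) \<in> D (Suc (Suc n)) ` carrier (C (Suc (Suc n)))"
    if x: "x \<in> carrier (P (Suc n))" and y: "y \<in> carrier (P (Suc (n + m)))"
      and 0: "D (Suc n) (x, y) = \<zero>\<^bsub>C n\<^esub>" for n x y
  proof -
    interpret Pn: module A "P n" by (rule Pm)
    interpret PS: module A "P (Suc n)" by (rule Pm)
    interpret Pnm: module A "P (n + m)" by (rule Pm)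
    interpret PSS: module A "P (Suc (Suc (n + m)))" by (rule Pm)
    have 1: "d (Suc n) x \<oplus>\<^bsub>P n\<^esub> \<Phi> n y = \<zero>\<^bsub>P n\<^esub>" and 2: "\<ominus>\<^bsub>P (n + m)\<^esub> d (Suc (n + m)) y = \<zero>\<^bsub>P (n + m)\<^esub>"
      using 0 unfolding D_apply C_simps by auto
    have "d (Suc (n + m)) y = \<zero>\<^bsub>P (n + m)\<^esub>"
    proof -
      have "d (Suc (n + m)) y = \<ominus>\<^bsub>P (n + m)\<^esub> (\<ominus>\<^bsub>P (n + m)\<^esub> d (Suc (n + m)) y)"
        using module_hom_in[OF d_hom y] by simp
      then show ?thesis unfolding 2 by simp
    qed
    then obtain w' where w': "w' \<in> carrier (P (Suc (Suc (n + m))))" "d (Suc (Suc (n + m))) w' = y"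
      using resolutionD(8)[OF res y] by auto
    \<comment> \<open>The sign cancels the one in the second component of \<open>D\<close>.\<close>
    define w where "w = \<ominus>\<^bsub>P (Suc (Suc (n + m)))\<^esub> w'"
    have w: "w \<in> carrier (P (Suc (Suc (n + m))))" unfolding w_def using w'(1) by simp
    interpret PSm: module A "P (Suc (n + m))" by (rule Pm)
    have dw: "d (Suc (Suc (n + m))) w = \<ominus>\<^bsub>P (Suc (n + m))\<^esub> y"
      unfolding w_def module_hom_neg[OF Pm Pm d_hom w'(1)] w'(2) ..
    note c = module_hom_in[OF \<Phi>[of "Suc n", simplified] w] module_hom_in[OF d_hom x] module_hom_in[OF \<Phi> y]
    have "d (Suc n) (x \<ominus>\<^bsub>P (Suc n)\<^esub> \<Phi> (Suc n) w) = d (Suc n) x \<ominus>\<^bsub>P n\<^esub> \<Phi> n (\<ominus>\<^bsub>P (Suc (n + m))\<^esub> y)"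
      unfolding module_hom_diff[OF Pm Pm d_hom x c(1)] d\<Phi>[OF w] dw ..
    also have "\<dots> = d (Suc n) x \<oplus>\<^bsub>P n\<^esub> \<Phi> n y"
      unfolding module_hom_neg[OF Pm Pm \<Phi> y] using c by (simp add: a_minus_def)
    finally have "d (Suc n) (x \<ominus>\<^bsub>P (Suc n)\<^esub> \<Phi> (Suc n) w) = \<zero>\<^bsub>P n\<^esub>" using 1 by simp
    then obtain u where u: "u \<in> carrier (P (Suc (Suc n)))" "d (Suc (Suc n)) u = x \<ominus>\<^bsub>P (Suc n)\<^esub> \<Phi> (Suc n) w"
      using resolutionD(8)[OF res, of "x \<ominus>\<^bsub>P (Suc n)\<^esub> \<Phi> (Suc n) w"] x c by auto
    have "D (Suc (Suc n)) (u, w) = (x, y)"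
      unfolding D_apply u(2) using dw y x c by (simp add: a_minus_def PS.a_assoc PS.l_neg)
    then show ?thesis using u(1) w by (force simp: C_simps)
  qed
  have im0: "D (Suc 0) ` carrier (C (Suc 0)) = {z \<in> carrier (C 0). \<epsilon> z = \<zero>\<^bsub>K\<^esub>}"
  proof (intro equalityI subsetI)
    fix z assume "z \<in> D (Suc 0) ` carrier (C (Suc 0))"
    then obtain x y where xy: "z = D (Suc 0) (x, y)" "x \<in> carrier (P (Suc 0))" "y \<in> carrier (P (Suc m))"
      by (auto simp: C_simps)
    then show "z \<in> {z \<in> carrier (C 0). \<epsilon> z = \<zero>\<^bsub>K\<^esub>}"
      using \<epsilon>D module_hom_in[OF D_hom[of 0], of "(x, y)"] by (simp add: C_simps)
  next
    fix z assume "z \<in> {z \<in> carrier (C 0). \<epsilon> z = \<zero>\<^bsub>K\<^esub>}"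
    then show "z \<in> D (Suc 0) ` carrier (C (Suc 0))"
      using ker\<epsilon> by (cases z) (simp add: C_simps)
  qed
  have im: "D (Suc (Suc n)) ` carrier (C (Suc (Suc n))) = {z \<in> carrier (C (Suc n)). D (Suc n) z = \<zero>\<^bsub>C n\<^esub>}" for n
  proof (intro equalityI subsetI)
    fix z assume "z \<in> D (Suc (Suc n)) ` carrier (C (Suc (Suc n)))"
    then obtain x y where xy: "z = D (Suc (Suc n)) (x, y)" "x \<in> carrier (P (Suc (Suc n)))"
      "y \<in> carrier (P (Suc (Suc (n + m))))" by (auto simp: C_simps(1))
    then show "z \<in> {z \<in> carrier (C (Suc n)). D (Suc n) z = \<zero>\<^bsub>C n\<^esub>}"
      using DD module_hom_in[OF D_hom[of "Suc n"], of "(x, y)"] by (simp add: C_simps(1))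
  next
    fix z assume "z \<in> {z \<in> carrier (C (Suc n)). D (Suc n) z = \<zero>\<^bsub>C n\<^esub>}"
    then show "z \<in> D (Suc (Suc n)) ` carrier (C (Suc (Suc n)))"
      using kerD[of "fst z" n "snd z"] by (simp add: C_simps(1) mem_Times_iff)
  qed
  show ?thesis
    unfolding resolution_def using C_module \<epsilon>_hom D_hom surj im0 im by simp
qed

lemma cone_lifts_along:
  assumes "resolution A L Q d' e'" "module A L" "lifts_along A P L Q d' e'"
  shows "lifts_along A C L Q d' e'"
  unfolding lifts_along_def C_def
  using assms(3) resolutionD(1-3)[OF assms(1)] assms(2) Pm
  by (auto simp: lifts_along_def intro!: direct_sum_lifts)

text \<open>The part of the long exact sequence in which \<open>Ext\<close> of the cone in degree
  \<open>n + 1\<close> stands between those of \<open>P\<close> in degrees \<open>n + m + 1\<close>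
  and \<open>n + 1\<close>. On cochains: bound \<open>g\<close> on the first summand by
  \<open>u'\<close>, correct it on the second by \<open>u'\<close> after \<open>\<Phi>\<close>, and
  bound the remainder by \<open>w\<close>.\<close>

lemma cone_ext_vanish:
  assumes N: "module A N" and van: "ext_vanish A P d N n" "ext_vanish A P d N (n + m)"
  shows "ext_vanish A C D N n"
  unfolding ext_vanish_def
proof (intro ballI impI)
  fix g assume g: "g \<in> module_hom A (C (Suc n)) N"
    and cyc: "\<forall>z \<in> carrier (C (Suc (Suc n))). g (D (Suc (Suc n)) z) = \<zero>\<^bsub>N\<^esub>"
  interpret N: module A N by (rule N)
  interpret Pn: module A "P n" by (rule Pm)
  interpret PS: module A "P (Suc n)" by (rule Pm)
  interpret PSm: module A "P (Suc (n + m))" by (rule Pm)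
  interpret PSS: module A "P (Suc (Suc n))" by (rule Pm)
  interpret PSSm: module A "P (Suc (Suc (n + m)))" by (rule Pm)
  have inl: "(\<lambda>x. (x, \<zero>\<^bsub>P (Suc (n + m))\<^esub>)) \<in> module_hom A (P (Suc n)) (C (Suc n))"
    and inr: "(\<lambda>y. (\<zero>\<^bsub>P (Suc n)\<^esub>, y)) \<in> module_hom A (P (Suc (n + m))) (C (Suc n))"
    using direct_sum_inl[OF Pm[of "Suc (n + m)"], of "P (Suc n)"] direct_sum_inr[OF Pm[of "Suc n"], of "P (Suc (n + m))"]
    by (simp_all add: C_def)
  note u = module_hom_comp[OF inl g] and v = module_hom_comp[OF inr g]
  have dec: "g (x, y) = g (x, \<zero>\<^bsub>P (Suc (n + m))\<^esub>) \<oplus>\<^bsub>N\<^esub> g (\<zero>\<^bsub>P (Suc n)\<^esub>, y)"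
    if "x \<in> carrier (P (Suc n))" "y \<in> carrier (P (Suc (n + m)))" for x y
    using that by (subst module_hom_add[OF g, symmetric]) (auto simp: C_simps)
  have "g (d (Suc (Suc n)) x, \<zero>\<^bsub>P (Suc (n + m))\<^esub>) = \<zero>\<^bsub>N\<^esub>" if x: "x \<in> carrier (P (Suc (Suc n)))" for x
  proof -
    have "D (Suc (Suc n)) (x, \<zero>\<^bsub>P (Suc (Suc (n + m)))\<^esub>) = (d (Suc (Suc n)) x, \<zero>\<^bsub>P (Suc (n + m))\<^esub>)"
      using module_hom_zero[OF Pm Pm \<Phi>[of "Suc n"]] module_hom_zero[OF Pm Pm d_hom[of "Suc (n + m)"]]
        module_hom_in[OF d_hom x] by (simp add: D_apply)
    then show ?thesis using bspec[OF cyc, of "(x, \<zero>\<^bsub>P (Suc (Suc (n + m)))\<^esub>)"] x by (simp add: C_simps)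
  qed
  from ext_vanishD[OF van(1) u this] obtain u'
    where u': "u' \<in> module_hom A (P n) N"
      "\<And>x. x \<in> carrier (P (Suc n)) \<Longrightarrow> g (x, \<zero>\<^bsub>P (Suc (n + m))\<^esub>) = u' (d (Suc n) x)" by blast
  have u'\<Phi>: "(\<lambda>y. u' (\<Phi> n y)) \<in> module_hom A (P (Suc (n + m))) N" by (rule module_hom_comp[OF \<Phi> u'(1)])
  have v': "(\<lambda>y. g (\<zero>\<^bsub>P (Suc n)\<^esub>, y) \<ominus>\<^bsub>N\<^esub> u' (\<Phi> n y)) \<in> module_hom A (P (Suc (n + m))) N"
    by (rule module_hom_minus[OF N v u'\<Phi>])
  \<comment> \<open>The corrected second component is a cocycle because \<open>g\<close> vanishes on
    \<open>D (0, y) = (\<Phi> y, -d y)\<close>.\<close>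
  have "g (\<zero>\<^bsub>P (Suc n)\<^esub>, d (Suc (Suc (n + m))) y) \<ominus>\<^bsub>N\<^esub> u' (\<Phi> n (d (Suc (Suc (n + m))) y)) = \<zero>\<^bsub>N\<^esub>"
    if y: "y \<in> carrier (P (Suc (Suc (n + m))))" for y
  proof -
    note dy = module_hom_in[OF d_hom y] and \<Phi>y = module_hom_in[OF \<Phi>[of "Suc n", simplified] y]
    have "D (Suc (Suc n)) (\<zero>\<^bsub>P (Suc (Suc n))\<^esub>, y) = (\<Phi> (Suc n) y, \<ominus>\<^bsub>P (Suc (n + m))\<^esub> d (Suc (Suc (n + m))) y)"
      using module_hom_zero[OF Pm Pm d_hom[of "Suc n"]] \<Phi>y by (simp add: D_apply)
    then have "g (\<Phi> (Suc n) y, \<ominus>\<^bsub>P (Suc (n + m))\<^esub> d (Suc (Suc (n + m))) y) = \<zero>\<^bsub>N\<^esub>"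
      using bspec[OF cyc, of "(\<zero>\<^bsub>P (Suc (Suc n))\<^esub>, y)"] y by (simp add: C_simps)
    then have "u' (\<Phi> n (d (Suc (Suc (n + m))) y)) \<oplus>\<^bsub>N\<^esub> (\<ominus>\<^bsub>N\<^esub> g (\<zero>\<^bsub>P (Suc n)\<^esub>, d (Suc (Suc (n + m))) y)) = \<zero>\<^bsub>N\<^esub>"
      using dec[OF \<Phi>y, of "\<ominus>\<^bsub>P (Suc (n + m))\<^esub> d (Suc (Suc (n + m))) y"] dy u'(2)[OF \<Phi>y] d\<Phi>[OF y]
        module_hom_neg[OF Pm N v dy] by simp
    then have "u' (\<Phi> n (d (Suc (Suc (n + m))) y)) = g (\<zero>\<^bsub>P (Suc n)\<^esub>, d (Suc (Suc (n + m))) y)"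
      using N.minus_other_side[OF module_hom_in[OF u'\<Phi> dy] module_hom_in[OF v dy]] by (simp add: a_minus_def)
    then show ?thesis using module_hom_in[OF v dy] by simp
  qed
  from ext_vanishD[OF van(2) v' this] obtain w where w: "w \<in> module_hom A (P (n + m)) N"
    "\<And>y. y \<in> carrier (P (Suc (n + m))) \<Longrightarrow> g (\<zero>\<^bsub>P (Suc n)\<^esub>, y) \<ominus>\<^bsub>N\<^esub> u' (\<Phi> n y) = w (d (Suc (n + m)) y)" by blast
  show "\<exists>h\<in>module_hom A (C n) N. \<forall>z\<in>carrier (C (Suc n)). g z = h (D (Suc n) z)"
  proof (intro bexI ballI)
    show "(\<lambda>z. u' (fst z) \<ominus>\<^bsub>N\<^esub> w (snd z)) \<in> module_hom A (C n) N"
      unfolding C_def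
      by (intro module_hom_minus N module_hom_comp[OF direct_sum_fst u'(1)] module_hom_comp[OF direct_sum_snd w(1)])
    fix z assume "z \<in> carrier (C (Suc n))"
    then obtain x y where z: "z = (x, y)" and x: "x \<in> carrier (P (Suc n))" and y: "y \<in> carrier (P (Suc (n + m)))"
      by (auto simp: C_simps)
    note dx = module_hom_in[OF d_hom x] and dy = module_hom_in[OF d_hom y] and \<Phi>y = module_hom_in[OF \<Phi> y]
    note c = module_hom_in[OF u'(1) dx] module_hom_in[OF u'(1) \<Phi>y] module_hom_in[OF w(1) dy] module_hom_in[OF v y]
    have "u' (d (Suc n) x \<oplus>\<^bsub>P n\<^esub> \<Phi> n y) \<ominus>\<^bsub>N\<^esub> w (\<ominus>\<^bsub>P (n + m)\<^esub> d (Suc (n + m)) y)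
        = (u' (d (Suc n) x) \<oplus>\<^bsub>N\<^esub> u' (\<Phi> n y)) \<oplus>\<^bsub>N\<^esub> w (d (Suc (n + m)) y)"
      unfolding module_hom_add[OF u'(1) dx \<Phi>y] module_hom_neg[OF Pm N w(1) dy] using c by (simp add: a_minus_def)
    also have "\<dots> = u' (d (Suc n) x) \<oplus>\<^bsub>N\<^esub> g (\<zero>\<^bsub>P (Suc n)\<^esub>, y)"
      unfolding w(2)[OF y, symmetric] a_minus_def using c
      by (simp add: N.a_assoc N.a_lcomm[of "u' (\<Phi> n y)" "g (\<zero>\<^bsub>P (Suc n)\<^esub>, y)"] N.r_neg)
    also have "\<dots> = g z" unfolding z using dec[OF x y] u'(2)[OF x] by simp
    finally show "g z = u' (fst (D (Suc n) z)) \<ominus>\<^bsub>N\<^esub> w (snd (D (Suc n) z))"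
      unfolding z D_apply by simp
  qed
qed

end


section \<open>Comparison of ranks\<close>

lemma free_lifts_along:
  assumes "resolution A M Q d e" "module A M"
  shows "lifts_along A (\<lambda>n. free_module A (b n)) M Q d e"
  unfolding lifts_along_def using resolutionD(1-3)[OF assms(1)] assms(2) by (auto intro!: free_lifts)

context noeth_local
begin

lemma minimalD:
  assumes "minimal_free_resolution A M b d e"
  shows "resolution A M (\<lambda>n. free_module A (b n)) d e"
    "x \<in> carrier (free_module A (b (Suc n))) \<Longrightarrow> d (Suc n) x \<in> mfree (b n)"
  using assms unfolding minimal_free_resolution_def ideal_times_free by auto

text \<open>In the retraction identity both homotopy terms lie in \<open>mfree (b n)\<close>, as the
  differentials of the minimal resolution do. So the images under \<open>\<beta>\<close> of the
  \<open>r n\<close> basis vectors generate modulo \<open>mm\<close>.\<close>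

lemma minimal_rank_le:
  assumes M: "module A M" and F: "minimal_free_resolution A M b d e"
    and G: "resolution A M (\<lambda>n. free_module A (r n)) d' e'"
  shows "b n \<le> r n"
proof -
  let ?F = "\<lambda>n. free_module A (b n)"
  note Fr = minimalD(1)[OF F]
  from resolution_retract[OF Fr G M free_lifts_along[OF G M] free_lifts_along[OF Fr M] free_lifts_along[OF Fr M]]
  obtain \<alpha> \<beta> s where \<alpha>: "\<And>n. \<alpha> n \<in> module_hom A (?F n) (free_module A (r n))"
    and \<beta>: "\<And>n. \<beta> n \<in> module_hom A (free_module A (r n)) (?F n)"
    and s: "\<And>n. s n \<in> module_hom A (?F n) (?F (Suc n))"
    and eq0: "\<And>x. x \<in> carrier (?F 0) \<Longrightarrow>
      x = \<beta> 0 (\<alpha> 0 x) \<oplus>\<^bsub>?F 0\<^esub> d (Suc 0) (s 0 x)"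
    and eqS: "\<And>n x. x \<in> carrier (?F (Suc n)) \<Longrightarrow>
      x = \<beta> (Suc n) (\<alpha> (Suc n) x) \<oplus>\<^bsub>?F (Suc n)\<^esub>
        (d (Suc (Suc n)) (s (Suc n) x) \<oplus>\<^bsub>?F (Suc n)\<^esub> s n (d (Suc n) x))"
    by blast
  show ?thesis
  proof (rule rank_le_of_generators_mod_mm)
    show "(\<lambda>j. \<beta> n (unit_fun A (r n) j)) \<in> {..<r n} \<rightarrow> carrier (?F n)"
      using module_hom_in[OF \<beta> unit_fun_in[OF ring_axioms]] by auto
    fix x assume x: "x \<in> carrier (?F n)"
    have c: "\<alpha> n x \<in> carrier (free_module A (r n))" by (rule module_hom_in[OF \<alpha> x])
    have "\<exists>z \<in> mfree (b n). x = \<beta> n (\<alpha> n x) \<oplus>\<^bsub>?F n\<^esub> z"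
    proof (cases n)
      case 0
      then show ?thesis
        using eq0[of x] x minimalD(2)[OF F module_hom_in[OF s[of 0], of x]] by blast
    next
      case (Suc k)
      then have x': "x \<in> carrier (?F (Suc k))" using x by simp
      have "d (Suc (Suc k)) (s (Suc k) x) \<oplus>\<^bsub>?F (Suc k)\<^esub> s k (d (Suc k) x) \<in> mfree (b (Suc k))"
        by (intro submodule.m_closed[OF mfree_submodule] minimalD(2)[OF F] module_hom_in[OF s x']
            hom_mfree[OF s] x')
      then show ?thesis using eqS[OF x'] Suc by blast
    qed
    then show "\<exists>c\<in>carrier (free_module A (r n)). \<exists>z\<in>mfree (b n).
        x = fam_comb (?F n) (\<lambda>j. \<beta> n (unit_fun A (r n) j)) (r n) c \<oplus>\<^bsub>?F n\<^esub> z"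
      using c free_hom_fam_comb[OF free_mod \<beta> c] by auto
  qed
qed

lemma min_res_props:
  assumes "fin_gen A M"
  shows "minimal_free_resolution A M (fst (min_res A M)) (res_map A M) (snd (snd (min_res A M)))"
    "resolution A M (res_module A M) (res_map A M) (snd (snd (min_res A M)))"
    "module A (res_module A M n)"
    "res_map A M (Suc n) \<in> module_hom A (res_module A M (Suc n)) (res_module A M n)"
proof -
  show min: "minimal_free_resolution A M (fst (min_res A M)) (res_map A M) (snd (snd (min_res A M)))"
    using min_res_minimal[OF assms] unfolding res_map_def .
  show res: "resolution A M (res_module A M) (res_map A M) (snd (snd (min_res A M)))"
    using minimalD(1)[OF min] unfolding res_module_def[abs_def] .
  show "module A (res_module A M n)"
    "res_map A M (Suc n) \<in> module_hom A (res_module A M (Suc n)) (res_module A M n)"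
    by (rule resolutionD[OF res])+
qed

lemma res_lifts_along:
  assumes "resolution A M Q d e" "module A M"
  shows "lifts_along A (res_module A L) M Q d e"
  unfolding res_module_def[abs_def] by (rule free_lifts_along[OF assms])

section \<open>Invariance under isomorphism\<close>

lemma resolution_iso:
  assumes M: "module A M" and N: "module A N" and h: "h \<in> module_hom A M N" "bij_betw h (carrier M) (carrier N)"
    and res: "resolution A M P d e"
  shows "resolution A N P d (\<lambda>x. h (e x))"
proof -
  note e = resolutionD(2)[OF res]
  interpret M: module A M by (rule M)
  have "h (e x) = \<zero>\<^bsub>N\<^esub> \<longleftrightarrow> e x = \<zero>\<^bsub>M\<^esub>" if "x \<in> carrier (P 0)" for x
    using module_hom_zero[OF M N h(1)] module_hom_in[OF e that] bij_betw_imp_inj_on[OF h(2)]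
    by (metis M.zero_closed inj_onD)
  then have "{x \<in> carrier (P 0). h (e x) = \<zero>\<^bsub>N\<^esub>} = {x \<in> carrier (P 0). e x = \<zero>\<^bsub>M\<^esub>}" by blast
  moreover have "(\<lambda>x. h (e x)) ` carrier (P 0) = carrier N"
    using bij_betw_imp_surj_on[OF h(2)] resolutionD(4)[OF res] by (metis image_image)
  ultimately show ?thesis
    using res module_hom_comp[OF e h(1)] unfolding resolution_def by simp
qed

lemma module_isomorphic_sym:
  assumes M: "module A M" and iso: "module_isomorphic A M N"
  shows "module_isomorphic A N M"
proof -
  interpret M: module A M by (rule M)
  obtain h where h: "h \<in> module_hom A M N" "bij_betw h (carrier M) (carrier N)"
    using iso unfolding module_isomorphic_def by blast
  let ?k = "inv_into (carrier M) h"
  have kc: "?k y \<in> carrier M" and hk: "h (?k y) = y" if "y \<in> carrier N" for y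
    using that h(2) by (auto simp: bij_betw_def inv_into_into f_inv_into_f)
  have kh: "?k (h x) = x" if "x \<in> carrier M" for x
    using that h(2) by (simp add: bij_betw_def)
  have "?k \<in> module_hom A N M"
  proof (rule module_homI)
    fix x y assume xy: "x \<in> carrier N" "y \<in> carrier N"
    then have "x \<oplus>\<^bsub>N\<^esub> y = h (?k x \<oplus>\<^bsub>M\<^esub> ?k y)"
      using module_hom_add[OF h(1)] kc hk by simp
    then show "?k (x \<oplus>\<^bsub>N\<^esub> y) = ?k x \<oplus>\<^bsub>M\<^esub> ?k y" using kh kc xy by simp
  next
    fix r x assume r: "r \<in> carrier A" and x: "x \<in> carrier N"
    then have "r \<odot>\<^bsub>N\<^esub> x = h (r \<odot>\<^bsub>M\<^esub> ?k x)"
      using module_hom_smult[OF h(1)] kc hk by simp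
    then show "?k (r \<odot>\<^bsub>N\<^esub> x) = r \<odot>\<^bsub>M\<^esub> ?k x" using kh kc r x by simp
  qed (rule kc)
  then show ?thesis
    unfolding module_isomorphic_def using bij_betw_inv_into[OF h(2)] by blast
qed

text \<open>A minimal resolution of one module is also a free resolution of the other, which gives
  the inequality in both directions.\<close>

lemma betti_iso:
  assumes M: "fin_gen A M" and N: "fin_gen A N" and iso: "module_isomorphic A M N"
  shows "betti A M n = betti A N n"
proof -
  have le: "betti A L n \<le> betti A L' n" if L: "fin_gen A L" and L': "fin_gen A L'" and iso: "module_isomorphic A L' L"
    for L :: "('a, 'x, 'y) module_scheme" and L' :: "('a, 'z, 'w) module_scheme"
  proof -
    obtain h where "h \<in> module_hom A L' L" "bij_betw h (carrier L') (carrier L)"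
      using iso unfolding module_isomorphic_def by blast
    from resolution_iso[OF fin_gen_module[OF L'] fin_gen_module[OF L] this minimalD(1)[OF min_res_props(1)[OF L']]]
    show ?thesis
      unfolding betti_eq_rank[OF L] betti_eq_rank[OF L']
      by (rule minimal_rank_le[OF fin_gen_module[OF L] min_res_props(1)[OF L]])
  qed
  show ?thesis
    using le[OF M N] le[OF N M] iso module_isomorphic_sym[OF fin_gen_module[OF M] iso] by (intro antisym)
qed

lemma complexity_iso:
  assumes "fin_gen A M" "fin_gen A N" "module_isomorphic A M N"
  shows "complexity A M = complexity A N"
  unfolding complexity_def using betti_iso[OF assms] by simp

lemma ext_vanish_iso:
  assumes M: "fin_gen A M" and X: "fin_gen A X" and iso: "module_isomorphic A X M" and N: "module A N"
    and van: "ext_vanish A (res_module A M) (res_map A M) N n"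
  shows "ext_vanish A (res_module A X) (res_map A X) N n"
proof -
  note Mm = fin_gen_module[OF M]
  obtain h where "h \<in> module_hom A X M" "bij_betw h (carrier X) (carrier M)"
    using iso unfolding module_isomorphic_def by blast
  note resX = resolution_iso[OF fin_gen_module[OF X] Mm this min_res_props(2)[OF X]]
  show ?thesis
    by (rule ext_vanish_transfer[OF min_res_props(2)[OF M] resX Mm N _ _ _ van])
      (intro res_lifts_along resX min_res_props(2)[OF M] Mm)+
qed

text \<open>The cone is a retract, up to homotopy, of any free resolution of \<open>K\<close>. Apply
  the identity to \<open>(x, 0)\<close> and take first coordinates: besides the \<open>r i\<close>
  generators coming from \<open>\<beta>\<close>, only \<open>\<Phi> i w\<close> may lie outside
  \<open>mfree (b i)\<close>.\<close>

lemma cone_generators: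
  assumes X: "module A X" and F: "minimal_free_resolution A X b d e"
    and cone: "mapping_cone A X (\<lambda>n. free_module A (b n)) d e m \<phi> \<Phi>"
    and G: "resolution A (mapping_cone.K X (\<lambda>n. free_module A (b n)) d m \<phi>) (\<lambda>n. free_module A (r n)) d' e'"
  shows "\<exists>v. v \<in> {..<r i} \<rightarrow> carrier (free_module A (b i)) \<and>
    (\<forall>x \<in> carrier (free_module A (b i)). \<exists>c \<in> carrier (free_module A (r i)).
       \<exists>w \<in> carrier (free_module A (b (i + Suc m))). \<exists>z \<in> mfree (b i).
       x = fam_comb (free_module A (b i)) v (r i) c \<oplus>\<^bsub>free_module A (b i)\<^esub>
         (\<Phi> i w \<oplus>\<^bsub>free_module A (b i)\<^esub> z))"
proof -
  let ?F = "\<lambda>n. free_module A (b n)"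
  interpret c: mapping_cone A X ?F d e m \<phi> \<Phi> by (rule cone)
  note Fr = minimalD(1)[OF F] and Kr = c.cone_resolution
  note Cl = c.cone_lifts_along[OF _ _ free_lifts_along]
  from resolution_retract[OF Kr G c.K_module Cl[OF G c.K_module G c.K_module]
      free_lifts_along[OF Kr c.K_module] Cl[OF Kr c.K_module Kr c.K_module]]
  obtain \<alpha> \<beta> s where \<alpha>: "\<And>n. \<alpha> n \<in> module_hom A (c.C n) (free_module A (r n))"
    and \<beta>: "\<And>n. \<beta> n \<in> module_hom A (free_module A (r n)) (c.C n)"
    and s: "\<And>n. s n \<in> module_hom A (c.C n) (c.C (Suc n))"
    and eq0: "\<And>x. x \<in> carrier (c.C 0) \<Longrightarrow> x = \<beta> 0 (\<alpha> 0 x) \<oplus>\<^bsub>c.C 0\<^esub> c.D (Suc 0) (s 0 x)"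
    and eqS: "\<And>n x. x \<in> carrier (c.C (Suc n)) \<Longrightarrow> x = \<beta> (Suc n) (\<alpha> (Suc n) x) \<oplus>\<^bsub>c.C (Suc n)\<^esub>
        (c.D (Suc (Suc n)) (s (Suc n) x) \<oplus>\<^bsub>c.C (Suc n)\<^esub> s n (c.D (Suc n) x))"
    by blast
  let ?v = "\<lambda>j. fst (\<beta> i (unit_fun A (r i) j))"
  have fst: "fst \<in> module_hom A (c.C n) (?F n)" for n unfolding c.C_def by (rule direct_sum_fst)
  have v: "?v \<in> {..<r i} \<rightarrow> carrier (?F i)"
    using module_hom_in[OF fst module_hom_in[OF \<beta> unit_fun_in[OF ring_axioms]]] by auto
  have "\<exists>c \<in> carrier (free_module A (r i)). \<exists>w \<in> carrier (?F (i + Suc m)). \<exists>z \<in> mfree (b i).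
       x = fam_comb (?F i) ?v (r i) c \<oplus>\<^bsub>?F i\<^esub> (\<Phi> i w \<oplus>\<^bsub>?F i\<^esub> z)" if x: "x \<in> carrier (?F i)" for x
  proof -
    interpret Fi: module A "?F i" by (rule free_mod)
    interpret Fim: module A "?F (i + m)" by (rule free_mod)
    \<comment> \<open>With second coordinate 0 the differential of the cone has first coordinate
      \<open>d x\<close> and involves no \<open>\<Phi>\<close>.\<close>
    let ?x = "(x, \<zero>\<^bsub>?F (i + m)\<^esub>)"
    have xC: "?x \<in> carrier (c.C i)" using x by (simp add: c.C_simps)
    have \<alpha>x: "\<alpha> i ?x \<in> carrier (free_module A (r i))" by (rule module_hom_in[OF \<alpha> xC])
    have comb: "fst (\<beta> i (\<alpha> i ?x)) = fam_comb (?F i) ?v (r i) (\<alpha> i ?x)"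
      using free_hom_fam_comb[OF free_mod module_hom_comp[OF \<beta> fst] \<alpha>x] .
    obtain u w where uw: "s i ?x = (u, w)" "u \<in> carrier (?F (Suc i))" "w \<in> carrier (?F (Suc (i + m)))"
      using module_hom_in[OF s xC] by (cases "s i ?x") (auto simp: c.C_simps)
    have D: "fst (c.D (Suc i) (s i ?x)) = d (Suc i) u \<oplus>\<^bsub>?F i\<^esub> \<Phi> i w"
      unfolding uw(1) c.D_apply by simp
    have du: "d (Suc i) u \<in> mfree (b i)" by (rule minimalD(2)[OF F uw(2)])
    note mf = submodule.subset[OF mfree_submodule, THEN subsetD]
    have \<Phi>w: "\<Phi> i w \<in> carrier (?F i)" by (rule module_hom_in[OF c.\<Phi> uw(3)])
    have "\<exists>z \<in> mfree (b i). x = fst (\<beta> i (\<alpha> i ?x)) \<oplus>\<^bsub>?F i\<^esub> (\<Phi> i w \<oplus>\<^bsub>?F i\<^esub> z)"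
    proof (cases i)
      case 0
      have "x = fst (\<beta> i (\<alpha> i ?x)) \<oplus>\<^bsub>?F i\<^esub> fst (c.D (Suc i) (s i ?x))"
        using arg_cong[OF eq0[of ?x], of fst] xC 0 by (simp add: c.C_simps)
      also have "fst (c.D (Suc i) (s i ?x)) = \<Phi> i w \<oplus>\<^bsub>?F i\<^esub> d (Suc i) u"
        unfolding D using mf[OF du] \<Phi>w by (rule Fi.a_comm)
      finally show ?thesis using du by blast
    next
      case (Suc k)
      interpret Fkm: module A "?F (k + m)" by (rule free_mod)
      have xS: "x \<in> carrier (?F (Suc k))" using x Suc by simp
      have "c.D (Suc k) ?x = (d (Suc k) x, \<zero>\<^bsub>?F (k + m)\<^esub>)"
        using module_hom_zero[OF free_mod free_mod c.\<Phi>[of k]] module_hom_zero[OF free_mod free_mod c.d_hom[of "k + m"]]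
          module_hom_in[OF c.d_hom xS] module.axioms(2)[OF free_mod, of "b k"]
        by (simp add: c.D_apply Suc abelian_group.axioms abelian_monoid.r_zero)
      then have sD: "fst (s k (c.D (Suc k) ?x)) = fst (s k (d (Suc k) x, \<zero>\<^bsub>?F (k + m)\<^esub>))" by simp
      \<comment> \<open>The map \<open>y \<mapsto> fst (s (y, 0))\<close> is a homomorphism of free
        modules, so it carries \<open>d x\<close>, which is in \<open>mfree\<close>, into
        \<open>mfree\<close>.\<close>
      have "(\<lambda>y. (y, \<zero>\<^bsub>?F (k + m)\<^esub>)) \<in> module_hom A (?F k) (c.C k)"
        unfolding c.C_def by (rule direct_sum_inl[OF free_mod])
      from hom_mfree[OF module_hom_comp[OF module_hom_comp[OF this s] fst] minimalD(2)[OF F xS]]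
      have sm: "fst (s k (c.D (Suc k) ?x)) \<in> mfree (b i)" unfolding sD unfolding Suc .
      have "x = fst (\<beta> i (\<alpha> i ?x)) \<oplus>\<^bsub>?F i\<^esub>
          (fst (c.D (Suc i) (s i ?x)) \<oplus>\<^bsub>?F i\<^esub> fst (s k (c.D (Suc k) ?x)))"
        using arg_cong[OF eqS[of ?x k], of fst] xC Suc by (simp add: c.C_simps)
      also have "fst (c.D (Suc i) (s i ?x)) \<oplus>\<^bsub>?F i\<^esub> fst (s k (c.D (Suc k) ?x))
          = \<Phi> i w \<oplus>\<^bsub>?F i\<^esub> (d (Suc i) u \<oplus>\<^bsub>?F i\<^esub> fst (s k (c.D (Suc k) ?x)))"
        unfolding D using mf[OF du] mf[OF sm] \<Phi>w by (simp add: Fi.a_ac)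
      finally show ?thesis using submodule.m_closed[OF mfree_submodule du sm] by blast
    qed
    then show ?thesis unfolding comb using \<alpha>x uw(3) by auto
  qed
  then show ?thesis using v by blast
qed

end


section \<open>Nilpotent chain maps and complexity\<close>

text \<open>The \<open>k\<close>-fold composite arriving in degree \<open>i\<close>. The factor
  added by the recursion is applied first, hence its degree \<open>i + k * q\<close>.\<close>

primrec chain_pow :: "(nat \<Rightarrow> 'p \<Rightarrow> 'p) \<Rightarrow> nat \<Rightarrow> nat \<Rightarrow> nat \<Rightarrow> 'p \<Rightarrow> 'p" where
  "chain_pow \<Phi> q 0 i = (\<lambda>w. w)"
| "chain_pow \<Phi> q (Suc k) i = (\<lambda>w. chain_pow \<Phi> q k i (\<Phi> (i + k * q) w))"

lemma chain_pow_hom: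
  assumes "\<And>n. \<Phi> n \<in> module_hom A (P (n + q)) (P n)"
  shows "chain_pow \<Phi> q k i \<in> module_hom A (P (i + k * q)) (P i)"
proof (induct k)
  case 0
  show ?case by (simp add: module_hom_id)
next
  case (Suc k)
  have idx: "i + Suc k * q = i + k * q + q" by simp
  show ?case unfolding chain_pow.simps idx by (rule module_hom_comp[OF assms Suc])
qed

lemma chain_pow_d:
  assumes \<Phi>: "\<And>n. \<Phi> n \<in> module_hom A (P (n + q)) (P n)"
    and d\<Phi>: "\<And>n y. y \<in> carrier (P (Suc n + q)) \<Longrightarrow> d (Suc n) (\<Phi> (Suc n) y) = \<Phi> n (d (Suc n + q) y)"
    and y: "y \<in> carrier (P (Suc n + k * q))"
  shows "d (Suc n) (chain_pow \<Phi> q k (Suc n) y) = chain_pow \<Phi> q k n (d (Suc n + k * q) y)"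
  using y
proof (induct k arbitrary: y)
  case 0
  show ?case by simp
next
  case (Suc k)
  have eq: "Suc (n + k * q) + q = Suc n + Suc k * q" by simp
  have y: "y \<in> carrier (P (Suc (n + k * q) + q))" using Suc.prems unfolding eq .
  then have "\<Phi> (Suc (n + k * q)) y \<in> carrier (P (Suc n + k * q))"
    using module_hom_in[OF \<Phi>[of "Suc (n + k * q)"], of y] by simp
  from Suc.hyps[OF this] show ?case using d\<Phi>[OF y] by (simp add: ac_simps)
qed

context noeth_local
begin

text \<open>The leftover \<open>w\<close> in degree \<open>i + k * q\<close> is itself expressed by
  the generation statement there. Applying \<open>\<Phi>\<^sup>k\<close> to that expression supplies
  \<open>r (i + k * q)\<close> further generators, and \<open>\<Phi>\<^sup>k\<close> preserves the
  maximal ideal part.\<close>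

lemma generators_chain_pow:
  assumes \<Phi>: "\<And>n. \<Phi> n \<in> module_hom A (free_module A (b (n + q))) (free_module A (b n))"
    and gen: "\<And>i. \<exists>v. v \<in> {..<r i} \<rightarrow> carrier (free_module A (b i)) \<and>
      (\<forall>x \<in> carrier (free_module A (b i)). \<exists>c \<in> carrier (free_module A (r i)).
         \<exists>w \<in> carrier (free_module A (b (i + q))). \<exists>z \<in> mfree (b i).
         x = fam_comb (free_module A (b i)) v (r i) c \<oplus>\<^bsub>free_module A (b i)\<^esub>
           (\<Phi> i w \<oplus>\<^bsub>free_module A (b i)\<^esub> z))"
  defines "R \<equiv> \<lambda>k i. \<Sum>j<k. r (i + j * q)"
  shows "\<exists>v. v \<in> {..<R k i} \<rightarrow> carrier (free_module A (b i)) \<and>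
      (\<forall>x \<in> carrier (free_module A (b i)). \<exists>c \<in> carrier (free_module A (R k i)).
         \<exists>w \<in> carrier (free_module A (b (i + k * q))). \<exists>z \<in> mfree (b i).
         x = fam_comb (free_module A (b i)) v (R k i) c \<oplus>\<^bsub>free_module A (b i)\<^esub>
           (chain_pow \<Phi> q k i w \<oplus>\<^bsub>free_module A (b i)\<^esub> z))"
proof (induct k)
  case 0
  let ?F = "free_module A (b i)"
  interpret F: module A "?F" by (rule free_mod)
  have R0: "R 0 i = 0" and i0: "i + 0 * q = i" by (simp_all add: R_def)
  show ?case
    unfolding R0 i0 chain_pow.simps
  proof (intro exI[of _ "\<lambda>_. \<zero>\<^bsub>?F\<^esub>"] conjI ballI)
    fix x assume x: "x \<in> carrier (?F)"
    show "\<exists>c \<in> carrier (free_module A 0). \<exists>w \<in> carrier (?F). \<exists>z \<in> mfree (b i).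
       x = fam_comb (?F) (\<lambda>_. \<zero>\<^bsub>?F\<^esub>) 0 c \<oplus>\<^bsub>?F\<^esub>
         (w \<oplus>\<^bsub>?F\<^esub> z)"
    proof (intro bexI)
      show "unit_fun A 0 0 \<in> carrier (free_module A 0)" by (rule unit_fun_in[OF ring_axioms])
      show "\<zero>\<^bsub>?F\<^esub> \<in> mfree (b i)" by (rule submodule.zero_closed[OF mfree_submodule])
      show "x \<in> carrier (?F)" by (rule x)
    qed (simp add: fam_comb_def x)
  qed simp
next
  case (Suc k)
  let ?F = "free_module A (b i)" and ?G = "free_module A (b (i + k * q))"
  interpret F: module A ?F by (rule free_mod)
  let ?\<Psi> = "chain_pow \<Phi> q k i"
  have \<Psi>: "?\<Psi> \<in> module_hom A ?G ?F" using chain_pow_hom[where P = "\<lambda>n. free_module A (b n)", OF \<Phi>] .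
  have RS: "R (Suc k) i = R k i + r (i + k * q)" unfolding R_def by simp
  have idx: "i + k * q + q = i + Suc k * q" by simp
  obtain v where v: "v \<in> {..<R k i} \<rightarrow> carrier ?F"
    and ev: "\<forall>x \<in> carrier ?F. \<exists>c \<in> carrier (free_module A (R k i)).
         \<exists>w \<in> carrier ?G. \<exists>z \<in> mfree (b i).
         x = fam_comb ?F v (R k i) c \<oplus>\<^bsub>?F\<^esub> (?\<Psi> w \<oplus>\<^bsub>?F\<^esub> z)" using Suc by blast
  obtain v' where v': "v' \<in> {..<r (i + k * q)} \<rightarrow> carrier ?G"
    and ev': "\<forall>x \<in> carrier ?G. \<exists>c \<in> carrier (free_module A (r (i + k * q))).
         \<exists>w \<in> carrier (free_module A (b (i + k * q + q))). \<exists>z \<in> mfree (b (i + k * q)).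
         x = fam_comb ?G v' (r (i + k * q)) c \<oplus>\<^bsub>?G\<^esub> (\<Phi> (i + k * q) w \<oplus>\<^bsub>?G\<^esub> z)" using gen[of "i + k * q"] by blast
  let ?v' = "\<lambda>j. ?\<Psi> (v' j)"
  have \<Psi>v': "?v' \<in> {..<r (i + k * q)} \<rightarrow> carrier ?F" using v' module_hom_in[OF \<Psi>] by auto
  let ?u = "\<lambda>j. if j < R k i then v j else ?v' (j - R k i)"
  have u: "?u \<in> {..<R (Suc k) i} \<rightarrow> carrier ?F" unfolding RS using v \<Psi>v' by (auto simp: Pi_iff)
  interpret G: module A ?G by (rule free_mod)
  note mf = submodule.subset[OF mfree_submodule, THEN subsetD]
  have "\<exists>c \<in> carrier (free_module A (R (Suc k) i)).
         \<exists>w \<in> carrier (free_module A (b (i + Suc k * q))). \<exists>z \<in> mfree (b i).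
         x = fam_comb ?F ?u (R (Suc k) i) c \<oplus>\<^bsub>?F\<^esub> (chain_pow \<Phi> q (Suc k) i w \<oplus>\<^bsub>?F\<^esub> z)"
    if x: "x \<in> carrier ?F" for x
  proof -
    obtain c w z where c: "c \<in> carrier (free_module A (R k i))" and w: "w \<in> carrier ?G" and z: "z \<in> mfree (b i)"
      and xe: "x = fam_comb ?F v (R k i) c \<oplus>\<^bsub>?F\<^esub> (?\<Psi> w \<oplus>\<^bsub>?F\<^esub> z)" using ev x by blast
    obtain c' w' z' where c': "c' \<in> carrier (free_module A (r (i + k * q)))"
      and w': "w' \<in> carrier (free_module A (b (i + k * q + q)))" and z': "z' \<in> mfree (b (i + k * q))"
      and we: "w = fam_comb ?G v' (r (i + k * q)) c' \<oplus>\<^bsub>?G\<^esub> (\<Phi> (i + k * q) w' \<oplus>\<^bsub>?G\<^esub> z')" using ev' w by blast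
    have cl: "fam_comb ?G v' (r (i + k * q)) c' \<in> carrier ?G" "\<Phi> (i + k * q) w' \<in> carrier ?G" "z' \<in> carrier ?G"
      using module_hom_in[OF fam_comb_hom[OF free_mod v'] c'] module_hom_in[OF \<Phi> w'] mf[OF z'] .
    \<comment> \<open>Of the three summands, the first yields new generators, the second is the next
      power applied to \<open>w'\<close>, and the third is absorbed into \<open>z\<close>.\<close>
    have \<Psi>w: "?\<Psi> w = fam_comb ?F ?v' (r (i + k * q)) c' \<oplus>\<^bsub>?F\<^esub> (?\<Psi> (\<Phi> (i + k * q) w') \<oplus>\<^bsub>?F\<^esub> ?\<Psi> z')"
      unfolding we using cl
      by (simp add: module_hom_add[OF \<Psi>] hom_fam_comb[OF free_mod free_mod \<Psi> v'] free_in[OF ring_axioms c'] Pi_iff)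
    have zz: "?\<Psi> z' \<oplus>\<^bsub>?F\<^esub> z \<in> mfree (b i)"
      by (intro submodule.m_closed[OF mfree_submodule] hom_mfree[OF \<Psi>] z z')
    have cl2: "fam_comb ?F v (R k i) c \<in> carrier ?F" "fam_comb ?F ?v' (r (i + k * q)) c' \<in> carrier ?F"
      "?\<Psi> (\<Phi> (i + k * q) w') \<in> carrier ?F" "?\<Psi> z' \<in> carrier ?F" "z \<in> carrier ?F"
      using module_hom_in[OF fam_comb_hom[OF free_mod v] c] module_hom_in[OF fam_comb_hom[OF free_mod \<Psi>v'] c']
        module_hom_in[OF \<Psi> cl(2)] module_hom_in[OF \<Psi> cl(3)] mf[OF z] .
    have "x = (fam_comb ?F v (R k i) c \<oplus>\<^bsub>?F\<^esub> fam_comb ?F ?v' (r (i + k * q)) c') \<oplus>\<^bsub>?F\<^esub>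
        (?\<Psi> (\<Phi> (i + k * q) w') \<oplus>\<^bsub>?F\<^esub> (?\<Psi> z' \<oplus>\<^bsub>?F\<^esub> z))"
      unfolding xe \<Psi>w using cl2 by (simp add: F.a_assoc)
    also have "fam_comb ?F v (R k i) c \<oplus>\<^bsub>?F\<^esub> fam_comb ?F ?v' (r (i + k * q)) c' =
        fam_comb ?F ?u (R (Suc k) i) (\<lambda>j\<in>{..<R (Suc k) i}. if j < R k i then c j else c' (j - R k i))"
      unfolding RS by (rule fam_comb_append_free[OF free_mod v c \<Psi>v' c'])
    finally show ?thesis
      using append_free[OF c c'] w' zz unfolding RS idx by auto
  qed
  then show ?case using u by blast
qed

text \<open>For large \<open>k\<close> the power \<open>\<Phi>\<^sup>k\<close> maps into
  \<open>mfree\<close>, so in \<open>generators_chain_pow\<close> its contribution joins the error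
  term and only the sum of the \<open>r\<close> remains. The number \<open>k\<close> of summands
  does not depend on \<open>i\<close>.\<close>

lemma rank_le_sum:
  assumes X: "module A X" and F: "minimal_free_resolution A X b d e"
    and cone: "mapping_cone A X (\<lambda>n. free_module A (b n)) d e m \<phi> \<Phi>"
    and G: "resolution A (mapping_cone.K X (\<lambda>n. free_module A (b n)) d m \<phi>) (\<lambda>n. free_module A (r n)) d' e'"
    and van: "\<And>n. n \<ge> n0 \<Longrightarrow> ext_vanish A (\<lambda>n. free_module A (b n)) d X n"
  shows "\<exists>k. \<forall>i. b i \<le> (\<Sum>j<k. r (i + j * Suc m))"
proof -
  let ?F = "\<lambda>n. free_module A (b n)" and ?q = "Suc m"
  interpret c: mapping_cone A X ?F d e m \<phi> \<Phi> by (rule cone)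
  note Fr = minimalD(1)[OF F]
  \<comment> \<open>Any \<open>k > n0\<close> would do: the cocycle below has degree
    \<open>k * Suc m = Suc N\<close>, and as \<open>ext_vanish\<close> is indexed one below the
    degree, \<open>N \<ge> n0\<close> is what is required.\<close>
  define k where "k = Suc n0"
  define N where "N = k * ?q - 1"
  have N: "k * ?q = Suc N" "N \<ge> n0" unfolding N_def k_def by simp_all
  define \<Psi> where "\<Psi> i = chain_pow \<Phi> ?q k i" for i
  have \<Phi>: "\<Phi> n \<in> module_hom A (?F (n + ?q)) (?F n)" for n using c.\<Phi>[of n] by simp
  have \<Psi>: "\<Psi> n \<in> module_hom A (?F (n + Suc N)) (?F n)" for n
    unfolding \<Psi>_def N(1)[symmetric] by (rule chain_pow_hom[where P = ?F, OF \<Phi>])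
  have \<Psi>d: "d (Suc n) (\<Psi> (Suc n) y) = \<Psi> n (d (Suc (n + Suc N)) y)"
    if "y \<in> carrier (?F (Suc n + Suc N))" for n y
    using chain_pow_d[where P = ?F and d = d and k = k and n = n and q = ?q, OF \<Phi>] c.d\<Phi> that
    unfolding \<Psi>_def N(1) by simp
  \<comment> \<open>This cocycle represents the \<open>k\<close>th power of the class of
    \<open>\<phi>\<close>.\<close>
  have e\<Psi>: "(\<lambda>y. e (\<Psi> 0 y)) \<in> module_hom A (?F (Suc N)) X"
    using module_hom_comp[OF \<Psi>[of 0] resolutionD(2)[OF Fr]] by simp
  have cyc: "e (\<Psi> 0 (d (Suc (Suc N)) y)) = \<zero>\<^bsub>X\<^esub>" if "y \<in> carrier (?F (Suc (Suc N)))" for y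
  proof -
    have "e (d (Suc 0) (\<Psi> (Suc 0) y)) = \<zero>\<^bsub>X\<^esub>"
      using that by (intro resolutionD(5)[OF Fr] module_hom_in[OF \<Psi>[of "Suc 0"]]) simp
    then show ?thesis using \<Psi>d[of y 0] that by simp
  qed
  obtain h where h: "h \<in> module_hom A (?F N) X"
    "\<And>y. y \<in> carrier (?F (Suc N)) \<Longrightarrow> e (\<Psi> 0 y) = h (d (Suc N) y)"
    using ext_vanishD[where g = "\<lambda>y. e (\<Psi> 0 y)", OF van[OF N(2)] e\<Psi>] cyc by blast
  have ex: "\<exists>y \<in> carrier (?F 0). e y = h x" if "x \<in> carrier (?F N)" for x
  proof -
    have "h x \<in> e ` carrier (?F 0)" unfolding resolutionD(4)[OF Fr] by (rule module_hom_in[OF h(1) that])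
    then show ?thesis by auto
  qed
  obtain s0 where s0: "s0 \<in> module_hom A (?F N) (?F 0)" "\<And>x. x \<in> carrier (?F N) \<Longrightarrow> e (s0 x) = h x"
    using liftsD[OF free_lifts[OF free_mod X resolutionD(2)[OF Fr]] h(1) ex] by blast
  \<comment> \<open>The bounding cochain \<open>h\<close> lifts through the augmentation to
    \<open>s0\<close>, the component of the homotopy just below the truncation.\<close>
  define a where "a y = s0 (d (Suc N) y)" for y
  have a: "a \<in> module_hom A (?F (0 + Suc N)) (?F 0)"
    unfolding a_def[abs_def] using module_hom_comp[OF resolutionD(3)[OF Fr] s0(1)] by simp
  have ea: "e (\<Psi> 0 y) = e (a y)" if "y \<in> carrier (?F (0 + Suc N))" for y
    unfolding a_def using that h(2) s0(2)[OF module_hom_in[OF resolutionD(3)[OF Fr]]] by simp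
  have ad: "a (d (Suc (0 + Suc N)) y) = \<zero>\<^bsub>?F 0\<^esub>" if "y \<in> carrier (?F (Suc 0 + Suc N))" for y
    unfolding a_def using that resolutionD(7)[OF Fr, of y N] module_hom_zero[OF free_mod free_mod s0(1)] by simp
  from homotopy[where P = "\<lambda>n. ?F (n + Suc N)" and \<psi> = \<Psi> and a = a, OF Fr X resolution_chain_cplx[OF Fr]
      free_lifts_along[OF Fr X] \<Psi> \<Psi>d a ea ad]
  obtain s where s: "\<And>n. s n \<in> module_hom A (?F (n + Suc N)) (?F (Suc n))"
    and null0: "\<And>x. x \<in> carrier (?F (0 + Suc N)) \<Longrightarrow> \<Psi> 0 x = d (Suc 0) (s 0 x) \<oplus>\<^bsub>?F 0\<^esub> a x"
    and nullS: "\<And>n x. x \<in> carrier (?F (Suc n + Suc N)) \<Longrightarrow>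
        \<Psi> (Suc n) x = d (Suc (Suc n)) (s (Suc n) x) \<oplus>\<^bsub>?F (Suc n)\<^esub> s n (d (Suc (n + Suc N)) x)"
    by blast
  \<comment> \<open>Each summand of the homotopy formula contains a differential of the minimal
    resolution, and homomorphisms preserve \<open>mfree\<close>.\<close>
  have null: "\<Psi> i x \<in> mfree (b i)" if x: "x \<in> carrier (?F (i + Suc N))" for i x
  proof (cases i)
    case 0
    then have x0: "x \<in> carrier (?F (0 + Suc N))" using x by simp
    then have x1: "x \<in> carrier (?F (Suc N))" by simp
    show ?thesis
      unfolding 0 null0[OF x0] a_def
      by (intro submodule.m_closed[OF mfree_submodule] minimalD(2)[OF F] hom_mfree[OF s0(1)]
          module_hom_in[OF s x0] x1)
  next
    case (Suc n)
    then have x0: "x \<in> carrier (?F (Suc n + Suc N))" using x by simp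
    then have x1: "x \<in> carrier (?F (Suc (n + Suc N)))" by simp
    show ?thesis
      unfolding Suc nullS[OF x0]
      by (intro submodule.m_closed[OF mfree_submodule] minimalD(2)[OF F] hom_mfree[OF s]
          module_hom_in[OF s x0] x1)
  qed
  have "b i \<le> (\<Sum>j<k. r (i + j * ?q))" for i
  proof -
    obtain v where v: "v \<in> {..<\<Sum>j<k. r (i + j * ?q)} \<rightarrow> carrier (?F i)"
      and ev: "\<forall>x \<in> carrier (?F i). \<exists>c \<in> carrier (free_module A (\<Sum>j<k. r (i + j * ?q))).
         \<exists>w \<in> carrier (?F (i + k * ?q)). \<exists>z \<in> mfree (b i).
         x = fam_comb (?F i) v (\<Sum>j<k. r (i + j * ?q)) c \<oplus>\<^bsub>?F i\<^esub> (chain_pow \<Phi> ?q k i w \<oplus>\<^bsub>?F i\<^esub> z)"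
      using generators_chain_pow[where \<Phi> = \<Phi> and q = ?q and b = b and r = r and k = k and i = i,
          OF \<Phi> cone_generators[OF X F cone G]] by blast
    show ?thesis
    proof (rule rank_le_of_generators_mod_mm[OF v])
      fix x assume "x \<in> carrier (?F i)"
      then obtain c w z where c: "c \<in> carrier (free_module A (\<Sum>j<k. r (i + j * ?q)))"
        and w: "w \<in> carrier (?F (i + Suc N))" and z: "z \<in> mfree (b i)"
        and x: "x = fam_comb (?F i) v (\<Sum>j<k. r (i + j * ?q)) c \<oplus>\<^bsub>?F i\<^esub> (\<Psi> i w \<oplus>\<^bsub>?F i\<^esub> z)"
        using ev unfolding N(1) \<Psi>_def by blast
      have "\<Psi> i w \<oplus>\<^bsub>?F i\<^esub> z \<in> mfree (b i)"
        by (rule submodule.m_closed[OF mfree_submodule null[OF w] z])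
      then show "\<exists>c\<in>carrier (free_module A (\<Sum>j<k. r (i + j * ?q))). \<exists>z\<in>mfree (b i).
          x = fam_comb (?F i) v (\<Sum>j<k. r (i + j * ?q)) c \<oplus>\<^bsub>?F i\<^esub> z"
        using c x by blast
    qed
  qed
  then show ?thesis by blast
qed

end

text \<open>From \<open>i \<ge> 1\<close> follows \<open>i + j * q \<le> i * (1 + k * q)\<close>.
  The exponent is -1 for \<open>t = 0\<close>, where the shift only decreases the value; the
  constant carries the power \<open>t\<close>, not \<open>t - 1\<close>, to cover both
  cases.\<close>

lemma powi_shift_le:
  fixes i j q k t :: nat
  assumes "1 \<le> i" "j < k"
  shows "real (i + j * q) powi (int t - 1) \<le> (1 + real k * real q) ^ t * real i powi (int t - 1)"
proof (cases t)
  case 0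
  have "inverse (real (i + j * q)) \<le> inverse (real i)" using assms by (intro le_imp_inverse_le) auto
  then show ?thesis using 0 by (simp add: power_int_minus)
next
  case (Suc s)
  have "real j * real q \<le> real i * (real k * real q)"
  proof -
    have "real j * real q \<le> real k * real q" using assms by (intro mult_right_mono) auto
    also have "\<dots> \<le> real i * (real k * real q)" using assms mult_right_mono[of 1 "real i" "real k * real q"] by simp
    finally show ?thesis .
  qed
  then have "real (i + j * q) \<le> real i * (1 + real k * real q)" by (simp add: algebra_simps)
  then have "real (i + j * q) ^ s \<le> (real i * (1 + real k * real q)) ^ s" by (intro power_mono) auto
  also have "\<dots> = (1 + real k * real q) ^ s * real i ^ s" by (simp add: power_mult_distrib)
  also have "\<dots> \<le> (1 + real k * real q) ^ Suc s * real i ^ s"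
    by (intro mult_right_mono power_increasing) auto
  finally show ?thesis using Suc by simp
qed

text \<open>A sum of a fixed number of shifts by a bounded amount has the same order of growth, so
  every exponent admissible for \<open>K\<close> is admissible for \<open>X\<close>.\<close>

lemma complexity_le:
  assumes "\<And>i. betti A X i \<le> (\<Sum>j<k. betti A K (i + j * q))"
  shows "complexity A X \<le> complexity A K"
  unfolding complexity_def
proof (intro Inf_superset_mono subsetI, elim CollectE exE conjE)
  fix x t a
  assume x: "x = enat t"
    and ev: "\<forall>\<^sub>F n in sequentially. real (betti A K n) \<le> a * real n powi (int t - 1)"
  then obtain N where N: "\<And>n. n \<ge> N \<Longrightarrow> real (betti A K n) \<le> a * real n powi (int t - 1)"
    unfolding eventually_sequentially by blast
  let ?c = "(1 + real k * real q) ^ t"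
  \<comment> \<open>The absolute value avoids a distinction by the sign of \<open>a\<close>;
    \<open>i \<ge> 1\<close> is needed for the shift estimate.\<close>
  have "real (betti A X i) \<le> (real k * (\<bar>a\<bar> * ?c)) * real i powi (int t - 1)" if i: "i \<ge> max N 1" for i
  proof -
    have "real (betti A X i) \<le> real (\<Sum>j<k. betti A K (i + j * q))" using assms by (simp only: of_nat_le_iff)
    also have "\<dots> = (\<Sum>j<k. real (betti A K (i + j * q)))" by simp
    also have "\<dots> \<le> (\<Sum>j<k. \<bar>a\<bar> * ?c * real i powi (int t - 1))"
    proof (rule sum_mono)
      fix j assume j: "j \<in> {..<k}"
      have "real (betti A K (i + j * q)) \<le> a * real (i + j * q) powi (int t - 1)"
        using i by (intro N) simp
      also have "\<dots> \<le> \<bar>a\<bar> * real (i + j * q) powi (int t - 1)"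
        by (intro mult_right_mono) auto
      also have "\<dots> \<le> \<bar>a\<bar> * (?c * real i powi (int t - 1))"
        using i j by (intro mult_left_mono powi_shift_le) auto
      finally show "real (betti A K (i + j * q)) \<le> \<bar>a\<bar> * ?c * real i powi (int t - 1)" by simp
    qed
    also have "\<dots> = (real k * (\<bar>a\<bar> * ?c)) * real i powi (int t - 1)" by simp
    finally show ?thesis .
  qed
  then show "x \<in> {enat t |t. \<exists>a. \<forall>\<^sub>F n in sequentially. real (betti A X n) \<le> a * real n powi (int t - 1)}"
    using x unfolding eventually_sequentially by blast
qed

lemma complexity_zero:
  assumes "\<And>i. i > n \<Longrightarrow> betti A X i = 0"
  shows "complexity A X = 0"
proof -
  \<comment> \<open>With exponent -1 the constant 0 bounds a sequence that is eventually
    zero.\<close>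
  have "\<forall>\<^sub>F i in sequentially. real (betti A X i) \<le> 0 * real i powi (int 0 - 1)"
    unfolding eventually_sequentially using assms by (intro exI[of _ "Suc n"]) auto
  then have "enat 0 \<in> {enat t |t. \<exists>a. \<forall>\<^sub>F n in sequentially. real (betti A X n) \<le> a * real n powi (int t - 1)}"
    by blast
  then have "complexity A X \<le> enat 0" unfolding complexity_def by (rule Inf_lower)
  then show ?thesis by (simp flip: zero_enat_def)
qed


section \<open>Finite projective dimension\<close>

text \<open>The lifting property of a projective module only speaks about modules of the type
  \<open>'a umodule\<close>. Quotients of a module with elements of type \<open>nat \<Rightarrow> 'a\<close> have this type, so the property
  is applied to the projection from \<open>Y/0\<close> to \<open>Y/ker g\<close>.\<close>

lemma projective_lifts:
  fixes Y :: "('a, nat \<Rightarrow> 'a) module"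
  assumes P: "projective_module A P" and Y: "fin_gen A Y" and Z: "module A Z" and g: "g \<in> module_hom A Y Z"
  shows "lifts A P g Y Z"
  unfolding lifts_def
proof (intro ballI impI)
  fix f assume f: "f \<in> module_hom A P Z" and fg: "f ` carrier P \<subseteq> g ` carrier Y"
  note Ym = fin_gen_module[OF Y]
  interpret Y: module A Y by (rule Ym)
  interpret Z: module A Z by (rule Z)
  let ?N = "{y \<in> carrier Y. g y = \<zero>\<^bsub>Z\<^esub>}"
  have N: "submodule A ?N Y" by (rule kernel_submodule[OF Ym Z g])
  have 0: "submodule A {\<zero>\<^bsub>Y\<^esub>} Y" by unfold_locales auto
  define Q where "Q = quotient_module Y ?N"
  define Q0 where "Q0 = quotient_module Y {\<zero>\<^bsub>Y\<^esub>}"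
  define \<pi> where "\<pi> y = ?N +>\<^bsub>Y\<^esub> y" for y
  note Q = quotient_module_props[OF Ym N, folded Q_def \<pi>_def]
  note Q0 = quotient_module_props[OF Ym 0, folded Q0_def]
  have coset0: "{\<zero>\<^bsub>Y\<^esub>} +>\<^bsub>Y\<^esub> y = {y}" if "y \<in> carrier Y" for y
    using that by (simp add: singleton_coset)
  have sing: "\<exists>y \<in> carrier Y. c = {y}" if "c \<in> carrier Q0" for c
    using that coset0 unfolding Q0(3)[symmetric] by auto
  have add0: "{x} \<oplus>\<^bsub>Q0\<^esub> {y} = {x \<oplus>\<^bsub>Y\<^esub> y}" if "x \<in> carrier Y" "y \<in> carrier Y" for x y
    using module_hom_add[OF Q0(2) that] coset0 that by simp
  have smult0: "a \<odot>\<^bsub>Q0\<^esub> {y} = {a \<odot>\<^bsub>Y\<^esub> y}" if "a \<in> carrier A" "y \<in> carrier Y" for a y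
    using module_hom_smult[OF Q0(2) that] coset0 that by simp
  have the: "the_elem \<in> module_hom A Q0 Y"
    by (rule module_homI) (auto dest!: sing simp: add0 smult0)
  have \<pi>_eq: "\<pi> x = \<pi> y \<longleftrightarrow> g x = g y" if "x \<in> carrier Y" "y \<in> carrier Y" for x y
  proof -
    interpret Q: module A Q by (rule Q(1))
    have "\<pi> x = \<pi> y \<longleftrightarrow> \<pi> (x \<ominus>\<^bsub>Y\<^esub> y) = \<zero>\<^bsub>Q\<^esub>"
      using that module_hom_in[OF Q(2)] by (simp add: module_hom_diff[OF Ym Q(1) Q(2)])
    also have "\<dots> \<longleftrightarrow> g (x \<ominus>\<^bsub>Y\<^esub> y) = \<zero>\<^bsub>Z\<^esub>" using Q(4)[of "x \<ominus>\<^bsub>Y\<^esub> y"] that by simp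
    also have "\<dots> \<longleftrightarrow> g x = g y"
      using that module_hom_in[OF g] by (simp add: module_hom_diff[OF Ym Z g])
    finally show ?thesis .
  qed
  have "\<exists>y \<in> carrier Y. g y = f x" if "x \<in> carrier P" for x
    using subsetD[OF fg imageI[OF that]] by auto
  \<comment> \<open>An arbitrary choice of preimages, in general not linear.\<close>
  then obtain l where l: "\<And>x. x \<in> carrier P \<Longrightarrow> l x \<in> carrier Y" "\<And>x. x \<in> carrier P \<Longrightarrow> g (l x) = f x" by metis
  have Pm: "module A P" using P fin_gen_module unfolding projective_module_def by blast
  interpret P: module A P by (rule Pm)
  \<comment> \<open>Two choices with the same image under \<open>g\<close> agree modulo the kernel,
    so the choice becomes linear in the quotient.\<close>
  have f': "(\<lambda>x. \<pi> (l x)) \<in> module_hom A P Q"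
  proof (rule module_homI)
    fix x assume x: "x \<in> carrier P"
    show "\<pi> (l x) \<in> carrier Q" by (rule module_hom_in[OF Q(2) l(1)[OF x]])
    fix y assume y: "y \<in> carrier P"
    have "\<pi> (l (x \<oplus>\<^bsub>P\<^esub> y)) = \<pi> (l x \<oplus>\<^bsub>Y\<^esub> l y)"
      using x y l by (subst \<pi>_eq) (auto simp: module_hom_add[OF g] module_hom_add[OF f])
    then show "\<pi> (l (x \<oplus>\<^bsub>P\<^esub> y)) = \<pi> (l x) \<oplus>\<^bsub>Q\<^esub> \<pi> (l y)"
      using x y l by (simp add: module_hom_add[OF Q(2)])
  next
    fix r x assume r: "r \<in> carrier A" and x: "x \<in> carrier P"
    have "\<pi> (l (r \<odot>\<^bsub>P\<^esub> x)) = \<pi> (r \<odot>\<^bsub>Y\<^esub> l x)"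
      using r x l by (subst \<pi>_eq) (auto simp: module_hom_smult[OF g] module_hom_smult[OF f])
    then show "\<pi> (l (r \<odot>\<^bsub>P\<^esub> x)) = r \<odot>\<^bsub>Q\<^esub> \<pi> (l x)"
      using r x l by (simp add: module_hom_smult[OF Q(2)])
  qed
  have "fin_gen A Q" "fin_gen A Q0"
    using fin_gen_image[OF Y Q(1-3)] fin_gen_image[OF Y Q0(1-3)] .
  moreover have "(\<lambda>c. \<pi> (the_elem c)) \<in> module_hom A Q0 Q" by (rule module_hom_comp[OF the Q(2)])
  moreover have "(\<lambda>c. \<pi> (the_elem c)) ` carrier Q0 = carrier Q"
    unfolding Q0(3)[symmetric] Q(3)[symmetric] image_image using coset0 by (intro image_cong) auto
  ultimately have "\<exists>h \<in> module_hom A P Q0. \<forall>x \<in> carrier P. \<pi> (the_elem (h x)) = \<pi> (l x)"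
    using P f' unfolding projective_module_def by blast
  then obtain h where h: "h \<in> module_hom A P Q0" "\<And>x. x \<in> carrier P \<Longrightarrow> \<pi> (the_elem (h x)) = \<pi> (l x)" by blast
  show "\<exists>h\<in>module_hom A P Y. \<forall>x\<in>carrier P. g (h x) = f x"
  proof (intro bexI ballI)
    show hom: "(\<lambda>x. the_elem (h x)) \<in> module_hom A P Y" by (rule module_hom_comp[OF h(1) the])
    fix x assume x: "x \<in> carrier P"
    show "g (the_elem (h x)) = f x"
      using h(2)[OF x] \<pi>_eq[OF module_hom_in[OF hom x] l(1)[OF x]] l(2)[OF x] by simp
  qed
qed

context noeth_local
begin

text \<open>In a degree beyond the length of the projective resolution the retraction passes through
  zero. The corresponding term of the minimal resolution then lies in \<open>mfree\<close>, which
  forces its rank to be 0.\<close>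

lemma finite_proj_dim_complexity:
  assumes X: "fin_gen A X" and pd: "proj_dim A X < \<infinity>"
  shows "complexity A X = 0"
proof -
  let ?S = "{enat n | n. \<exists>(P :: nat \<Rightarrow> 'a umodule) d e.
     resolution A X P d e \<and> (\<forall>i. projective_module A (P i)) \<and> (\<forall>i>n. carrier (P i) = {\<zero>\<^bsub>P i\<^esub>})}"
  \<comment> \<open>The infimum of the empty set is infinite, so a finite value provides an actual
    resolution.\<close>
  have "?S \<noteq> {}"
  proof
    assume "?S = {}"
    then have "proj_dim A X = Inf {}" unfolding proj_dim_def by (rule arg_cong)
    then have "proj_dim A X = \<infinity>" by (simp add: top_enat_def)
    then show False using pd by simp
  qed
  then obtain n P d e where P: "resolution A X (P :: nat \<Rightarrow> 'a umodule) d e"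
    and proj: "\<And>i. projective_module A (P i)" and zero: "\<And>i. i > n \<Longrightarrow> carrier (P i) = {\<zero>\<^bsub>P i\<^esub>}" by blast
  note Xm = fin_gen_module[OF X]
  let ?b = "fst (min_res A X)" and ?d = "res_map A X"
  note F = min_res_props(1)[OF X] and Fr = minimalD(1)[OF min_res_props(1)[OF X]]
  have PF: "lifts_along A P X (\<lambda>n. free_module A (?b n)) ?d (snd (snd (min_res A X)))"
    unfolding lifts_along_def
    by (intro allI conjI projective_lifts proj fin_gen_free is_cring Xm free_mod resolutionD(2,3)[OF Fr])
  from resolution_retract[OF Fr P Xm free_lifts_along[OF P Xm] PF free_lifts_along[OF Fr Xm]]
  obtain \<alpha> \<beta> s where \<alpha>: "\<And>n. \<alpha> n \<in> module_hom A (free_module A (?b n)) (P n)"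
    and \<beta>: "\<And>n. \<beta> n \<in> module_hom A (P n) (free_module A (?b n))"
    and s: "\<And>n. s n \<in> module_hom A (free_module A (?b n)) (free_module A (?b (Suc n)))"
    and eqS: "\<And>n x. x \<in> carrier (free_module A (?b (Suc n))) \<Longrightarrow>
      x = \<beta> (Suc n) (\<alpha> (Suc n) x) \<oplus>\<^bsub>free_module A (?b (Suc n))\<^esub>
        (?d (Suc (Suc n)) (s (Suc n) x) \<oplus>\<^bsub>free_module A (?b (Suc n))\<^esub> s n (?d (Suc n) x))"
    by blast
  show ?thesis
  proof (rule complexity_zero)
    fix i assume "n < i"
    then obtain k where i: "i = Suc k" by (cases i) auto
    \<comment> \<open>The empty family generates modulo \<open>mm\<close>.\<close>
    have "?b i \<le> 0"
    proof (rule rank_le_of_generators_mod_mm)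
      show "(\<lambda>_. \<zero>\<^bsub>free_module A (?b i)\<^esub>) \<in> {..<0::nat} \<rightarrow> carrier (free_module A (?b i))" by auto
      interpret Fi: module A "free_module A (?b i)" by (rule free_mod)
      have fc0: "fam_comb (free_module A (?b i)) (\<lambda>_. \<zero>\<^bsub>free_module A (?b i)\<^esub>) 0 c = \<zero>\<^bsub>free_module A (?b i)\<^esub>" for c
        by (simp add: fam_comb_def)
      fix x assume x: "x \<in> carrier (free_module A (?b i))"
      then have x': "x \<in> carrier (free_module A (?b (Suc k)))" unfolding i .
      let ?z = "?d (Suc (Suc k)) (s (Suc k) x) \<oplus>\<^bsub>free_module A (?b (Suc k))\<^esub> s k (?d (Suc k) x)"
      have z: "?z \<in> mfree (?b i)"
        unfolding i by (intro submodule.m_closed[OF mfree_submodule] minimalD(2)[OF F] module_hom_in[OF s x']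
            hom_mfree[OF s] x')
      have "\<alpha> i x = \<zero>\<^bsub>P i\<^esub>" using module_hom_in[OF \<alpha> x] zero[OF \<open>n < i\<close>] by auto
      then have "\<beta> i (\<alpha> i x) = \<zero>\<^bsub>free_module A (?b i)\<^esub>"
        using module_hom_zero[OF resolutionD(1)[OF P] free_mod \<beta>] by simp
      then have "x = fam_comb (free_module A (?b i)) (\<lambda>_. \<zero>\<^bsub>free_module A (?b i)\<^esub>) 0 (unit_fun A 0 0)
          \<oplus>\<^bsub>free_module A (?b i)\<^esub> ?z"
        using eqS[OF x'] fc0 unfolding i by simp
      then show "\<exists>c\<in>carrier (free_module A 0). \<exists>z\<in>mfree (?b i).
          x = fam_comb (free_module A (?b i)) (\<lambda>_. \<zero>\<^bsub>free_module A (?b i)\<^esub>) 0 c \<oplus>\<^bsub>free_module A (?b i)\<^esub> z"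
        using z unit_fun_in[OF ring_axioms] by blast
    qed
    then show "betti A X i = 0" unfolding betti_eq_rank[OF X] by simp
  qed
qed


section \<open>Free reducible complexity\<close>

text \<open>The composite of \<open>f\<close> with the map onto the syzygy is a cocycle, which
  \<open>comparison_map\<close> lifts to \<open>\<Phi>\<close> on the truncated resolution. The two
  pushouts agree because the syzygy is the image of the differential in degree
  \<open>Suc m\<close>.\<close>

lemma pushout_cone:
  assumes X: "fin_gen A X" and f: "represents A (Suc m) X X f \<eta>"
  obtains \<Phi> where
    "mapping_cone A X (res_module A X) (res_map A X) (snd (snd (min_res A X))) m
       (\<lambda>y. f (res_map A X (Suc m) y)) \<Phi>"
    "K_module A (Suc m) X f =
       mapping_cone.K X (res_module A X) (res_map A X) m (\<lambda>y. f (res_map A X (Suc m) y))"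
proof -
  let ?F = "res_module A X" and ?d = "res_map A X" and ?e = "snd (snd (min_res A X))"
  let ?\<phi> = "\<lambda>y. f (?d (Suc m) y)"
  note Xm = fin_gen_module[OF X] and Fr = min_res_props(2)[OF X] and Fm = min_res_props(3)[OF X]
    and d = min_res_props(4)[OF X]
  have f_hom: "f \<in> module_hom A (syzygy A X (Suc m)) X" using f unfolding represents_def by simp
  have "?d (Suc m) \<in> module_hom A (?F (Suc m)) (syzygy A X (Suc m))"
    using d[of m] unfolding syzygy_def module_hom_def by auto
  from module_hom_comp[OF this f_hom] have \<phi>: "?\<phi> \<in> module_hom A (?F (Suc m)) X" .
  have \<phi>d: "?\<phi> (?d (Suc (Suc m)) y) = \<zero>\<^bsub>X\<^esub>" if "y \<in> carrier (?F (Suc (Suc m)))" for y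
    using resolutionD(7)[OF Fr that] module_hom_zero[OF Fm Fm d[of m]] module_hom_zero[OF Fm Xm \<phi>] by simp
  have cc: "chain_cplx A (\<lambda>n. ?F (n + Suc m)) (\<lambda>n. ?d (Suc (n + Suc m)))" by (rule resolution_chain_cplx[OF Fr])
  have la: "lifts_along A (\<lambda>n. ?F (n + Suc m)) X ?F ?d ?e"
    using res_lifts_along[OF Fr Xm, of X] unfolding lifts_along_def by simp
  have eps: "?\<phi> \<in> module_hom A (?F (0 + Suc m)) X" "\<And>y. y \<in> carrier (?F (Suc 0 + Suc m)) \<Longrightarrow> ?\<phi> (?d (Suc (0 + Suc m)) y) = \<zero>\<^bsub>X\<^esub>"
    using \<phi> \<phi>d by simp_all
  obtain \<Phi> where \<Phi>: "\<And>n. \<Phi> n \<in> module_hom A (?F (n + Suc m)) (?F n)"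
    "\<And>y. y \<in> carrier (?F (0 + Suc m)) \<Longrightarrow> ?e (\<Phi> 0 y) = ?\<phi> y"
    "\<And>n y. y \<in> carrier (?F (Suc n + Suc m)) \<Longrightarrow> ?d (Suc n) (\<Phi> (Suc n) y) = \<Phi> n (?d (Suc (n + Suc m)) y)"
    using comparison_map[where eps = ?\<phi> and P = "\<lambda>n. ?F (n + Suc m)", OF Fr Xm cc la eps] by blast
  have cone: "mapping_cone A X ?F ?d ?e m ?\<phi> \<Phi>"
  proof (rule mapping_cone.intro[OF Xm Fr \<phi>])
    show "\<Phi> n \<in> module_hom A (?F (Suc (n + m))) (?F n)" for n using \<Phi>(1)[of n] by simp
    show "?e (\<Phi> 0 y) = ?\<phi> y" if "y \<in> carrier (?F (Suc m))" for y using \<Phi>(2)[of y] that by simp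
    show "?d (Suc n) (\<Phi> (Suc n) y) = \<Phi> n (?d (Suc (Suc (n + m))) y)"
      if "y \<in> carrier (?F (Suc (Suc (n + m))))" for n y using \<Phi>(3)[of y n] that by simp
  qed
  have "K_module A (Suc m) X f = mapping_cone.K X ?F ?d m ?\<phi>"
    unfolding K_module_def Let_def mapping_cone.K_def[OF cone] mapping_cone.S_def[OF cone] syzygy_def
    by (simp add: image_image)
  with cone show ?thesis by (rule that)
qed

lemma frc_fin_gen: "frc A X \<Longrightarrow> fin_gen A X"
  by (cases rule: frc.cases) auto

lemma fin_gen_iso:
  assumes "fin_gen A K" "module A L" "module_isomorphic A K L"
  shows "fin_gen A L"
  using assms fin_gen_image[OF assms(1,2)] unfolding module_isomorphic_def bij_betw_def by blast

text \<open>The complexity is only assumed to be at least \<open>t\<close>, which lets the induction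
  follow the reductions while the class of test modules stays fixed. Vanishing descends to
  \<open>K\<close> as long as \<open>K\<close> still has complexity at least \<open>t\<close>;
  otherwise \<open>X\<close> itself is a test module.\<close>

lemma frc_no_ext_vanishing:
  assumes "frc A X" and "enat t \<le> complexity A X" and "t \<ge> 1"
    and "\<And>N. N \<in> frc_class A t \<Longrightarrow> \<forall>\<^sub>F i in sequentially. ext_vanish A (res_module A X) (res_map A X) N i"
  shows False
  using assms
proof (induct rule: frc.induct)
  case (finite_proj_dim X)
  then show ?case
    using finite_proj_dim_complexity[OF finite_proj_dim(1,2)] by (simp add: zero_enat_def)
next
  case (reduce X n \<eta> f K)
  note X = reduce(1) and Xm = fin_gen_module[OF reduce(1)]
  obtain m where n: "n = Suc m" using reduce(4) by (cases n) auto
  let ?F = "res_module A X" and ?d = "res_map A X" and ?e = "snd (snd (min_res A X))"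
  let ?\<phi> = "\<lambda>y. f (?d (Suc m) y)" and ?L = "K_module A n X f"
  obtain \<Phi> where cone: "mapping_cone A X ?F ?d ?e m ?\<phi> \<Phi>"
    and L: "?L = mapping_cone.K X ?F ?d m ?\<phi>"
    using pushout_cone[OF X reduce(6)[unfolded n]] unfolding n by blast
  interpret c: mapping_cone A X ?F ?d ?e m ?\<phi> \<Phi> by (rule cone)
  have K: "fin_gen A K" using reduce(9) by (rule frc_fin_gen)
  have Lm: "module A ?L" unfolding L by (rule c.K_module)
  \<comment> \<open>Elements of the pushout have another type, so membership in the class, and with
    it finite generation, is known for the isomorphic copy \<open>K\<close>.\<close>
  have Lf: "fin_gen A ?L" by (rule fin_gen_iso[OF K Lm reduce(8)])
  have cxK: "complexity A K = complexity A ?L" by (rule complexity_iso[OF K Lf reduce(8)])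
  show ?case
  proof (cases "enat t \<le> complexity A K")
    case True
    show ?thesis
    proof (rule reduce(10)[OF True reduce(12)])
      fix N assume N: "N \<in> frc_class A t"
      then have Nm: "module A N" unfolding frc_class_def using frc_fin_gen fin_gen_module by blast
      obtain h where h: "h \<in> module_hom A K ?L" "bij_betw h (carrier K) (carrier ?L)"
        using reduce(8) unfolding module_isomorphic_def by blast
      note resK = resolution_iso[OF fin_gen_module[OF K] Lm h min_res_props(2)[OF K]]
      note resC = c.cone_resolution[folded L]
      obtain I where I: "\<And>i. i \<ge> I \<Longrightarrow> ext_vanish A ?F ?d N i"
        using reduce(13)[OF N] unfolding eventually_sequentially by blast
      have "ext_vanish A (res_module A K) (res_map A K) N i" if "i \<ge> I" for i
      proof (rule ext_vanish_transfer[OF resC resK Lm Nm])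
        show "lifts_along A c.C ?L (res_module A K) (res_map A K) (\<lambda>x. h (snd (snd (min_res A K)) x))"
          by (rule c.cone_lifts_along[OF resK Lm res_lifts_along[OF resK Lm]])
        show "lifts_along A (res_module A K) ?L c.C c.D c.\<epsilon>" by (rule res_lifts_along[OF resC Lm])
        show "lifts_along A (res_module A K) ?L (res_module A K) (res_map A K) (\<lambda>x. h (snd (snd (min_res A K)) x))"
          by (rule res_lifts_along[OF resK Lm])
        \<comment> \<open>Both required indices, \<open>i\<close> and \<open>i + m\<close>, are at
          least \<open>I\<close>.\<close>
        show "ext_vanish A c.C c.D N i" using that by (intro c.cone_ext_vanish Nm I) simp_all
      qed
      then show "\<forall>\<^sub>F i in sequentially. ext_vanish A (res_module A K) (res_map A K) N i"
        unfolding eventually_sequentially by blast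
    qed
  next
    case False
    obtain s where s: "complexity A X = enat s" using reduce(3) by (cases "complexity A X") auto
    have "enat s - 1 = enat (s - 1)" by (simp add: one_enat_def)
    \<comment> \<open>The drop is exactly one, so \<open>s - 1 < t\<close> and
      \<open>t \<le> s\<close> leave only \<open>s = t\<close>, and \<open>X\<close> may be inserted
      for the test module.\<close>
    then have "s - 1 < t" using False reduce(7) cxK s by simp
    moreover have "t \<le> s" using reduce(11) s by simp
    ultimately have st: "s = t" by simp
    have "frc A X" by (rule frc.reduce[OF reduce(1-9)])
    then have "X \<in> frc_class A t" using s st unfolding frc_class_def by simp
    from reduce(13)[OF this] obtain I where I: "\<And>i. i \<ge> I \<Longrightarrow> ext_vanish A ?F ?d X i"
      unfolding eventually_sequentially by blast
    have "resolution A ?L (\<lambda>n. free_module A (fst (min_res A ?L) n)) (res_map A ?L) (snd (snd (min_res A ?L)))"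
      by (rule minimalD(1)[OF min_res_props(1)[OF Lf]])
    from rank_le_sum[OF Xm min_res_props(1)[OF X] cone[unfolded res_module_def[abs_def]]
        this[unfolded L res_module_def[abs_def]] I[unfolded res_module_def[abs_def]]]
    obtain k where "\<And>i. betti A X i \<le> (\<Sum>j<k. betti A ?L (i + j * Suc m))"
      unfolding betti_eq_rank[OF X] betti_eq_rank[OF Lf] unfolding L res_module_def[abs_def] by blast
    then have "complexity A X \<le> complexity A ?L" by (rule complexity_le)
    then show False using False cxK reduce(11) by auto
  qed
qed

end

theorem theorem3p2:
  fixes A :: "('a, 'r) ring_scheme"
    and M :: "('a, 'm, 'e) module_scheme"
    and t :: nat
  assumes "noetherian_local_ring A"
    and "fin_gen A M"
    and "free_reducible_complexity A M"
    and "t \<ge> 1"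
    and "\<And>N :: 'a umodule. N \<in> frc_class A t \<Longrightarrow>
           \<forall>\<^sub>F i in sequentially. carrier (Ext A i M N) = {\<zero>\<^bsub>Ext A i M N\<^esub>}"
  shows "complexity A M < enat t"
proof (rule ccontr)
  interpret noeth_local A
    using assms(1) by (simp add: noeth_local_def noeth_local_axioms_def noetherian_local_ring_def)
  assume "\<not> complexity A M < enat t"
  \<comment> \<open>The induction runs over modules of the type used in \<open>frc\<close>, whereas
    \<open>M\<close> may have any element type.\<close>
  obtain X :: "'a umodule" where frc: "frc A X" and iso: "module_isomorphic A X M"
    using assms(3) unfolding free_reducible_complexity_def by blast
  note X = frc_fin_gen[OF frc]
  have "enat t \<le> complexity A X"
    using \<open>\<not> complexity A M < enat t\<close> complexity_iso[OF X assms(2) iso] by simp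
  moreover have "\<forall>\<^sub>F i in sequentially. ext_vanish A (res_module A X) (res_map A X) N i"
    if N: "N \<in> frc_class A t" for N
  proof -
    have Nm: "module A N" using N frc_fin_gen fin_gen_module unfolding frc_class_def by blast
    \<comment> \<open>Shifted by one because \<open>ext_vanish\<close> at index \<open>i\<close>
      concerns degree \<open>Suc i\<close>.\<close>
    have "\<forall>\<^sub>F i in sequentially. carrier (Ext A (Suc i) M N) = {\<zero>\<^bsub>Ext A (Suc i) M N\<^esub>}"
      using assms(5)[OF N] by (rule eventually_sequentially_Suc[THEN iffD2])
    then show ?thesis
    proof (rule eventually_mono)
      fix i assume "carrier (Ext A (Suc i) M N) = {\<zero>\<^bsub>Ext A (Suc i) M N\<^esub>}"
      then have "ext_vanish A (res_module A M) (res_map A M) N i"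
        by (rule ext_vanish_of_Ext[OF min_res_props(3)[OF assms(2)] Nm min_res_props(4)[OF assms(2)]])
      then show "ext_vanish A (res_module A X) (res_map A X) N i"
        by (rule ext_vanish_iso[OF assms(2) X iso Nm])
    qed
  qed
  ultimately show False
    using frc assms(4) by (intro frc_no_ext_vanishing)
qed

end
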